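(* Let $b,c$ be real numbers, $c\neq 0$, and consider the family $\dot x=y$, $\dot y=b\left(\frac{s+4}{2}\right)y-\frac{3}{2}bx-cx^{2}$ with $s=-4$, that is, $$\dot x=y,\qquad \dot y=-\frac{3}{2}bx-cx^{2}.$$ The following statements hold. (1) The dynamical system is Hamiltonian with one degree of freedom and with polynomial first integral $$H=H(x,y)=\frac{y^{2}}{2}+\frac{c}{3}x^{3}+\frac{3}{4}bx^{2}.$$ (2) The integral curve of the Hamiltonian vector field is given in terms of the Weierstrass $\wp$-function. (3) The differential Galois group associated to the foliation is isomorphic to $\mathbb{Z}_2$ (the group with two elements). (4) The connected identity component of the differential Galois group of the first variational equation along any particular solution is an abelian group.
   Context: Hamiltonian with one degree of freedom means $\dot x=\partial H/\partial y$, $\dot y=-\partial H/\partial x$. The Weierstrass function $x=\wp(t;g_2,g_3)$ with invariants $g_2,g_3$ is the elliptic function that satisfies $\dot x^{2}=4x^{3}-g_2x-g_3$. The foliation associated to a vector field $\dot x=P$, $\dot y=Q$ is the equation $y'=Q/P$, $'=d/dx$, considered over the differential field $\mathbb{C}(x)$. For a differential field $K$ and a Picard–Vessiot extension $L/K$ (the extension of $K$ by the solutions, having the same field of constants as $K$), the differential Galois group $DGal(L/K)$ is the group of automorphisms of $L$ that commute with the derivation and fix every element of $K$. For a particular solution $(x_0(t),\dot x_0(t))$, the first variational equation is the linear system $\dot\xi=DX(x_0(t),\dot x_0(t))\,\xi$, where $DX$ is the Jacobian matrix of the vector field. *)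

theory Defs
  imports
    "HOL-Complex_Analysis.Complex_Analysis"
    "HOL-Computational_Algebra.Computational_Algebra"
    "HOL-Algebra.Bij"
    "HOL-Algebra.Elementary_Groups"
begin

section \<open>Planar vector fields\<close>

text \<open>
  The family and its Hamiltonian are defined over an arbitrary field, because they are used over
  the reals, over the complex numbers, and (for the foliation) over differential fields.
\<close>

definition vfield :: "'a::field \<Rightarrow> 'a \<Rightarrow> 'a \<Rightarrow> 'a \<times> 'a \<Rightarrow> 'a \<times> 'a" where
  "vfield b c s = (\<lambda>(x, y). (y, b * ((s + 4) / 2) * y - 3 / 2 * b * x - c * x ^ 2))"

definition ham :: "'a::field \<Rightarrow> 'a \<Rightarrow> 'a \<times> 'a \<Rightarrow> 'a" where
  "ham b c = (\<lambda>(x, y). y ^ 2 / 2 + c / 3 * x ^ 3 + 3 / 4 * b * x ^ 2)"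

text \<open>Time is real or complex; over the complex numbers the derivatives are complex derivatives.\<close>

definition integral_curve_on ::
  "('a::real_normed_field \<times> 'a \<Rightarrow> 'a \<times> 'a) \<Rightarrow> 'a set \<Rightarrow> ('a \<Rightarrow> 'a \<times> 'a) \<Rightarrow> bool" where
  "integral_curve_on X T \<gamma> \<longleftrightarrow>
     (\<forall>t\<in>T. ((\<lambda>u. fst (\<gamma> u)) has_field_derivative fst (X (\<gamma> t))) (at t) \<and>
            ((\<lambda>u. snd (\<gamma> u)) has_field_derivative snd (X (\<gamma> t))) (at t))"

definition hamiltonian_system ::
  "('a::real_normed_field \<times> 'a \<Rightarrow> 'a) \<Rightarrow> ('a \<times> 'a \<Rightarrow> 'a \<times> 'a) \<Rightarrow> bool" where
  "hamiltonian_system H X \<longleftrightarrow>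
     (\<forall>x y. ((\<lambda>v. H (x, v)) has_field_derivative fst (X (x, y))) (at y) \<and>
            ((\<lambda>u. H (u, y)) has_field_derivative - snd (X (x, y))) (at x))"

definition polynomial_in_two_variables :: "('a::comm_ring_1 \<times> 'a \<Rightarrow> 'a) \<Rightarrow> bool" where
  "polynomial_in_two_variables H \<longleftrightarrow>
     (\<exists>p :: 'a poly poly. \<forall>x y. H (x, y) = poly (poly p [:y:]) x)"

definition first_integral ::
  "('a::real_normed_field \<times> 'a \<Rightarrow> 'a) \<Rightarrow> ('a \<times> 'a \<Rightarrow> 'a \<times> 'a) \<Rightarrow> bool" where
  "first_integral H X \<longleftrightarrow>
     \<not> H constant_on UNIV \<and>
     (\<forall>T \<gamma>. open T \<longrightarrow> connected T \<longrightarrow> integral_curve_on X T \<gamma> \<longrightarrow>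
            (\<lambda>t. H (\<gamma> t)) constant_on T)"

definition jacobian ::
  "(complex \<times> complex \<Rightarrow> complex \<times> complex) \<Rightarrow> complex \<times> complex \<Rightarrow> complex ^ 2 ^ 2" where
  "jacobian X = (\<lambda>(x, y).
     vector [vector [deriv (\<lambda>u. fst (X (u, y))) x, deriv (\<lambda>v. fst (X (x, v))) y],
             vector [deriv (\<lambda>u. snd (X (u, y))) x, deriv (\<lambda>v. snd (X (x, v))) y]])"


section \<open>The Weierstrass function with given invariants\<close>

definition elliptic_function :: "(complex \<Rightarrow> complex) \<Rightarrow> bool" where
  "elliptic_function f \<longleftrightarrow>
     f nicely_meromorphic_on UNIV \<and>
     (\<exists>w1 w2. w1 \<noteq> 0 \<and> w2 / w1 \<notin> \<real> \<and> (\<forall>z. f (z + w1) = f z \<and> f (z + w2) = f z))"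

text \<open>
  The differential equation determines a non-constant meromorphic solution only up to translation;
  the pole at the origin fixes the translation. When the discriminant \<open>g2^3 - 27 g3^2\<close>
  vanishes, the function so described is the usual degenerate (trigonometric or rational) one.
\<close>

definition is_weierstrass :: "complex \<Rightarrow> complex \<Rightarrow> (complex \<Rightarrow> complex) \<Rightarrow> bool" where
  "is_weierstrass g2 g3 P \<longleftrightarrow>
     P nicely_meromorphic_on UNIV \<and> is_pole P 0 \<and>
     (\<forall>z. \<not> is_pole P z \<longrightarrow> (deriv P z) ^ 2 = 4 * (P z) ^ 3 - g2 * P z - g3)"

definition weierstrass :: "complex \<Rightarrow> complex \<Rightarrow> complex \<Rightarrow> complex" where
  "weierstrass g2 g3 = (THE P. is_weierstrass g2 g3 P)"


text \<open>
  Substituting \<open>x = - (6/c) u - 3b/(4c)\<close> into \<open>x'^2 = 2h - (2c/3) x^3 - (3/2) b x^2\<close> gives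
  \<open>u'^2 = 4u^3 - g2 u - g3\<close> with the following invariants; \<open>h\<close> is the energy and \<open>t0\<close> the time shift.
\<close>

definition inv_g2 :: "real \<Rightarrow> complex" where
  "inv_g2 b = complex_of_real (3 * b ^ 2 / 16)"

definition inv_g3 :: "real \<Rightarrow> real \<Rightarrow> complex \<Rightarrow> complex" where
  "inv_g3 b c h = complex_of_real (b ^ 3 / 64) - complex_of_real (c ^ 2 / 18) * h"

abbreviation energy_weierstrass :: "real \<Rightarrow> real \<Rightarrow> complex \<Rightarrow> complex \<Rightarrow> complex" where
  "energy_weierstrass b c h \<equiv> weierstrass (inv_g2 b) (inv_g3 b c h)"

definition weierstrass_curve ::
  "real \<Rightarrow> real \<Rightarrow> complex \<Rightarrow> complex \<Rightarrow> complex \<Rightarrow> complex \<times> complex" where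
  "weierstrass_curve b c h t0 = (\<lambda>t.
     (- complex_of_real (6 / c) * energy_weierstrass b c h (t - t0) - complex_of_real (3 * b / (4 * c)),
      - complex_of_real (6 / c) * deriv (energy_weierstrass b c h) (t - t0)))"


section \<open>Differential fields and differential Galois groups\<close>

text \<open>
  Differential fields are subsets of an ambient field type; the derivation is only constrained on
  the subset.
\<close>

definition subfield_set :: "'l::field set \<Rightarrow> bool" where
  "subfield_set F \<longleftrightarrow>
     0 \<in> F \<and> 1 \<in> F \<and>
     (\<forall>u\<in>F. \<forall>v\<in>F. u + v \<in> F \<and> u * v \<in> F) \<and> (\<forall>u\<in>F. - u \<in> F \<and> inverse u \<in> F)"

definition differential_field :: "('l::field \<Rightarrow> 'l) \<Rightarrow> 'l set \<Rightarrow> bool" where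
  "differential_field D F \<longleftrightarrow>
     subfield_set F \<and> D ` F \<subseteq> F \<and>
     (\<forall>u\<in>F. \<forall>v\<in>F. D (u + v) = D u + D v \<and> D (u * v) = D u * v + u * D v)"

definition field_of_constants :: "('l::field \<Rightarrow> 'l) \<Rightarrow> 'l set \<Rightarrow> 'l set" where
  "field_of_constants D F = {u \<in> F. D u = 0}"

definition ring_hom_set :: "'k::field set \<Rightarrow> ('k \<Rightarrow> 'l::field) \<Rightarrow> bool" where
  "ring_hom_set F f \<longleftrightarrow>
     f 1 = 1 \<and> (\<forall>u\<in>F. \<forall>v\<in>F. f (u + v) = f u + f v \<and> f (u * v) = f u * f v)"

definition differential_embedding ::
  "('k::field \<Rightarrow> 'l::field) \<Rightarrow> ('k \<Rightarrow> 'k) \<Rightarrow> 'k set \<Rightarrow> ('l \<Rightarrow> 'l) \<Rightarrow> 'l set \<Rightarrow> bool" where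
  "differential_embedding \<iota> DK K DL L \<longleftrightarrow>
     differential_field DK K \<and> differential_field DL L \<and>
     \<iota> ` K \<subseteq> L \<and> ring_hom_set K \<iota> \<and> (\<forall>u\<in>K. \<iota> (DK u) = DL (\<iota> u))"

text \<open>\<open>L\<close> is the extension of \<open>K\<close> by the solutions in \<open>S\<close>, without new constants.\<close>

definition picard_vessiot_by :: "('l::field \<Rightarrow> 'l) \<Rightarrow> 'l set \<Rightarrow> 'l set \<Rightarrow> 'l set \<Rightarrow> bool" where
  "picard_vessiot_by D K L S \<longleftrightarrow>
     differential_field D K \<and> differential_field D L \<and> K \<subseteq> L \<and> S \<subseteq> L \<and>
     L = subfield_set hull (K \<union> S) \<and>
     field_of_constants D L = field_of_constants D K"

definition DGal :: "('l::field \<Rightarrow> 'l) \<Rightarrow> 'l set \<Rightarrow> 'l set \<Rightarrow> ('l \<Rightarrow> 'l) monoid" where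
  "DGal D K L = (BijGroup L)
     \<lparr>carrier := {\<sigma> \<in> Bij L. ring_hom_set L \<sigma> \<and>
                   (\<forall>u\<in>L. \<sigma> (D u) = D (\<sigma> u)) \<and> (\<forall>u\<in>K. \<sigma> u = u)}\<rparr>"


section \<open>The foliation\<close>

text \<open>The derivation \<open>d/dx\<close>; it is independent of the representative chosen, as the lemma shows.\<close>

definition fract_deriv :: "'a::idom poly fract \<Rightarrow> 'a poly fract" where
  "fract_deriv r =
     (let (p, q) = (SOME (p, q). q \<noteq> 0 \<and> r = Fract p q)
      in Fract (pderiv p * q - p * pderiv q) (q * q))"

lemma fract_deriv_Fract:
  fixes a b :: "'a::idom poly"
  assumes "b \<noteq> 0"
  shows "fract_deriv (Fract a b) = Fract (pderiv a * b - a * pderiv b) (b * b)"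
proof -
  obtain c d where cd: "(SOME (p, q). q \<noteq> 0 \<and> Fract a b = Fract p q) = (c, d)"
    by (meson surj_pair)
  have "case (SOME (p, q). q \<noteq> 0 \<and> Fract a b = Fract p q) of
          (p, q) \<Rightarrow> q \<noteq> 0 \<and> Fract a b = Fract p q"
    by (rule someI[of _ "(a, b)"]) (simp add: assms)
  then have d: "d \<noteq> 0" and "Fract a b = Fract c d"
    by (simp_all add: cd)
  then have e: "a * d = c * b"
    using assms by (simp add: eq_fract)
  have e': "a * pderiv d + d * pderiv a = c * pderiv b + b * pderiv c"
    using arg_cong[OF e, of pderiv] by (simp add: pderiv_mult)
  have "(pderiv a * b - a * pderiv b) * (d * d)
        = (a * pderiv d + d * pderiv a) * (b * d) - (a * d) * (pderiv d * b + pderiv b * d)"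
    by (simp add: algebra_simps)
  also have "\<dots> = (c * pderiv b + b * pderiv c) * (b * d) - (c * b) * (pderiv d * b + pderiv b * d)"
    by (simp only: e e')
  also have "\<dots> = (pderiv c * d - c * pderiv d) * (b * b)"
    by (simp add: algebra_simps)
  finally have "Fract (pderiv a * b - a * pderiv b) (b * b)
                = Fract (pderiv c * d - c * pderiv d) (d * d)"
    using assms d by (simp add: eq_fract)
  then show ?thesis
    by (simp add: fract_deriv_def cd)
qed

abbreviation ratconst :: "complex \<Rightarrow> complex poly fract" where
  "ratconst z \<equiv> to_fract [:z:]"

abbreviation ratvar :: "complex poly fract" where
  "ratvar \<equiv> to_fract [:0, 1:]"

text \<open>The equation \<open>y' = Q/P\<close> for the vector field \<open>X = (P, Q)\<close>.\<close>

definition foliation_solution ::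
  "('l::field \<Rightarrow> 'l) \<Rightarrow> ('l \<times> 'l \<Rightarrow> 'l \<times> 'l) \<Rightarrow> 'l \<Rightarrow> 'l \<Rightarrow> bool" where
  "foliation_solution D X x y \<longleftrightarrow>
     fst (X (x, y)) \<noteq> 0 \<and> D y = snd (X (x, y)) / fst (X (x, y))"

text \<open>
  The solutions of the foliation form a one-parameter family, the parameter being the value
  \<open>h\<close> of the first integral; the solutions in question are those of one level \<open>h\<close>
  (adjoining solutions of different levels gives a different extension for each set of levels).
  \<open>\<iota>\<close> embeds the rational functions into the differential field \<open>L\<close>.
\<close>

definition leaf_solutions ::
  "complex \<Rightarrow> complex \<Rightarrow> complex \<Rightarrow> complex \<Rightarrow>
   (complex poly fract \<Rightarrow> 'l::field) \<Rightarrow> ('l \<Rightarrow> 'l) \<Rightarrow> 'l set \<Rightarrow> 'l set" where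
  "leaf_solutions b c s h \<iota> D L =
     {y \<in> L. foliation_solution D
               (vfield (\<iota> (ratconst b)) (\<iota> (ratconst c)) (\<iota> (ratconst s))) (\<iota> ratvar) y \<and>
             ham (\<iota> (ratconst b)) (\<iota> (ratconst c)) (\<iota> ratvar, y) = \<iota> (ratconst h)}"

definition foliation_extension ::
  "complex \<Rightarrow> complex \<Rightarrow> complex \<Rightarrow> complex \<Rightarrow>
   (complex poly fract \<Rightarrow> 'l::field) \<Rightarrow> ('l \<Rightarrow> 'l) \<Rightarrow> 'l set \<Rightarrow> bool" where
  "foliation_extension b c s h \<iota> D L \<longleftrightarrow>
     differential_embedding \<iota> fract_deriv UNIV D L \<and>
     leaf_solutions b c s h \<iota> D L \<noteq> {} \<and>
     picard_vessiot_by D (range \<iota>) L (leaf_solutions b c s h \<iota> D L)"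


section \<open>Linear systems and the identity component\<close>

definition entries :: "'l ^ 'n ^ 'm \<Rightarrow> 'l set" where
  "entries M = {M $ i $ j | i j. True}"

definition fundamental_matrix ::
  "('l::field \<Rightarrow> 'l) \<Rightarrow> 'l set \<Rightarrow> 'l ^ 'n ^ 'n \<Rightarrow> 'l ^ 'n ^ 'n \<Rightarrow> bool" where
  "fundamental_matrix D L A \<Phi> \<longleftrightarrow>
     entries \<Phi> \<subseteq> L \<and> invertible \<Phi> \<and> map_matrix D \<Phi> = A ** \<Phi>"

definition picard_vessiot_linear ::
  "('l::field \<Rightarrow> 'l) \<Rightarrow> 'l set \<Rightarrow> 'l set \<Rightarrow> 'l ^ 'n ^ 'n \<Rightarrow> 'l ^ 'n ^ 'n \<Rightarrow> bool" where
  "picard_vessiot_linear D K L A \<Phi> \<longleftrightarrow>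
     entries A \<subseteq> K \<and> fundamental_matrix D L A \<Phi> \<and> picard_vessiot_by D K L (entries \<Phi>)"

inductive_set matrix_polynomials :: "'l::field set \<Rightarrow> ('l ^ 'n ^ 'n \<Rightarrow> 'l) set"
  for C :: "'l set" where
  const: "a \<in> C \<Longrightarrow> (\<lambda>M. a) \<in> matrix_polynomials C"
| entry: "(\<lambda>M. M $ i $ j) \<in> matrix_polynomials C"
| add: "p \<in> matrix_polynomials C \<Longrightarrow> q \<in> matrix_polynomials C \<Longrightarrow>
        (\<lambda>M. p M + q M) \<in> matrix_polynomials C"
| mult: "p \<in> matrix_polynomials C \<Longrightarrow> q \<in> matrix_polynomials C \<Longrightarrow>
        (\<lambda>M. p M * q M) \<in> matrix_polynomials C"

definition zariski_topology :: "'l::field set \<Rightarrow> ('l ^ 'n ^ 'n) topology" where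
  "zariski_topology C =
     topology_generated_by {{M. p M \<noteq> 0} | p. p \<in> matrix_polynomials C}"

text \<open>
  A differential automorphism \<open>\<sigma>\<close> is represented by the constant matrix \<open>M\<close> with
  \<open>\<sigma>(\<Phi>) = \<Phi> M\<close>.
\<close>

definition galois_matrix :: "'l::field ^ 'n ^ 'n \<Rightarrow> ('l \<Rightarrow> 'l) \<Rightarrow> 'l ^ 'n ^ 'n" where
  "galois_matrix \<Phi> \<sigma> = matrix_inv \<Phi> ** map_matrix \<sigma> \<Phi>"

definition DGal_topology ::
  "('l::field \<Rightarrow> 'l) \<Rightarrow> 'l set \<Rightarrow> 'l set \<Rightarrow> 'l ^ 'n ^ 'n \<Rightarrow> ('l \<Rightarrow> 'l) topology" where
  "DGal_topology D K L \<Phi> =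
     pullback_topology (carrier (DGal D K L)) (galois_matrix \<Phi>)
       (zariski_topology (field_of_constants D L))"

definition identity_component ::
  "('l::field \<Rightarrow> 'l) \<Rightarrow> 'l set \<Rightarrow> 'l set \<Rightarrow> 'l ^ 'n ^ 'n \<Rightarrow> ('l \<Rightarrow> 'l) set" where
  "identity_component D K L \<Phi> =
     connected_component_of_set (DGal_topology D K L \<Phi>) \<one>\<^bsub>DGal D K L\<^esub>"


section \<open>The first variational equation\<close>

text \<open>
  Meromorphic functions on the connected time domain of a particular solution are represented by
  their Laurent expansions at a point \<open>t0\<close> of the domain. The base field is the field
  generated over the complex numbers by the two components of the particular solution.
\<close>

definition solution_field ::
  "(complex \<Rightarrow> complex \<times> complex) \<Rightarrow> complex \<Rightarrow> complex fls set" where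
  "solution_field \<gamma> t0 = subfield_set hull
     (range fls_const \<union>
      {laurent_expansion (\<lambda>t. fst (\<gamma> t)) t0, laurent_expansion (\<lambda>t. snd (\<gamma> t)) t0})"

definition variational_matrix ::
  "(complex \<times> complex \<Rightarrow> complex \<times> complex) \<Rightarrow> (complex \<Rightarrow> complex \<times> complex) \<Rightarrow>
   complex \<Rightarrow> complex fls ^ 2 ^ 2" where
  "variational_matrix X \<gamma> t0 =
     (\<chi> i j. laurent_expansion (\<lambda>t. jacobian X (\<gamma> t) $ i $ j) t0)"

end

theory Submission
  imports Defs
begin

text \<open>
  At its pole, \<open>1 / \<wp>\<close> has a germ \<open>f = w\<^sup>2\<close> with \<open>w'\<^sup>2 = 1 - g2/4 w\<^sup>4 - g3/4 w\<^sup>6\<close>, which is obtained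
  by separation of variables. The germ satisfies \<open>f'' = 2 - 3/2 g2 f\<^sup>2 - 2 g3 f\<^sup>3\<close>, and uniqueness for
  this equation gives the duplication formula \<open>f (2 z) = N (f z) / D (f z)\<close>. Its iterates, written in
  homogeneous form, represent \<open>f\<close> as a quotient of holomorphic functions on balls of radius
  \<open>2\<^sup>n r\<close>, so that \<open>\<wp>\<close> exists for all invariants, without reference to a lattice. The set of values
  of \<open>\<wp>\<close> is open, and closed among the points that are not double roots of the cubic, because a
  local solution through such a point is a translate of \<open>\<wp>\<close>. Hence \<open>\<wp>\<close> attains all simple roots;
  at these places \<open>\<wp>'\<close> vanishes and \<open>\<wp>\<close> is symmetric, which makes them half periods. For the same
  reason every integral curve that is not an equilibrium is a translate of \<open>\<wp>\<close>.

  The solutions of the foliation on a level of the energy are the two square roots of a cubic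
  polynomial in \<open>x\<close>, which is not a square in the field of rational functions.

  Along a particular solution that is not an equilibrium, its velocity solves the variational
  equation over the base field, so the Galois matrices are unimodular and fix a vector; at an
  equilibrium they commute with a constant matrix that is not scalar. In both cases the whole
  Galois group is abelian.
\<close>

text \<open>Its first-order form is ill suited to uniqueness: it gives the derivative only up to
  sign and has constant solutions at the roots of the cubic. Differentiating once gives a
  second-order equation with polynomial right-hand side, whose solutions are determined by initial
  values; the step is legitimate for nonconstant solutions only, hence the many side conditions of
  that kind. At the pole and at a simple root the first-order equation is branched, and substituting
  a square removes the branching. Duplication serves as continuation because it doubles the radius
  of definition by polynomials only; in homogeneous form all divisions are postponed to the end, so
  poles met on the way do no harm. In the Galois part the field containing \<open>L\<close> is
  arbitrary, so even its characteristic must be controlled through the embedding of the rational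
  functions.\<close>

no_notation fps_nth (infixl "$" 75)

section \<open>The Hamiltonian\<close>

lemma vfield_neg4:
  "vfield (b :: 'a :: field_char_0) c (- 4) (x, y) = (y, - (3 / 2) * b * x - c * x ^ 2)"
  by (simp add: vfield_def)

lemma hamiltonian_system_ham:
  fixes b c :: "'a :: real_normed_field"
  shows "hamiltonian_system (ham b c) (vfield b c (- 4))"
  unfolding hamiltonian_system_def vfield_neg4 ham_def
  by (auto intro!: derivative_eq_intros simp: field_simps power2_eq_square)

lemma polynomial_ham:
  fixes b c :: "'a :: field_char_0"
  shows "polynomial_in_two_variables (ham b c)"
  unfolding polynomial_in_two_variables_def
  \<comment> \<open>The outer variable of the bivariate polynomial is \<open>y\<close> and the inner
    one is \<open>x\<close>, so the list runs over the powers of \<open>y\<close>.\<close>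
  by (rule exI[of _ "[: [:0, 0, 3/4 * b, c/3:], 0, [:1/2:] :]"])
    (simp add: ham_def algebra_simps power2_eq_square power3_eq_cube)

lemma ham_along_curve:
  fixes b c :: "'a :: real_normed_field"
  assumes "integral_curve_on (vfield b c (- 4)) T \<gamma>" "t \<in> T"
  shows "((\<lambda>u. ham b c (\<gamma> u)) has_field_derivative 0) (at t)"
proof -
  define x y where "x = (\<lambda>u. fst (\<gamma> u))" and "y = (\<lambda>u. snd (\<gamma> u))"
  then have g: "\<gamma> = (\<lambda>u. (x u, y u))"
    by simp
  have x: "(x has_field_derivative y t) (at t)"
    and y: "(y has_field_derivative - (3 / 2) * b * x t - c * x t ^ 2) (at t)"
    using assms by (auto simp: integral_curve_on_def g vfield_neg4)
  show ?thesis
    unfolding g ham_def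
    by (auto intro!: derivative_eq_intros x y simp: field_simps power2_eq_square)
qed

text \<open>The type class covers real and complex time at once.\<close>

lemma ham_constant_on_curve:
  fixes b c :: "'a :: {real_normed_field, euclidean_space}"
  assumes "open T" "connected T" "integral_curve_on (vfield b c (- 4)) T \<gamma>"
  shows "(\<lambda>t. ham b c (\<gamma> t)) constant_on T"
proof -
  have d: "((\<lambda>u. ham b c (\<gamma> u)) has_field_derivative 0) (at t)" if "t \<in> T" for t
    by (rule ham_along_curve[OF assms(3) that])
  then have "continuous_on T (\<lambda>u. ham b c (\<gamma> u))"
    by (intro DERIV_continuous_on) (blast intro: has_field_derivative_at_within)
  then show ?thesis
    using DERIV_zero_connected_constant_on[OF assms(2,1) finite.emptyI] d by simp
qed

lemma first_integral_ham:
  fixes b c :: "'a :: {real_normed_field, euclidean_space}"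
  shows "first_integral (ham b c) (vfield b c (- 4))"
proof -
  have "ham b c (0, 0) = 0" "ham b c (0, 1) = 1/2"
    by (simp_all add: ham_def)
  then have "\<not> ham b c constant_on UNIV"
    unfolding constant_on_def by (metis UNIV_I divide_eq_0_iff zero_neq_numeral zero_neq_one)
  then show ?thesis
    by (simp add: first_integral_def ham_constant_on_curve)
qed

section \<open>Differential fields and their automorphisms\<close>

lemma subfield_set_diff: "subfield_set F \<Longrightarrow> u \<in> F \<Longrightarrow> v \<in> F \<Longrightarrow> u - v \<in> F"
  unfolding subfield_set_def by (metis add_uminus_conv_diff)

lemma subfield_set_divide: "subfield_set F \<Longrightarrow> u \<in> F \<Longrightarrow> v \<in> F \<Longrightarrow> u / v \<in> F"
  unfolding subfield_set_def by (metis divide_inverse)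

lemma subfield_set_add: "subfield_set F \<Longrightarrow> u \<in> F \<Longrightarrow> v \<in> F \<Longrightarrow> u + v \<in> F"
  and subfield_set_mult: "subfield_set F \<Longrightarrow> u \<in> F \<Longrightarrow> v \<in> F \<Longrightarrow> u * v \<in> F"
  and subfield_set_uminus: "subfield_set F \<Longrightarrow> u \<in> F \<Longrightarrow> - u \<in> F"
  and subfield_set_inverse: "subfield_set F \<Longrightarrow> u \<in> F \<Longrightarrow> inverse u \<in> F"
  and subfield_set_0: "subfield_set F \<Longrightarrow> 0 \<in> F"
  and subfield_set_1: "subfield_set F \<Longrightarrow> 1 \<in> F"
  by (auto simp: subfield_set_def)

lemmas subfield_set_closed = subfield_set_diff subfield_set_divide subfield_set_add
  subfield_set_mult subfield_set_uminus subfield_set_inverse subfield_set_0 subfield_set_1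

lemma subfield_set_of_nat: "subfield_set F \<Longrightarrow> of_nat n \<in> F"
  by (induction n) (auto intro: subfield_set_closed)

lemma subfield_set_hull [intro]: "subfield_set (subfield_set hull S)"
  by (rule hull_in) (auto simp: subfield_set_def)

lemma ring_hom_set_facts:
  assumes "ring_hom_set F f" "subfield_set F"
  shows ring_hom_set_0: "f 0 = 0"
    and ring_hom_set_1: "f 1 = 1"
    and ring_hom_set_add: "u \<in> F \<Longrightarrow> v \<in> F \<Longrightarrow> f (u + v) = f u + f v"
    and ring_hom_set_mult: "u \<in> F \<Longrightarrow> v \<in> F \<Longrightarrow> f (u * v) = f u * f v"
    and ring_hom_set_uminus: "u \<in> F \<Longrightarrow> f (- u) = - f u"
    and ring_hom_set_diff: "u \<in> F \<Longrightarrow> v \<in> F \<Longrightarrow> f (u - v) = f u - f v"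
    and ring_hom_set_inverse: "u \<in> F \<Longrightarrow> f (inverse u) = inverse (f u)"
    and ring_hom_set_divide: "u \<in> F \<Longrightarrow> v \<in> F \<Longrightarrow> f (u / v) = f u / f v"
    and ring_hom_set_inj: "inj_on f F"
proof -
  note F = subfield_set_closed[OF assms(2)]
  show add: "f (u + v) = f u + f v" if "u \<in> F" "v \<in> F" for u v
    using assms(1) that by (auto simp: ring_hom_set_def)
  show mult: "f (u * v) = f u * f v" if "u \<in> F" "v \<in> F" for u v
    using assms(1) that by (auto simp: ring_hom_set_def)
  show 1: "f 1 = 1"
    using assms(1) by (auto simp: ring_hom_set_def)
  show 0: "f 0 = 0"
    using add[OF F(7) F(7)] by (metis add_0_right add_cancel_right_right)
  show um: "f (- u) = - f u" if "u \<in> F" for u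
    using add[of u "- u"] F that 0 by (simp add: eq_neg_iff_add_eq_0 add.commute)
  show diff: "f (u - v) = f u - f v" if "u \<in> F" "v \<in> F" for u v
    using add[of u "- v"] um[of v] F that by simp
  show inv: "f (inverse u) = inverse (f u)" if "u \<in> F" for u
  proof (cases "u = 0")
    case False
    then have "f u * f (inverse u) = 1"
      using mult[of u "inverse u"] F that 1 by simp
    then show ?thesis
      by (simp add: inverse_unique)
  qed (simp add: 0)
  show "f (u / v) = f u / f v" if "u \<in> F" "v \<in> F" for u v
    using mult[of u "inverse v"] inv[of v] F that by (simp add: divide_inverse)
  show "inj_on f F"
  proof (rule inj_onI)
    fix u v assume uv: "u \<in> F" "v \<in> F" "f u = f v"
    show "u = v"
    proof (rule ccontr)
      assume "u \<noteq> v"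
      then have "f (u - v) * f (inverse (u - v)) = 1"
        using mult[of "u - v" "inverse (u - v)"] F uv 1 by simp
      then show False
        using diff uv by simp
    qed
  qed
qed

lemma ring_hom_set_of_nat:
  assumes "ring_hom_set F f" "subfield_set F"
  shows "f (of_nat n) = of_nat n"
  using assms subfield_set_of_nat[OF assms(2)] subfield_set_1[OF assms(2)]
  by (induction n) (auto simp: ring_hom_set_facts)

lemma ring_hom_set_numeral:
  assumes "ring_hom_set F f" "subfield_set F"
  shows "f (numeral n) = numeral n"
  using ring_hom_set_of_nat[OF assms, of "numeral n"] by simp

lemma ring_hom_set_image_subfield:
  assumes "ring_hom_set F f" "subfield_set F"
  shows "subfield_set (f ` F)"
proof -
  note h = ring_hom_set_facts[OF assms] and F = subfield_set_closed[OF assms(2)]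
  have "0 \<in> f ` F" "1 \<in> f ` F"
    using imageI[OF F(7), of f] imageI[OF F(8), of f] h(1,2) by simp_all
  moreover have "f u + f v \<in> f ` F" "f u * f v \<in> f ` F" if "u \<in> F" "v \<in> F" for u v
    using imageI[OF F(3)[OF that], of f] imageI[OF F(4)[OF that], of f] h(3,4)[OF that] by simp_all
  moreover have "- f u \<in> f ` F" "inverse (f u) \<in> f ` F" if "u \<in> F" for u
    using imageI[OF F(5)[OF that], of f] imageI[OF F(6)[OF that], of f] h(5)[OF that] h(7)[OF that]
    by simp_all
  ultimately show ?thesis
    by (auto simp: subfield_set_def)
qed

lemma ring_hom_set_eq_subfield:
  assumes "ring_hom_set L f" "ring_hom_set L g" "subfield_set L"
  shows "subfield_set {u \<in> L. f u = g u}"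
  unfolding subfield_set_def
  by (auto simp: subfield_set_closed ring_hom_set_facts[OF assms(1,3)]
      ring_hom_set_facts[OF assms(2,3)] assms(3))

text \<open>The equalizer of two homomorphisms is a subfield, so agreement on generators suffices.
  Automorphisms are identified in this way from their action on the adjoined solutions.\<close>

lemma ring_hom_set_eq_on_hull:
  assumes "ring_hom_set L f" "ring_hom_set L g" "subfield_set L" "L = subfield_set hull S"
    and "\<And>u. u \<in> S \<Longrightarrow> f u = g u" "u \<in> L"
  shows "f u = g u"
proof -
  have "S \<subseteq> L"
    unfolding assms(4) by (rule hull_subset)
  then have "subfield_set hull S \<subseteq> {u \<in> L. f u = g u}"
    by (intro hull_minimal ring_hom_set_eq_subfield assms(1-3)) (use assms in auto)
  with assms show ?thesis by auto
qed

section \<open>Derivations and constants\<close>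

lemma derivation_facts:
  assumes "differential_field D F"
  shows differential_field_subfield: "subfield_set F"
    and derivation_closed: "u \<in> F \<Longrightarrow> D u \<in> F"
    and derivation_add: "u \<in> F \<Longrightarrow> v \<in> F \<Longrightarrow> D (u + v) = D u + D v"
    and derivation_mult: "u \<in> F \<Longrightarrow> v \<in> F \<Longrightarrow> D (u * v) = D u * v + u * D v"
    and derivation_0: "D 0 = 0"
    and derivation_1: "D 1 = 0"
    and derivation_uminus: "u \<in> F \<Longrightarrow> D (- u) = - D u"
    and derivation_diff: "u \<in> F \<Longrightarrow> v \<in> F \<Longrightarrow> D (u - v) = D u - D v"
    and derivation_inverse: "u \<in> F \<Longrightarrow> D (inverse u) = - (D u / u\<^sup>2)"
proof -
  show S: "subfield_set F"
    using assms by (auto simp: differential_field_def)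
  note F = subfield_set_closed[OF S]
  show "D u \<in> F" if "u \<in> F" for u
    using assms that by (auto simp: differential_field_def)
  show add: "D (u + v) = D u + D v" if "u \<in> F" "v \<in> F" for u v
    using assms that by (auto simp: differential_field_def)
  show mult: "D (u * v) = D u * v + u * D v" if "u \<in> F" "v \<in> F" for u v
    using assms that by (auto simp: differential_field_def)
  show 0: "D 0 = 0"
    using add[OF F(7) F(7)] by (metis add_0_right add_cancel_right_right)
  show 1: "D 1 = 0"
    using mult[OF F(8) F(8)] by (metis add_cancel_right_right mult_1 mult_1_right)
  show um: "D (- u) = - D u" if "u \<in> F" for u
    using add[of u "- u"] F that 0 by (simp add: eq_neg_iff_add_eq_0 add.commute)
  show "D (u - v) = D u - D v" if "u \<in> F" "v \<in> F" for u v
    using add[of u "- v"] um[of v] F that by simp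
  show "D (inverse u) = - (D u / u\<^sup>2)" if "u \<in> F" for u
  proof (cases "u = 0")
    case False
    then have "D u * inverse u + u * D (inverse u) = 0"
      using mult[of u "inverse u"] F that 1 by simp
    with False show ?thesis
      by (simp add: field_simps power2_eq_square eq_neg_iff_add_eq_0)
  qed (simp add: 0)
qed

text \<open>By the sum, product and quotient rules the elements whose derivative stays in the hull
  form a subfield; closure under \<open>D\<close> thus needs checking on generators only.\<close>

lemma differential_field_hull:
  assumes "differential_field D UNIV" and "D ` S \<subseteq> subfield_set hull S"
  shows "differential_field D (subfield_set hull S)"
proof -
  define H where "H = subfield_set hull S"
  note H = subfield_set_closed[OF subfield_set_hull[of S], folded H_def]
  note d = derivation_add[OF assms(1) UNIV_I UNIV_I] derivation_mult[OF assms(1) UNIV_I UNIV_I]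
    derivation_uminus[OF assms(1) UNIV_I] derivation_inverse[OF assms(1) UNIV_I]
    derivation_0[OF assms(1)] derivation_1[OF assms(1)]
  have "subfield_set {u \<in> H. D u \<in> H}"
    unfolding subfield_set_def by (auto simp: d power2_eq_square intro!: H)
  then have "H \<subseteq> {u \<in> H. D u \<in> H}"
    unfolding H_def
    by (rule hull_minimal[rotated]) (use assms(2) hull_subset[of S subfield_set] in auto)
  moreover have "subfield_set H"
    unfolding H_def by (rule subfield_set_hull)
  ultimately have "differential_field D H"
    by (auto simp: differential_field_def d)
  then show ?thesis
    by (simp add: H_def)
qed

lemma differential_field_fls: "differential_field fls_deriv (UNIV :: 'a :: field fls set)"
  by (auto simp: differential_field_def subfield_set_def)

lemma fls_deriv_eq_0_iff:
  fixes f :: "'a :: field_char_0 fls"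
  shows "fls_deriv f = 0 \<longleftrightarrow> (\<exists>a. f = fls_const a)"
proof
  assume *: "fls_deriv f = 0"
  have "f = fls_const (fls_nth f 0)"
  proof (rule fls_eqI)
    fix n
    \<comment> \<open>The coefficient of index \<open>n - 1\<close> of the derivative; in
      characteristic 0 only index 0 survives.\<close>
    have "of_int n * fls_nth f n = 0"
      using arg_cong[OF *, of "\<lambda>g. fls_nth g (n - 1)"] by simp
    then show "fls_nth f n = fls_nth (fls_const (fls_nth f 0)) n"
      by (auto simp: fls_const_nth)
  qed
  then show "\<exists>a. f = fls_const a" ..
qed auto

text \<open>Inside Laurent series every differential field above the scalars has exactly the scalars
  as constants. Extensions built there therefore satisfy the condition on constants
  automatically.\<close>

lemma field_of_constants_fls:
  assumes "range fls_const \<subseteq> F"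
  shows "field_of_constants fls_deriv F = range (fls_const :: 'a :: field_char_0 \<Rightarrow> _)"
  using assms by (auto simp: field_of_constants_def fls_deriv_eq_0_iff)


section \<open>The group of differential automorphisms\<close>

lemma in_DGal_iff:
  "\<sigma> \<in> carrier (DGal D K L) \<longleftrightarrow> \<sigma> \<in> Bij L \<and> ring_hom_set L \<sigma> \<and>
     (\<forall>u\<in>L. \<sigma> (D u) = D (\<sigma> u)) \<and> (\<forall>u\<in>K. \<sigma> u = u)"
  by (auto simp: DGal_def)

lemma DGal_mem:
  assumes "\<sigma> \<in> carrier (DGal D K L)"
  shows "ring_hom_set L \<sigma>" "u \<in> L \<Longrightarrow> \<sigma> u \<in> L" "u \<in> L \<Longrightarrow> \<sigma> (D u) = D (\<sigma> u)"
    "u \<in> K \<Longrightarrow> \<sigma> u = u" "\<sigma> \<in> extensional L" "bij_betw \<sigma> L L"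
  using assms Bij_imp_funcset[of \<sigma> L] by (auto simp: in_DGal_iff Bij_def)

lemma DGal_mult:
  assumes "\<sigma> \<in> carrier (DGal D K L)" "\<tau> \<in> carrier (DGal D K L)"
  shows "\<sigma> \<otimes>\<^bsub>DGal D K L\<^esub> \<tau> = compose L \<sigma> \<tau>"
  using assms by (auto simp: DGal_def BijGroup_def)

lemma DGal_one: "\<one>\<^bsub>DGal D K L\<^esub> = (\<lambda>x\<in>L. x)"
  by (simp add: DGal_def BijGroup_def)

lemma group_DGal:
  assumes L: "differential_field D L" and "K \<subseteq> L"
  shows "group (DGal D K L)"
proof -
  let ?C = "carrier (DGal D K L)"
  note F = subfield_set_closed[OF differential_field_subfield[OF L]]
    and D = derivation_closed[OF L]
  interpret B: group "BijGroup L"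
    by (rule group_BijGroup)
  have "subgroup ?C (BijGroup L)"
  proof (rule B.subgroupI)
    show "?C \<subseteq> carrier (BijGroup L)"
      by (auto simp: in_DGal_iff BijGroup_def)
    have "(\<lambda>x\<in>L. x) \<in> ?C"
      using \<open>K \<subseteq> L\<close> F D by (auto simp: in_DGal_iff id_Bij ring_hom_set_def)
    then show "?C \<noteq> {}" by blast
  next
    fix \<sigma> assume s: "\<sigma> \<in> ?C"
    note sm = DGal_mem[OF s]
    let ?t = "\<lambda>x\<in>L. inv_into L \<sigma> x"
    have B: "\<sigma> \<in> Bij L"
      using s by (simp add: in_DGal_iff)
    have t: "?t u \<in> L" "\<sigma> (?t u) = u" if "u \<in> L" for u
      using sm(6) that by (auto simp: bij_betw_def f_inv_into_f inv_into_into)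
    \<comment> \<open>Every law for the inverse map follows from the same law for
      \<open>\<sigma>\<close> by this characterization of its values.\<close>
    have u: "?t u = v" if "v \<in> L" "\<sigma> v = u" for u v
      using sm(6) that by (auto simp: bij_betw_def)
    have "?t \<in> ?C"
      unfolding in_DGal_iff ring_hom_set_def
    proof (intro conjI ballI)
      show "?t \<in> Bij L"
        by (rule restrict_inv_into_Bij[OF B])
      show "?t 1 = 1"
        by (rule u) (use sm(1) F in \<open>auto simp: ring_hom_set_def\<close>)
      show "?t (x + y) = ?t x + ?t y" if "x \<in> L" "y \<in> L" for x y
        by (rule u) (use sm(1) t that F in \<open>auto simp: ring_hom_set_def\<close>)
      show "?t (x * y) = ?t x * ?t y" if "x \<in> L" "y \<in> L" for x y
        by (rule u) (use sm(1) t that F in \<open>auto simp: ring_hom_set_def\<close>)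
      show "?t (D x) = D (?t x)" if "x \<in> L" for x
        by (rule u) (use sm(3) t that D in auto)
      show "?t x = x" if "x \<in> K" for x
        by (rule u) (use sm(4) that \<open>K \<subseteq> L\<close> in auto)
    qed
    then show "inv\<^bsub>BijGroup L\<^esub> \<sigma> \<in> ?C"
      by (simp add: inv_BijGroup[OF B])
  next
    fix \<sigma> \<tau> assume s: "\<sigma> \<in> ?C" and t: "\<tau> \<in> ?C"
    note sm = DGal_mem[OF s] and tm = DGal_mem[OF t]
    have B: "\<sigma> \<in> Bij L" "\<tau> \<in> Bij L"
      using s t by (simp_all add: in_DGal_iff)
    have "compose L \<sigma> \<tau> \<in> ?C"
      unfolding in_DGal_iff ring_hom_set_def compose_def
      using sm(1) tm(1) sm(2-4) tm(2-4) F D \<open>K \<subseteq> L\<close> compose_Bij[OF B]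
      by (auto simp: ring_hom_set_def compose_def subset_iff)
    then show "\<sigma> \<otimes>\<^bsub>BijGroup L\<^esub> \<tau> \<in> ?C"
      using B by (simp add: BijGroup_def)
  qed
  then have "group (BijGroup L\<lparr>carrier := ?C\<rparr>)"
    by (rule B.subgroup_imp_group)
  moreover have "BijGroup L\<lparr>carrier := ?C\<rparr> = DGal D K L"
    by (simp add: DGal_def)
  ultimately show ?thesis by simp
qed

section \<open>The identity component\<close>

text \<open>Multiplication need not be jointly continuous in a Zariski topology, so only left
  translations are used: translating the component by the inverse of one of its elements gives a
  connected set through the unit, hence a subset of the component.\<close>

lemma (in group) subgroup_connected_component_of_one:
  assumes T: "topspace T = carrier G"
    and cont: "\<And>g. g \<in> carrier G \<Longrightarrow> continuous_map T T (\<lambda>x. g \<otimes> x)"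
  shows "subgroup (connected_component_of_set T \<one>) G"
proof -
  define C where "C = connected_component_of_set T \<one>"
  have C: "C \<subseteq> carrier G" "\<one> \<in> C"
    using connected_component_of_subset_topspace[of T \<one>] T
    by (auto simp: C_def connected_component_of_refl)
  have *: "inv a \<otimes> b \<in> C" if "a \<in> C" "b \<in> C" for a b
  proof -
    have a: "a \<in> carrier G" using that C by auto
    have "connectedin T ((\<lambda>x. inv a \<otimes> x) ` C)"
      by (rule connectedin_continuous_map_image[OF cont])
        (use a in \<open>auto simp: C_def connectedin_connected_component_of\<close>)
    moreover have "\<one> \<in> (\<lambda>x. inv a \<otimes> x) ` C"
      using that(1) a by (force simp: image_iff)
    ultimately have "(\<lambda>x. inv a \<otimes> x) ` C \<subseteq> C"
      unfolding C_def by (rule connected_component_of_maximal)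
    with that show ?thesis by blast
  qed
  have inv: "inv a \<in> C" if "a \<in> C" for a
    using *[OF that C(2)] that C by (simp add: subset_iff)
  have "a \<otimes> b \<in> C" if "a \<in> C" "b \<in> C" for a b
    using *[OF inv[OF that(1)] that(2)] that C by (simp add: subset_iff)
  with inv C show ?thesis
    unfolding C_def[symmetric] by (intro subgroupI) auto
qed

section \<open>Matrices over subfields and differential fields\<close>

lemma matrix_inv_left: "invertible M \<Longrightarrow> matrix_inv M ** M = mat 1"
  and matrix_inv_right: "invertible M \<Longrightarrow> M ** matrix_inv M = mat 1"
  for M :: "'a :: semiring_1 ^ 'n ^ 'm"
  unfolding invertible_def matrix_inv_def by (rule conjunct2, erule someI_ex) (rule conjunct1, erule someI_ex)

lemma subfield_set_sum: "subfield_set F \<Longrightarrow> (\<And>i. i \<in> I \<Longrightarrow> f i \<in> F) \<Longrightarrow> sum f I \<in> F"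
  by (induction I rule: infinite_finite_induct) (auto intro: subfield_set_closed)

lemma subfield_set_prod: "subfield_set F \<Longrightarrow> (\<And>i. i \<in> I \<Longrightarrow> f i \<in> F) \<Longrightarrow> prod f I \<in> F"
  by (induction I rule: infinite_finite_induct) (auto intro: subfield_set_closed)

lemma ring_hom_set_sum:
  "ring_hom_set F f \<Longrightarrow> subfield_set F \<Longrightarrow> (\<And>i. i \<in> I \<Longrightarrow> g i \<in> F) \<Longrightarrow>
    f (sum g I) = (\<Sum>i\<in>I. f (g i))"
  by (induction I rule: infinite_finite_induct)
    (auto simp: ring_hom_set_0 ring_hom_set_add subfield_set_sum)

lemma derivation_sum:
  "differential_field D F \<Longrightarrow> (\<And>i. i \<in> I \<Longrightarrow> g i \<in> F) \<Longrightarrow> D (sum g I) = (\<Sum>i\<in>I. D (g i))"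
  by (induction I rule: infinite_finite_induct)
    (auto simp: derivation_0 derivation_add subfield_set_sum differential_field_subfield)

lemma entries_subset_iff: "entries M \<subseteq> F \<longleftrightarrow> (\<forall>i j. M $ i $ j \<in> F)"
  by (auto simp: entries_def)

lemma entries_mult:
  fixes M N :: "'l :: field ^ 'n ^ 'n"
  assumes "subfield_set F" "entries M \<subseteq> F" "entries N \<subseteq> F"
  shows "entries (M ** N) \<subseteq> F"
  using assms
  by (auto simp: entries_subset_iff matrix_matrix_mult_def intro!: subfield_set_sum subfield_set_mult)

lemma det_in_subfield:
  fixes M :: "'l :: field ^ 'n ^ 'n"
  assumes F: "subfield_set F" and "entries M \<subseteq> F"
  shows "det M \<in> F"
proof -
  have "of_int (sign p) \<in> F" for p :: "'n \<Rightarrow> 'n"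
    using F by (auto simp: sign_def intro: subfield_set_closed)
  with assms show ?thesis
    unfolding det_def entries_subset_iff
    by (intro subfield_set_sum subfield_set_mult subfield_set_prod) auto
qed

text \<open>By Cramer's rule the entries of the inverse are quotients of determinants over the
  subfield.\<close>

lemma entries_matrix_inv:
  fixes M :: "'l :: field ^ 'n ^ 'n"
  assumes F: "subfield_set F" and M: "entries M \<subseteq> F" "invertible M"
  shows "entries (matrix_inv M) \<subseteq> F"
  unfolding entries_subset_iff
proof (intro allI)
  fix k j
  define x where "x = matrix_inv M *v axis j 1"
  have "M *v x = axis j 1"
    by (simp add: x_def matrix_vector_mul_assoc matrix_inv_right[OF M(2)])
  then have x: "x = (\<chi> k. det (\<chi> i l. if l = k then axis j 1 $ i else M $ i $ l) / det M)"
    using M(2) by (subst (asm) cramer) (auto simp: invertible_det_nz)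
  have "x $ k = matrix_inv M $ k $ j"
    by (simp add: x_def matrix_vector_mult_def axis_def if_distrib[of "\<lambda>x. _ * x"] cong: if_cong)
  moreover have "entries (\<chi> i l. if l = k then axis j 1 $ i else M $ i $ l) \<subseteq> F"
    using M(1) subfield_set_closed(7,8)[OF F] by (simp add: entries_subset_iff axis_def)
  then have "x $ k \<in> F"
    unfolding x by (simp add: subfield_set_divide[OF F] det_in_subfield[OF F] M(1))
  ultimately show "matrix_inv M $ k $ j \<in> F" by simp
qed

lemma ring_hom_set_matrix_mult:
  fixes M N :: "'l :: field ^ 'n ^ 'n"
  assumes "ring_hom_set F f" "subfield_set F" "entries M \<subseteq> F" "entries N \<subseteq> F"
  shows "map_matrix f (M ** N) = map_matrix f M ** map_matrix f N"
  using assms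
  by (auto simp: map_matrix_def matrix_matrix_mult_def vec_eq_iff entries_subset_iff
      ring_hom_set_sum ring_hom_set_mult subfield_set_mult)

lemma derivation_matrix_mult:
  fixes M N :: "'l :: field ^ 'n ^ 'n"
  assumes "differential_field D F" "entries M \<subseteq> F" "entries N \<subseteq> F"
  shows "map_matrix D (M ** N) = map_matrix D M ** N + M ** map_matrix D N"
  using assms differential_field_subfield[OF assms(1)]
  by (auto simp: map_matrix_def matrix_matrix_mult_def vec_eq_iff entries_subset_iff
      derivation_sum derivation_mult subfield_set_mult sum.distrib)

section \<open>Representation of automorphisms by constant matrices\<close>

context
  fixes D :: "'l :: field \<Rightarrow> 'l" and K L A and \<Phi> :: "'l ^ 'n ^ 'n"
  assumes PV: "picard_vessiot_linear D K L A \<Phi>"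
begin

lemma PV_facts:
  "differential_field D K" "differential_field D L" "K \<subseteq> L" "L = subfield_set hull (K \<union> entries \<Phi>)"
  "field_of_constants D L = field_of_constants D K" "entries A \<subseteq> K" "entries A \<subseteq> L"
  "entries \<Phi> \<subseteq> L" "invertible \<Phi>" "map_matrix D \<Phi> = A ** \<Phi>" "subfield_set L" "subfield_set K"
  using PV by (auto simp: picard_vessiot_linear_def picard_vessiot_by_def fundamental_matrix_def
      differential_field_def)

lemma galois_matrix_eq:
  "\<Phi> ** galois_matrix \<Phi> \<sigma> = map_matrix \<sigma> \<Phi>"
  by (simp add: galois_matrix_def matrix_mul_assoc matrix_inv_right PV_facts)

lemma fundamental_cancel: "\<Phi> ** X = \<Phi> ** Y \<longleftrightarrow> X = Y"
  by (metis PV_facts(9) matrix_inv_left matrix_mul_assoc matrix_mul_lid)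

lemma map_matrix_fixed:
  assumes "\<sigma> \<in> carrier (DGal D K L)" "entries M \<subseteq> K"
  shows "map_matrix \<sigma> M = M"
  using assms by (auto simp: vec_eq_iff entries_subset_iff DGal_mem(4))

text \<open>\<open>\<sigma>\<close> fixes \<open>A\<close> and commutes with \<open>D\<close>, so
  \<open>\<Phi>\<close> and its image solve the same system; differentiating
  \<open>\<Phi> ** M\<close> leaves \<open>\<Phi> ** map_matrix D M = 0\<close>. Absence of new
  constants then places the entries in \<open>K\<close>.\<close>

lemma entries_galois_matrix:
  assumes s: "\<sigma> \<in> carrier (DGal D K L)"
  shows "entries (galois_matrix \<Phi> \<sigma>) \<subseteq> field_of_constants D L"
    and "entries (galois_matrix \<Phi> \<sigma>) \<subseteq> K"
proof -
  define M where "M = galois_matrix \<Phi> \<sigma>"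
  have eM: "\<Phi> ** M = map_matrix \<sigma> \<Phi>"
    by (simp add: M_def galois_matrix_eq)
  have eL: "entries M \<subseteq> L"
    unfolding M_def galois_matrix_def
    by (intro entries_mult entries_matrix_inv PV_facts)
      (use PV_facts(8) s in \<open>auto simp: entries_subset_iff DGal_mem(2)\<close>)
  have "A ** (\<Phi> ** M) + \<Phi> ** map_matrix D M = map_matrix D (\<Phi> ** M)"
    by (simp add: derivation_matrix_mult[OF PV_facts(2,8) eL] PV_facts(10) matrix_mul_assoc)
  also have "\<dots> = map_matrix \<sigma> (map_matrix D \<Phi>)"
    unfolding eM using PV_facts(8) s by (auto simp: vec_eq_iff entries_subset_iff DGal_mem(3))
  also have "\<dots> = A ** map_matrix \<sigma> \<Phi>"
    unfolding PV_facts(10)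
    by (simp add: ring_hom_set_matrix_mult[OF DGal_mem(1)[OF s] PV_facts(11,7,8)]
        map_matrix_fixed[OF s PV_facts(6)])
  also have "\<dots> = A ** (\<Phi> ** M)"
    by (simp add: eM)
  finally have "\<Phi> ** map_matrix D M = \<Phi> ** 0"
    by simp
  then have "map_matrix D M = 0"
    by (simp only: fundamental_cancel)
  then have "entries M \<subseteq> field_of_constants D L"
    using eL by (auto simp: entries_subset_iff field_of_constants_def vec_eq_iff)
  then show "entries (galois_matrix \<Phi> \<sigma>) \<subseteq> field_of_constants D L"
    and "entries (galois_matrix \<Phi> \<sigma>) \<subseteq> K"
    using PV_facts(5) by (auto simp: M_def field_of_constants_def)
qed

text \<open>The matrix of \<open>\<tau>\<close> has entries in \<open>K\<close> and is fixed by
  \<open>\<sigma>\<close>; this is what keeps the factors in the given order.\<close>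

lemma galois_matrix_mult:
  assumes s: "\<sigma> \<in> carrier (DGal D K L)" and t: "\<tau> \<in> carrier (DGal D K L)"
  shows "galois_matrix \<Phi> (\<sigma> \<otimes>\<^bsub>DGal D K L\<^esub> \<tau>) = galois_matrix \<Phi> \<sigma> ** galois_matrix \<Phi> \<tau>"
proof -
  have e: "entries (galois_matrix \<Phi> \<tau>) \<subseteq> K" "entries (galois_matrix \<Phi> \<tau>) \<subseteq> L"
    using entries_galois_matrix(2)[OF t] PV_facts(3) by auto
  have "\<Phi> ** galois_matrix \<Phi> (\<sigma> \<otimes>\<^bsub>DGal D K L\<^esub> \<tau>) = map_matrix \<sigma> (map_matrix \<tau> \<Phi>)"
    unfolding galois_matrix_eq using PV_facts(8)
    by (auto simp: vec_eq_iff DGal_mult[OF s t] compose_def entries_subset_iff)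
  also have "\<dots> = map_matrix \<sigma> (\<Phi> ** galois_matrix \<Phi> \<tau>)"
    by (simp add: galois_matrix_eq)
  also have "\<dots> = map_matrix \<sigma> \<Phi> ** galois_matrix \<Phi> \<tau>"
    by (simp add: ring_hom_set_matrix_mult[OF DGal_mem(1)[OF s] PV_facts(11,8) e(2)]
        map_matrix_fixed[OF s e(1)])
  also have "\<dots> = \<Phi> ** (galois_matrix \<Phi> \<sigma> ** galois_matrix \<Phi> \<tau>)"
    by (simp add: galois_matrix_eq matrix_mul_assoc)
  finally show ?thesis
    by (simp only: fundamental_cancel)
qed

text \<open>The representation is faithful because \<open>K\<close> and the entries of
  \<open>\<Phi>\<close> generate \<open>L\<close>.\<close>

lemma DGal_eqI:
  assumes s: "\<sigma> \<in> carrier (DGal D K L)" and t: "\<tau> \<in> carrier (DGal D K L)"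
    and "galois_matrix \<Phi> \<sigma> = galois_matrix \<Phi> \<tau>"
  shows "\<sigma> = \<tau>"
proof (rule extensionalityI[OF DGal_mem(5)[OF s] DGal_mem(5)[OF t]])
  fix u assume u: "u \<in> L"
  have "map_matrix \<sigma> \<Phi> = map_matrix \<tau> \<Phi>"
    using assms(3) by (metis galois_matrix_eq)
  then have "\<sigma> v = \<tau> v" if "v \<in> K \<union> entries \<Phi>" for v
    using that DGal_mem(4)[OF s] DGal_mem(4)[OF t] by (auto simp: vec_eq_iff entries_def)
  then show "\<sigma> u = \<tau> u"
    using ring_hom_set_eq_on_hull[OF DGal_mem(1)[OF s] DGal_mem(1)[OF t] PV_facts(11,4)] u by blast
qed

end

section \<open>Zariski continuity of translations\<close>

lemma topspace_zariski [simp]: 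
  assumes "1 \<in> C" shows "topspace (zariski_topology C) = UNIV"
proof -
  have "(\<lambda>M. 1) \<in> matrix_polynomials C"
    by (rule matrix_polynomials.const[OF assms])
  then have "UNIV \<in> {{M. p M \<noteq> 0} | p. p \<in> matrix_polynomials C}"
    by (force intro!: exI[of _ "\<lambda>M. 1"])
  then show ?thesis
    by (auto simp: zariski_topology_def)
qed

lemma matrix_polynomials_sum:
  assumes "0 \<in> C" "finite I" "\<And>i. i \<in> I \<Longrightarrow> f i \<in> matrix_polynomials C"
  shows "(\<lambda>M. \<Sum>i\<in>I. f i M) \<in> matrix_polynomials C"
  using assms(2,3)
  by (induction I) (auto intro: matrix_polynomials.intros assms(1))

lemma matrix_polynomials_left_mult:
  fixes N :: "'l :: field ^ 'n ^ 'n"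
  assumes "0 \<in> C" "entries N \<subseteq> C" "p \<in> matrix_polynomials C"
  shows "(\<lambda>M. p (N ** M)) \<in> matrix_polynomials C"
  using assms(3)
proof induction
  case (entry i j)
  show ?case
    unfolding matrix_matrix_mult_def using assms
    by (auto simp: entries_subset_iff intro!: matrix_polynomials_sum matrix_polynomials.intros)
qed (auto intro: matrix_polynomials.intros)

text \<open>Substituting \<open>N ** M\<close> into a polynomial over \<open>C\<close> gives a
  polynomial over \<open>C\<close>, so preimages of basic open sets are again basic.\<close>

lemma continuous_map_zariski_left_mult:
  fixes N :: "'l :: field ^ 'n ^ 'n"
  assumes "0 \<in> C" "1 \<in> C" "entries N \<subseteq> C"
  shows "continuous_map (zariski_topology C) (zariski_topology C) (\<lambda>M. N ** M)"
proof -
  have "openin (zariski_topology C) ((\<lambda>M. N ** M) -` {M. p M \<noteq> 0} \<inter> topspace (zariski_topology C))"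
    if "p \<in> matrix_polynomials C" for p
  proof -
    have "(\<lambda>M. N ** M) -` {M. p M \<noteq> 0} \<in> {{M. p M \<noteq> 0} | p. p \<in> matrix_polynomials C}"
      using matrix_polynomials_left_mult[OF assms(1,3) that] by auto
    then show ?thesis
      using assms(2) by (auto simp: zariski_topology_def intro!: topology_generated_by_Basis)
  qed
  moreover have "\<Union>{{M. p M \<noteq> 0} | p. p \<in> matrix_polynomials C} = (UNIV :: ('l ^ 'n ^ 'n) set)"
    using topspace_zariski[OF assms(2)] by (simp add: zariski_topology_def)
  ultimately show ?thesis
    by (subst (2) zariski_topology_def, intro continuous_on_generated_topo) auto
qed

text \<open>The topology is pulled back along \<open>galois_matrix\<close>, which turns a left
  translation into a matrix multiplication by constants.\<close>

lemma subgroup_identity_component: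
  fixes \<Phi> :: "'l :: field ^ 'n ^ 'n"
  assumes PV: "picard_vessiot_linear D K L A \<Phi>"
  shows "subgroup (identity_component D K L \<Phi>) (DGal D K L)"
proof -
  note F = PV_facts[OF PV]
  let ?G = "DGal D K L" and ?C = "field_of_constants D L"
  interpret group ?G
    by (rule group_DGal[OF F(2,3)])
  have C: "0 \<in> ?C" "1 \<in> ?C"
    using subfield_set_closed(7,8)[OF F(11)] derivation_0[OF F(2)] derivation_1[OF F(2)]
    by (auto simp: field_of_constants_def)
  have top: "topspace (DGal_topology D K L \<Phi>) = carrier ?G"
    by (simp add: DGal_topology_def topspace_pullback_topology C)
  have "continuous_map (DGal_topology D K L \<Phi>) (DGal_topology D K L \<Phi>) (\<lambda>x. g \<otimes>\<^bsub>?G\<^esub> x)"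
    if g: "g \<in> carrier ?G" for g
  proof -
    have gm: "continuous_map (DGal_topology D K L \<Phi>) (zariski_topology ?C) (galois_matrix \<Phi>)"
      unfolding DGal_topology_def
      using continuous_map_pullback[OF continuous_map_id, where f = "galois_matrix \<Phi>"] by simp
    have "continuous_map (DGal_topology D K L \<Phi>) (zariski_topology ?C)
        ((\<lambda>M. galois_matrix \<Phi> g ** M) \<circ> galois_matrix \<Phi>)"
      by (rule continuous_map_compose[OF gm continuous_map_zariski_left_mult[OF C]])
        (rule entries_galois_matrix[OF PV g])
    then have "continuous_map (DGal_topology D K L \<Phi>) (zariski_topology ?C)
        (galois_matrix \<Phi> \<circ> (\<lambda>x. g \<otimes>\<^bsub>?G\<^esub> x))"
      by (rule continuous_map_eq) (auto simp: top galois_matrix_mult[OF PV g])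
    then show ?thesis
      by (subst (2) DGal_topology_def, intro continuous_map_pullback') (auto simp: top g)
  qed
  from subgroup_connected_component_of_one[OF top this] show ?thesis
    by (simp add: identity_component_def)
qed

section \<open>Commuting two by two matrices\<close>

lemma proportional_ex:
  fixes u1 u2 u3 w1 w2 w3 :: "'a :: field"
  assumes "u1 * w2 = u2 * w1" "u1 * w3 = u3 * w1" "u2 * w3 = u3 * w2"
    and "w1 \<noteq> 0 \<or> w2 \<noteq> 0 \<or> w3 \<noteq> 0"
  shows "\<exists>l. u1 = l * w1 \<and> u2 = l * w2 \<and> u3 = l * w3"
proof -
  have 0: "u = t * v" if "u * w = v * x" "w \<noteq> 0" "t = x / w" for t u v w x :: 'a
    using that(1,2) unfolding that(3)
    by (metis (no_types) nonzero_mult_div_cancel_right mult.commute times_divide_eq_left)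
  have "u1 = u1 / w1 * w1 \<and> u2 = u1 / w1 * w2 \<and> u3 = u1 / w1 * w3" if "w1 \<noteq> 0"
    using that assms(1,2) by (intro conjI) (rule 0[OF _ that refl], simp add: ac_simps)+
  moreover have "u1 = u2 / w2 * w1 \<and> u2 = u2 / w2 * w2 \<and> u3 = u2 / w2 * w3" if "w2 \<noteq> 0"
    using that assms(1,3) by (intro conjI) (rule 0[OF _ that refl], simp add: ac_simps)+
  moreover have "u1 = u3 / w3 * w1 \<and> u2 = u3 / w3 * w2 \<and> u3 = u3 / w3 * w3" if "w3 \<noteq> 0"
    using that assms(2,3) by (intro conjI) (rule 0[OF _ that refl], simp add: ac_simps)+
  ultimately show ?thesis
    using assms(4) by blast
qed

text \<open>Modulo scalar matrices, \<open>M\<close> is the vector of its two off-diagonal entries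
  and the difference of its diagonal entries. The three equations say that the cross product of the
  vectors of \<open>M\<close> and \<open>N\<close> vanishes.\<close>

lemma commute_2x2_iff:
  fixes M N :: "'a :: field ^ 2 ^ 2"
  shows "M ** N = N ** M \<longleftrightarrow>
    M$1$2 * N$2$1 = M$2$1 * N$1$2 \<and>
    M$1$2 * (N$1$1 - N$2$2) = (M$1$1 - M$2$2) * N$1$2 \<and>
    M$2$1 * (N$1$1 - N$2$2) = (M$1$1 - M$2$2) * N$2$1"
proof -
  have 11: "p * p' + q * r' = p' * p + q' * r \<longleftrightarrow> q * r' = r * q'" for p q r p' q' r' :: 'a
    by (simp only: mult.commute[of p' p] mult.commute[of q' r] add_left_cancel)
  have 22: "r * q' + s * s' = r' * q + s' * s \<longleftrightarrow> q * r' = r * q'" for s q r s' q' r' :: 'a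
    by (simp only: mult.commute[of r' q] mult.commute[of s' s] add_right_cancel) (rule eq_commute)
  have d: "(p - q = r - s) = (p + s = r + q)" for p q r s :: 'a
    by (simp only: diff_eq_eq diff_add_eq eq_diff_eq)
  have 12: "p * q' + q * s' = p' * q + q' * s \<longleftrightarrow> q * (p' - s') = (p - s) * q'" for p q s p' q' s' :: 'a
    unfolding left_diff_distrib right_diff_distrib d by (simp only: mult.commute[of p' q] mult.commute[of q' s]) (rule eq_commute)
  have 21: "r * p' + s * r' = r' * p + s' * r \<longleftrightarrow> r * (p' - s') = (p - s) * r'" for p r s p' r' s' :: 'a
    unfolding left_diff_distrib right_diff_distrib d by (simp only: mult.commute[of r' p] mult.commute[of s' r])
  note mm = matrix_matrix_mult_def sum_2 vec_lambda_beta
  have "(M ** N)$1$1 = (N ** M)$1$1 \<longleftrightarrow> M$1$2 * N$2$1 = M$2$1 * N$1$2"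
    by (simp only: mm 11)
  moreover have "(M ** N)$2$2 = (N ** M)$2$2 \<longleftrightarrow> M$1$2 * N$2$1 = M$2$1 * N$1$2"
    by (simp only: mm 22)
  moreover have "(M ** N)$1$2 = (N ** M)$1$2 \<longleftrightarrow> M$1$2 * (N$1$1 - N$2$2) = (M$1$1 - M$2$2) * N$1$2"
    by (simp only: mm 12)
  moreover have "(M ** N)$2$1 = (N ** M)$2$1 \<longleftrightarrow> M$2$1 * (N$1$1 - N$2$2) = (M$1$1 - M$2$2) * N$2$1"
    by (simp only: mm 21)
  moreover have "M ** N = N ** M \<longleftrightarrow> (\<forall>i j. (M ** N)$i$j = (N ** M)$i$j)"
    by (simp only: vec_eq_iff)
  ultimately show ?thesis
    unfolding forall_2 by blast
qed

lemma proportional_2x2_commute: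
  fixes M N :: "'a :: field ^ 2 ^ 2"
  assumes "M$1$2 * w2 = M$2$1 * w1" "M$1$2 * w3 = (M$1$1 - M$2$2) * w1"
      "M$2$1 * w3 = (M$1$1 - M$2$2) * w2"
    and "N$1$2 * w2 = N$2$1 * w1" "N$1$2 * w3 = (N$1$1 - N$2$2) * w1"
      "N$2$1 * w3 = (N$1$1 - N$2$2) * w2"
    and w: "w1 \<noteq> 0 \<or> w2 \<noteq> 0 \<or> w3 \<noteq> 0"
  shows "M ** N = N ** M"
proof -
  obtain l where "M$1$2 = l * w1" "M$2$1 = l * w2" "M$1$1 - M$2$2 = l * w3"
    using proportional_ex[OF assms(1-3) w] by blast
  moreover obtain m where "N$1$2 = m * w1" "N$2$1 = m * w2" "N$1$1 - N$2$2 = m * w3"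
    using proportional_ex[OF assms(4-6) w] by blast
  ultimately show ?thesis
    unfolding commute_2x2_iff by simp
qed

text \<open>A matrix that is not scalar has a nonzero vector in the sense of
  \<open>commute_2x2_iff\<close>, and everything commuting with it is proportional to that
  vector.\<close>

lemma centralizer_2x2_commute:
  fixes M N B :: "'a :: field ^ 2 ^ 2"
  assumes "M ** B = B ** M" "N ** B = B ** N" and B: "\<And>a. B \<noteq> mat a"
  shows "M ** N = N ** M"
proof -
  have "B$1$2 \<noteq> 0 \<or> B$2$1 \<noteq> 0 \<or> B$1$1 - B$2$2 \<noteq> 0"
    using B[of "B$1$1"] by (auto simp: vec_eq_iff forall_2 mat_def)
  with assms(1,2) show ?thesis
    unfolding commute_2x2_iff[of _ B]
    by (intro proportional_2x2_commute[of M "B$2$1" "B$1$2" "B$1$1 - B$2$2" N]) auto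
qed

text \<open>A unimodular matrix with fixed vector \<open>(x, y)\<close> has trace 2, so subtracting
  the identity leaves a multiple of the nilpotent matrix with rows \<open>(x*y, - x*x)\<close> and
  \<open>(y*y, - x*y)\<close>. The claims express this without division, in every
  characteristic.\<close>

lemma unipotent_stabilizer_proportional:
  fixes R :: "'a :: field ^ 2 ^ 2"
  assumes "R *v c = c" "det R = 1" "c \<noteq> 0"
  shows "R$1$2 * - (c$2 * c$2) = R$2$1 * (c$1 * c$1)"
    "R$1$2 * (- 2 * (c$1 * c$2)) = (R$1$1 - R$2$2) * (c$1 * c$1)"
    "R$2$1 * (- 2 * (c$1 * c$2)) = (R$1$1 - R$2$2) * - (c$2 * c$2)"
proof -
  \<comment> \<open>Obtained from \<open>x = x * det R\<close>. It is applied to both coordinates,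
    since only one of them is known to be nonzero.\<close>
  have trace: "x * (p + s - 2) = 0"
    if "p * x + q * y = x" "r * x + s * y = y" "p * s - q * r = 1" for p q r s x y :: 'a
  proof -
    have e: "p * x = x - q * y" "s * y = y - r * x"
      using that(1,2) by (simp_all add: eq_diff_eq add.commute)
    have "x = x * (p * s - q * r)" by (simp add: that)
    also have "\<dots> = s * (p * x) - q * r * x" by (simp add: algebra_simps)
    also have "\<dots> = s * x - q * (s * y) - q * r * x" by (simp add: e(1) algebra_simps)
    also have "\<dots> = s * x - q * y" by (simp add: e(2) algebra_simps)
    also have "\<dots> = s * x + p * x - x" by (simp add: e(1))
    finally have "x = s * x + p * x - x" .
    then show ?thesis by (simp add: algebra_simps)
  qed
  define p q r s x y where "p = R$1$1" and "q = R$1$2" and "r = R$2$1" and "s = R$2$2"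
    and "x = c$1" and "y = c$2"
  have eqs: "p * x + q * y = x" "r * x + s * y = y" "p * s - q * r = 1"
    using assms(1,2)
    by (simp_all add: vec_eq_iff forall_2 matrix_vector_mult_def sum_2 det_2
        p_def q_def r_def s_def x_def y_def)
  have "x \<noteq> 0 \<or> y \<noteq> 0"
    using \<open>c \<noteq> 0\<close> by (auto simp: vec_eq_iff forall_2 x_def y_def)
  moreover have "x * (p + s - 2) = 0"
    by (rule trace[OF eqs])
  moreover have "y * (s + p - 2) = 0"
    by (rule trace[where q = r and r = q and x = y and y = x])
      (use eqs in \<open>simp_all add: add.commute mult.commute\<close>)
  ultimately have "p + s - 2 = 0"
    by (auto simp: add.commute)
  then have s: "s = 2 - p"
    by (simp add: eq_diff_eq add.commute)
  have e: "q * y = (1 - p) * x" "r * x = (p - 1) * y"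
    using eqs(1,2) unfolding s by (simp_all add: algebra_simps eq_diff_eq)
  have 1: "q * - (y * y) = - (q * y) * y" "r * (x * x) = (r * x) * x"
    "q * (- 2 * (x * y)) = - 2 * (q * y) * x" "r * (- 2 * (x * y)) = - 2 * (r * x) * y"
    by (simp_all add: algebra_simps)
  have "q * - (y * y) = r * (x * x)" "q * (- 2 * (x * y)) = (p - s) * (x * x)"
    "r * (- 2 * (x * y)) = (p - s) * - (y * y)"
    unfolding 1 e s by (auto simp: left_diff_distrib right_diff_distrib mult.assoc mult.left_commute)
  then show "R$1$2 * - (c$2 * c$2) = R$2$1 * (c$1 * c$1)"
    "R$1$2 * (- 2 * (c$1 * c$2)) = (R$1$1 - R$2$2) * (c$1 * c$1)"
    "R$2$1 * (- 2 * (c$1 * c$2)) = (R$1$1 - R$2$2) * - (c$2 * c$2)"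
    by (simp_all only: p_def q_def r_def s_def x_def y_def)
qed

lemma unipotent_stabilizer_2x2_commute:
  fixes M N :: "'a :: field ^ 2 ^ 2"
  assumes "M *v c = c" "N *v c = c" "c \<noteq> 0" "det M = 1" "det N = 1"
  shows "M ** N = N ** M"
proof (rule proportional_2x2_commute)
  show "c$1 * c$1 \<noteq> 0 \<or> - (c$2 * c$2) \<noteq> 0 \<or> - 2 * (c$1 * c$2) \<noteq> 0"
    using \<open>c \<noteq> 0\<close> by (auto simp: vec_eq_iff forall_2)
qed (use assms unipotent_stabilizer_proportional[of M c] unipotent_stabilizer_proportional[of N c] in auto)

section \<open>Second-order linear equations\<close>

text \<open>Any square matrix of solutions, invertible or not, has constant coordinates with respect
  to \<open>\<Phi>\<close>, so automorphisms act on it through their Galois matrices.\<close>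

lemma solution_coordinates:
  fixes \<Phi> V :: "'l :: field ^ 'n ^ 'n"
  assumes PV: "picard_vessiot_linear D K L A \<Phi>"
    and V: "entries V \<subseteq> L" "map_matrix D V = A ** V"
  obtains C where "\<Phi> ** C = V" "entries C \<subseteq> K"
    "\<And>\<sigma>. \<sigma> \<in> carrier (DGal D K L) \<Longrightarrow> map_matrix \<sigma> V = \<Phi> ** (galois_matrix \<Phi> \<sigma> ** C)"
proof -
  note F = PV_facts[OF PV]
  define C where "C = matrix_inv \<Phi> ** V"
  have eC: "\<Phi> ** C = V"
    by (simp add: C_def matrix_mul_assoc matrix_inv_right F)
  have CL: "entries C \<subseteq> L"
    unfolding C_def by (intro entries_mult entries_matrix_inv F V)
  have "A ** (\<Phi> ** C) + \<Phi> ** map_matrix D C = map_matrix D (\<Phi> ** C)"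
    by (simp add: derivation_matrix_mult[OF F(2,8) CL] F(10) matrix_mul_assoc)
  then have "\<Phi> ** map_matrix D C = \<Phi> ** 0"
    by (simp add: eC V(2))
  then have "map_matrix D C = 0"
    by (simp only: fundamental_cancel[OF PV])
  then have "entries C \<subseteq> field_of_constants D L"
    using CL by (auto simp: entries_subset_iff field_of_constants_def vec_eq_iff)
  then have CK: "entries C \<subseteq> K"
    using F(5) by (auto simp: field_of_constants_def)
  have "map_matrix \<sigma> V = \<Phi> ** (galois_matrix \<Phi> \<sigma> ** C)" if s: "\<sigma> \<in> carrier (DGal D K L)" for \<sigma>
    unfolding eC[symmetric]
    by (simp add: ring_hom_set_matrix_mult[OF DGal_mem(1)[OF s] F(11,8) CL]
        map_matrix_fixed[OF PV s CK] matrix_mul_assoc galois_matrix_eq[OF PV])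
  with eC CK that show thesis by blast
qed

text \<open>
  If \<open>a\<close> is constant, the Galois matrices commute with the constant non-scalar matrix
  \<open>B = \<Phi>\<^sup>-\<^sup>1 A \<Phi>\<close>. If the equation has a solution \<open>y \<noteq> 0\<close> in \<open>K\<close>, they are
  unimodular and fix the coordinates of that solution. Both conditions define commutative groups of
  \<open>2 \<times> 2\<close> matrices.
\<close>

lemma DGal_second_order_commute:
  fixes \<Phi> :: "'l :: field ^ 2 ^ 2"
  assumes PV: "picard_vessiot_linear D K L A \<Phi>"
    and A: "A$1$1 = 0" "A$1$2 = 1" "A$2$1 = a" "A$2$2 = 0"
    and a: "D a = 0 \<or> (\<exists>y\<in>K. y \<noteq> 0 \<and> D (D y) = a * y)"
    and st: "\<sigma> \<in> carrier (DGal D K L)" "\<tau> \<in> carrier (DGal D K L)"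
  shows "\<sigma> \<otimes>\<^bsub>DGal D K L\<^esub> \<tau> = \<tau> \<otimes>\<^bsub>DGal D K L\<^esub> \<sigma>"
proof -
  note F = PV_facts[OF PV]
  let ?G = "DGal D K L"
  interpret group ?G
    by (rule group_DGal[OF F(2,3)])
  have "galois_matrix \<Phi> \<sigma> ** galois_matrix \<Phi> \<tau> = galois_matrix \<Phi> \<tau> ** galois_matrix \<Phi> \<sigma>"
    using a
  proof
    assume "D a = 0"
    then have DA: "map_matrix D A = 0"
      using derivation_0[OF F(2)] derivation_1[OF F(2)] A by (simp add: vec_eq_iff forall_2)
    \<comment> \<open>With constant coefficients, \<open>A ** \<Phi>\<close> is again a matrix of
      solutions; its coordinates are the matrix \<open>B\<close>.\<close>
    have 1: "entries (A ** \<Phi>) \<subseteq> L"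
      by (intro entries_mult F)
    have 2: "map_matrix D (A ** \<Phi>) = A ** (A ** \<Phi>)"
      by (simp add: derivation_matrix_mult[OF F(2,7,8)] DA F(10))
    obtain B where B: "\<Phi> ** B = A ** \<Phi>" "\<And>\<sigma>. \<sigma> \<in> carrier ?G \<Longrightarrow>
        map_matrix \<sigma> (A ** \<Phi>) = \<Phi> ** (galois_matrix \<Phi> \<sigma> ** B)"
      using solution_coordinates[OF PV 1 2] by metis
    have "galois_matrix \<Phi> s ** B = B ** galois_matrix \<Phi> s" if s: "s \<in> carrier ?G" for s
    proof -
      have "\<Phi> ** (galois_matrix \<Phi> s ** B) = A ** map_matrix s \<Phi>"
        by (simp flip: B(2)[OF s] add: ring_hom_set_matrix_mult[OF DGal_mem(1)[OF s] F(11,7,8)]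
            map_matrix_fixed[OF PV s F(6)])
      also have "\<dots> = \<Phi> ** (B ** galois_matrix \<Phi> s)"
        by (simp add: matrix_mul_assoc B(1) flip: galois_matrix_eq[OF PV])
      finally show ?thesis
        by (simp only: fundamental_cancel[OF PV])
    qed
    moreover have "B \<noteq> mat r" for r
    proof
      assume "B = mat r"
      have "A ** \<Phi> = mat r ** \<Phi>"
        unfolding B(1)[symmetric] \<open>B = mat r\<close>
        by (auto simp: vec_eq_iff forall_2 matrix_matrix_mult_def sum_2 mat_def)
      then have "A ** \<Phi> ** matrix_inv \<Phi> = mat r ** \<Phi> ** matrix_inv \<Phi>"
        by simp
      then have "A = mat r"
        by (simp add: matrix_inv_right[OF F(9)] flip: matrix_mul_assoc)
      with A(2) show False
        by (simp add: mat_def)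
    qed
    ultimately show ?thesis
      using centralizer_2x2_commute st by metis
  next
    assume "\<exists>y\<in>K. y \<noteq> 0 \<and> D (D y) = a * y"
    then obtain y where y: "y \<in> K" "y \<noteq> 0" "D (D y) = a * y"
      by blast
    \<comment> \<open>One solution is written into both columns, so that
      \<open>solution_coordinates\<close> applies to a square matrix; afterwards only the first
      column is used.\<close>
    define V :: "'l ^ 2 ^ 2" where "V = vector [vector [y, y], vector [D y, D y]]"
    have VK: "entries V \<subseteq> K"
      using y derivation_closed[OF F(1) y(1)] by (simp add: entries_subset_iff V_def forall_2)
    have 2: "map_matrix D V = A ** V"
      using A y by (simp add: V_def vec_eq_iff forall_2 matrix_matrix_mult_def sum_2)
    obtain C where C: "\<Phi> ** C = V" "\<And>\<sigma>. \<sigma> \<in> carrier ?G \<Longrightarrow>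
        map_matrix \<sigma> V = \<Phi> ** (galois_matrix \<Phi> \<sigma> ** C)"
      using solution_coordinates[OF PV _ 2] VK F(3) by (metis order_trans)
    define c where "c = column 1 C"
    have c: "galois_matrix \<Phi> s *v c = c" if s: "s \<in> carrier ?G" for s
    proof -
      have "\<Phi> ** (galois_matrix \<Phi> s ** C) = \<Phi> ** C"
        using C(2)[OF s] map_matrix_fixed[OF PV s VK] C(1) by simp
      then have "galois_matrix \<Phi> s ** C = C"
        by (simp only: fundamental_cancel[OF PV])
      then show ?thesis
        by (auto simp: c_def column_def vec_eq_iff matrix_matrix_mult_def matrix_vector_mult_def)
    qed
    have "c \<noteq> 0"
    proof
      assume "c = 0"
      then have "(\<Phi> ** C) $ 1 $ 1 = 0"
        by (simp add: c_def column_def vec_eq_iff matrix_matrix_mult_def)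
      then show False
        using y by (simp add: C(1) V_def)
    qed
    moreover have det: "det (galois_matrix \<Phi> s) = 1" if s: "s \<in> carrier ?G" for s
    proof -
      have \<Phi>: "\<Phi> $ i $ j \<in> L" for i j
        using F(8) by (auto simp: entries_subset_iff)
      have d: "D (\<Phi> $ 1 $ j) = \<Phi> $ 2 $ j" "D (\<Phi> $ 2 $ j) = a * \<Phi> $ 1 $ j" for j
        using arg_cong[OF F(10), of "\<lambda>M. M $ 1 $ j"] arg_cong[OF F(10), of "\<lambda>M. M $ 2 $ j"] A
        by (simp_all add: matrix_matrix_mult_def sum_2)
      \<comment> \<open>Liouville's formula: \<open>A\<close> has trace 0. The determinant is thus a
        constant in \<open>K\<close> and fixed by \<open>s\<close>, which forces the Galois matrix
        to have determinant 1.\<close>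
      have "D (det \<Phi>) = 0"
        by (simp add: det_2 derivation_diff[OF F(2)] derivation_mult[OF F(2)] \<Phi> d
            subfield_set_mult[OF F(11)] algebra_simps)
      then have "det \<Phi> \<in> field_of_constants D L"
        using det_in_subfield[OF F(11,8)] by (simp add: field_of_constants_def)
      then have "det \<Phi> \<in> K"
        unfolding F(5) by (simp add: field_of_constants_def)
      then have "det \<Phi> = s (det \<Phi>)"
        by (simp add: DGal_mem(4)[OF s])
      also have "\<dots> = det (map_matrix s \<Phi>)"
        by (simp add: det_2 ring_hom_set_diff[OF DGal_mem(1)[OF s] F(11)]
            ring_hom_set_mult[OF DGal_mem(1)[OF s] F(11)] \<Phi> subfield_set_mult[OF F(11)])
      also have "\<dots> = det \<Phi> * det (galois_matrix \<Phi> s)"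
        by (simp add: det_mul flip: galois_matrix_eq[OF PV])
      finally show ?thesis
        using F(9) by (simp add: invertible_det_nz)
    qed
    ultimately show ?thesis
      using unipotent_stabilizer_2x2_commute c st by metis
  qed
  then show ?thesis
    by (intro DGal_eqI[OF PV]) (simp_all add: st galois_matrix_mult[OF PV])
qed

lemma comm_group_identity_component:
  assumes PV: "picard_vessiot_linear D K L A \<Phi>"
    and "\<And>\<sigma> \<tau>. \<sigma> \<in> carrier (DGal D K L) \<Longrightarrow> \<tau> \<in> carrier (DGal D K L) \<Longrightarrow>
      \<sigma> \<otimes>\<^bsub>DGal D K L\<^esub> \<tau> = \<tau> \<otimes>\<^bsub>DGal D K L\<^esub> \<sigma>"
  shows "comm_group ((DGal D K L)\<lparr>carrier := identity_component D K L \<Phi>\<rparr>)"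
proof -
  interpret group "DGal D K L"
    by (rule group_DGal) (use PV_facts[OF PV] in auto)
  have s: "subgroup (identity_component D K L \<Phi>) (DGal D K L)"
    by (rule subgroup_identity_component[OF PV])
  show ?thesis
    by (rule group.group_comm_groupI[OF subgroup_imp_group[OF s]])
      (use assms(2) subgroup.mem_carrier[OF s] in auto)
qed

text \<open>The last equation is the coefficient of index \<open>n\<close> in
  \<open>u'' = a u\<close>, solved for the coefficient of index \<open>n + 2\<close>.\<close>

fun second_order_coeffs :: "'a :: field_char_0 fps \<Rightarrow> 'a \<Rightarrow> 'a \<Rightarrow> nat \<Rightarrow> 'a" where
  "second_order_coeffs a p q 0 = p"
| "second_order_coeffs a p q (Suc 0) = q"
| "second_order_coeffs a p q (Suc (Suc n)) =
     (\<Sum>k\<le>n. fps_nth a k * second_order_coeffs a p q (n - k)) / (of_nat (Suc n) * of_nat (Suc (Suc n)))"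

lemma second_order_fps_solution:
  fixes a :: "'a :: field_char_0 fps"
  obtains u where "fps_deriv (fps_deriv u) = a * u" "fps_nth u 0 = p" "fps_nth u 1 = q"
proof
  let ?u = "Abs_fps (second_order_coeffs a p q)"
  show "fps_deriv (fps_deriv ?u) = a * ?u"
  proof (rule fps_ext)
    fix n
    have "(of_nat (Suc n) :: 'a) \<noteq> 0" "(of_nat (Suc (Suc n)) :: 'a) \<noteq> 0"
      by (simp_all only: of_nat_neq_0 not_False_eq_True)
    then show "(fps_nth (fps_deriv (fps_deriv ?u)) n = fps_nth (a * ?u) n)"
      by (simp add: fps_mult_nth atLeast0AtMost del: of_nat_Suc)
  qed
qed simp_all

text \<open>The series with initial values \<open>(1, 0)\<close> and \<open>(0, 1)\<close> have a
  Wronskian with constant coefficient 1, hence form a fundamental system. Staying inside Laurent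
  series excludes new constants.\<close>

lemma picard_vessiot_second_order_fls:
  fixes K :: "complex fls set" and A :: "complex fls ^ 2 ^ 2"
  assumes K: "differential_field fls_deriv K" "range fls_const \<subseteq> K"
    and A: "A$1$1 = 0" "A$1$2 = 1" "A$2$1 = fps_to_fls a" "A$2$2 = 0" "fps_to_fls a \<in> K"
  shows "\<exists>L \<Phi>. picard_vessiot_linear fls_deriv K L A \<Phi>"
proof -
  obtain u where u: "fps_deriv (fps_deriv u) = a * u" "fps_nth u 0 = 1" "fps_nth u 1 = 0"
    by (rule second_order_fps_solution)
  obtain v where v: "fps_deriv (fps_deriv v) = a * v" "fps_nth v 0 = 0" "fps_nth v 1 = 1"
    by (rule second_order_fps_solution)
  define \<Phi> :: "complex fls ^ 2 ^ 2" where "\<Phi> = vector [vector [fps_to_fls u, fps_to_fls v],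
    vector [fps_to_fls (fps_deriv u), fps_to_fls (fps_deriv v)]]"
  define L where "L = subfield_set hull (K \<union> entries \<Phi>)"
  have KL: "K \<subseteq> L" "entries \<Phi> \<subseteq> L"
    using hull_subset[of "K \<union> entries \<Phi>" subfield_set] by (auto simp: L_def)
  have sK: "subfield_set K" and sL: "subfield_set L"
    using K differential_field_subfield by (auto simp: L_def)
  have "det \<Phi> = fps_to_fls (u * fps_deriv v - v * fps_deriv u)"
    by (simp add: \<Phi>_def det_2 fls_times_fps_to_fls)
  moreover have "fps_nth (u * fps_deriv v - v * fps_deriv u) 0 = 1"
    using u v by simp
  ultimately have "invertible \<Phi>"
    by (metis fps_to_fls_eq_0_iff fps_zero_nth invertible_det_nz zero_neq_one)
  moreover have D\<Phi>: "map_matrix fls_deriv \<Phi> = A ** \<Phi>"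
    using A u v
    by (simp add: \<Phi>_def vec_eq_iff forall_2 matrix_matrix_mult_def sum_2 fls_deriv_fps_to_fls
        fls_times_fps_to_fls)
  moreover have "entries A \<subseteq> K"
    using A subfield_set_closed(7,8)[OF sK] by (auto simp: entries_subset_iff forall_2)
  moreover have "entries (A ** \<Phi>) \<subseteq> L"
    using KL \<open>entries A \<subseteq> K\<close> by (intro entries_mult sL) auto
  then have "fls_deriv ` (K \<union> entries \<Phi>) \<subseteq> L"
    unfolding D\<Phi>[symmetric] using derivation_closed[OF K(1)] KL
    by (auto simp: entries_def)
  then have "differential_field fls_deriv L"
    unfolding L_def by (rule differential_field_hull[OF differential_field_fls])
  moreover have "field_of_constants fls_deriv L = field_of_constants fls_deriv K"
    using K KL by (simp add: field_of_constants_fls)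
  ultimately have "picard_vessiot_linear fls_deriv K L A \<Phi>"
    using K KL by (auto simp: picard_vessiot_linear_def picard_vessiot_by_def fundamental_matrix_def L_def)
  then show ?thesis by blast
qed

section \<open>The variational equation\<close>

lemma has_fps_expansion_field_derivative:
  assumes "open T" "t0 \<in> T"
    and f: "\<And>t. t \<in> T \<Longrightarrow> (f has_field_derivative f' t) (at t)"
    and F: "(\<lambda>x. f (t0 + x)) has_fps_expansion F"
  shows "(\<lambda>x. f' (t0 + x)) has_fps_expansion fps_deriv F"
proof -
  have "open ((\<lambda>x. - t0 + x) ` T)"
    by (rule open_translation[OF \<open>open T\<close>])
  moreover have "0 \<in> (\<lambda>x. - t0 + x) ` T"
    using \<open>t0 \<in> T\<close> by (auto simp: image_iff)
  ultimately have "eventually (\<lambda>x. x \<in> (\<lambda>x. - t0 + x) ` T) (nhds 0)"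
    by (rule eventually_nhds_in_open)
  then have "eventually (\<lambda>x. deriv (\<lambda>x. f (t0 + x)) x = f' (t0 + x)) (nhds 0)"
  proof eventually_elim
    case (elim x)
    then have "t0 + x \<in> T" by auto
    from f[OF this] show ?case
      by (intro DERIV_imp_deriv) (simp add: DERIV_shift add.commute[of t0])
  qed
  with has_fps_expansion_deriv[OF F] show ?thesis
    by (simp add: has_fps_expansion_cong)
qed

text \<open>Complex differentiability on an open set makes the curve holomorphic. Its expansions are
  then power series, the system becomes an identity of formal series, and the variational matrix is
  the companion matrix of a second-order equation.\<close>

lemma solution_expansion:
  fixes b c :: complex
  assumes T: "open T" "t0 \<in> T" and \<gamma>: "integral_curve_on (vfield b c (- 4)) T \<gamma>"
  obtains X Y where
    "laurent_expansion (\<lambda>t. fst (\<gamma> t)) t0 = fps_to_fls X"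
    "laurent_expansion (\<lambda>t. snd (\<gamma> t)) t0 = fps_to_fls Y"
    "fps_deriv X = Y" "fps_deriv Y = - fps_const (3 / 2 * b) * X - fps_const c * (X * X)"
    "(variational_matrix (vfield b c (- 4)) \<gamma> t0) $ 1 $ 1 = 0"
    "(variational_matrix (vfield b c (- 4)) \<gamma> t0) $ 1 $ 2 = 1"
    "(variational_matrix (vfield b c (- 4)) \<gamma> t0) $ 2 $ 1 =
       fps_to_fls (- fps_const (3 / 2 * b) - fps_const (2 * c) * X)"
    "(variational_matrix (vfield b c (- 4)) \<gamma> t0) $ 2 $ 2 = 0"
proof -
  define x y where "x t = fst (\<gamma> t)" and "y t = snd (\<gamma> t)" for t
  have x: "(x has_field_derivative y t) (at t)"
    and y: "(y has_field_derivative - (3 / 2) * b * x t - c * x t ^ 2) (at t)" if "t \<in> T" for t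
    using \<gamma> that unfolding integral_curve_on_def
    by (cases "\<gamma> t"; fastforce simp: x_def[abs_def] y_def[abs_def] vfield_def)+
  have an: "x analytic_on {t0}" "y analytic_on {t0}"
    unfolding analytic_at using x y T
    by (intro exI[of _ T] conjI; (simp add: holomorphic_on_open)?; blast)+
  define X Y where "X = fps_expansion x t0" and "Y = fps_expansion y t0"
  have X: "(\<lambda>s. x (t0 + s)) has_fps_expansion X" and Y: "(\<lambda>s. y (t0 + s)) has_fps_expansion Y"
    unfolding X_def Y_def by (intro analytic_at_imp_has_fps_expansion an)+
  have l: "laurent_expansion g t0 = fps_to_fls G" if "(\<lambda>s. g (t0 + s)) has_fps_expansion G" for g G
    by (intro laurent_expansion_eqI has_laurent_expansion_fps that)
  have "(\<lambda>s. y (t0 + s)) has_fps_expansion fps_deriv X"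
    by (rule has_fps_expansion_field_derivative[OF T x X])
  then have 1: "fps_deriv X = Y"
    using Y fps_expansion_unique_complex by blast
  have "(\<lambda>s. - (3 / 2) * b * x (t0 + s) - c * x (t0 + s) ^ 2) has_fps_expansion fps_deriv Y"
    by (rule has_fps_expansion_field_derivative[OF T y Y])
  moreover have "(\<lambda>s. - (3 / 2 * b) * x (t0 + s) - c * (x (t0 + s) * x (t0 + s))) has_fps_expansion
      - fps_const (3 / 2 * b) * X - fps_const c * (X * X)"
    by (intro fps_expansion_intros X)
  ultimately have 2: "fps_deriv Y = - fps_const (3 / 2 * b) * X - fps_const c * (X * X)"
    using fps_expansion_unique_complex by (simp add: power2_eq_square)
  have J: "jacobian (vfield b c (- 4)) (u, v) = vector [vector [0, 1], vector [- (3 / 2 * b) - 2 * c * u, 0]]" for u v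
  proof -
    have "deriv (\<lambda>w. - (3 / 2) * b * w - c * w ^ 2) u = - (3 / 2 * b) - 2 * c * u"
      by (rule DERIV_imp_deriv) (auto intro!: derivative_eq_intros)
    then show ?thesis
      by (simp add: jacobian_def vfield_def)
  qed
  have J': "jacobian (vfield b c (- 4)) (\<gamma> t) = vector [vector [0, 1], vector [- (3 / 2 * b) - 2 * c * x t, 0]]" for t
    using J[of "fst (\<gamma> t)" "snd (\<gamma> t)"] by (simp add: x_def)
  have "(\<lambda>s. - (3 / 2 * b) - 2 * c * x (t0 + s)) has_fps_expansion
      - fps_const (3 / 2 * b) - fps_const (2 * c) * X"
    by (intro fps_expansion_intros X)
  then have 3: "laurent_expansion (\<lambda>t. - (3 / 2 * b) - 2 * c * x t) t0 =
      fps_to_fls (- fps_const (3 / 2 * b) - fps_const (2 * c) * X)"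
    by (rule l)
  have 4: "laurent_expansion (\<lambda>t. 0) t0 = 0" "laurent_expansion (\<lambda>t. 1) t0 = 1"
    using l[of "\<lambda>t. 0" 0] l[of "\<lambda>t. 1" 1] by (simp_all add: fps_expansion_intros)
  show thesis
    by (rule that[of X Y])
      (use 1 2 3 4 l[OF X] l[OF Y] in \<open>simp_all add: variational_matrix_def J' x_def[abs_def] y_def[abs_def]\<close>)
qed

theorem variational_equation_galois:
  fixes b c :: complex
  assumes T: "open T" "t0 \<in> T" and \<gamma>: "integral_curve_on (vfield b c (- 4)) T \<gamma>"
    and K: "K = solution_field \<gamma> t0" and A: "A = variational_matrix (vfield b c (- 4)) \<gamma> t0"
  shows "\<exists>L \<Phi>. picard_vessiot_linear fls_deriv K L A \<Phi>"
    and "differential_embedding \<iota> fls_deriv K D (L :: 'l :: field set) \<Longrightarrow>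
      picard_vessiot_linear D (\<iota> ` K) L (map_matrix \<iota> A) \<Phi> \<Longrightarrow>
      comm_group ((DGal D (\<iota> ` K) L)\<lparr>carrier := identity_component D (\<iota> ` K) L \<Phi>\<rparr>)"
proof -
  obtain X Y where
    XY: "laurent_expansion (\<lambda>t. fst (\<gamma> t)) t0 = fps_to_fls X"
    "laurent_expansion (\<lambda>t. snd (\<gamma> t)) t0 = fps_to_fls Y"
    and D: "fps_deriv X = Y" "fps_deriv Y = - fps_const (3 / 2 * b) * X - fps_const c * (X * X)"
    and A': "A $ 1 $ 1 = 0" "A $ 1 $ 2 = 1" "A $ 2 $ 1 = fps_to_fls (- fps_const (3 / 2 * b) - fps_const (2 * c) * X)"
      "A $ 2 $ 2 = 0"
    using solution_expansion[OF T \<gamma>] unfolding A by metis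
  define a where "a = - fps_const (3 / 2 * b) - fps_const (2 * c) * X"
  define G where "G = range fls_const \<union> {fps_to_fls X, fps_to_fls Y}"
  have KG: "K = subfield_set hull G"
    by (simp add: K solution_field_def XY G_def)
  then have GK: "G \<subseteq> K" and sK: "subfield_set K"
    using hull_subset[of G subfield_set] by (auto simp: subfield_set_hull)
  have cK: "fps_to_fls (fps_const z) \<in> K" and XK: "fps_to_fls X \<in> K" and YK: "fps_to_fls Y \<in> K" for z
    using GK by (auto simp: G_def)
  have aK: "fps_to_fls a \<in> K"
    unfolding a_def fps_to_fls_minus fps_to_fls_uminus fls_times_fps_to_fls
    by (intro subfield_set_closed[OF sK] cK XK)
  have "fps_to_fls (fps_deriv Y) \<in> K"
    unfolding D fps_to_fls_minus fps_to_fls_uminus fls_times_fps_to_fls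
    by (intro subfield_set_closed[OF sK] cK XK)
  \<comment> \<open>\<open>X' = Y\<close>, and \<open>Y'\<close> is a polynomial in
    \<open>X\<close>, so the two components generate a differential field.\<close>
  then have "fls_deriv ` G \<subseteq> subfield_set hull G"
    unfolding KG[symmetric] using YK subfield_set_0[OF sK]
    by (auto simp: G_def fls_deriv_fps_to_fls D(1))
  then have dK: "differential_field fls_deriv K"
    unfolding KG by (rule differential_field_hull[OF differential_field_fls])
  show "\<exists>L \<Phi>. picard_vessiot_linear fls_deriv K L A \<Phi>"
    by (rule picard_vessiot_second_order_fls[OF dK _ A'(1,2) _ A'(4) aK])
      (use GK A'(3) in \<open>auto simp: G_def a_def\<close>)
  assume emb: "differential_embedding \<iota> fls_deriv K D L"
    and PV: "picard_vessiot_linear D (\<iota> ` K) L (map_matrix \<iota> A) \<Phi>"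
  have \<iota>: "ring_hom_set K \<iota>" and D\<iota>: "\<And>u. u \<in> K \<Longrightarrow> D (\<iota> u) = \<iota> (fls_deriv u)"
    using emb by (auto simp: differential_embedding_def)
  have "D (\<iota> (fps_to_fls a)) = 0 \<or>
      (\<exists>y\<in>\<iota> ` K. y \<noteq> 0 \<and> D (D y) = \<iota> (fps_to_fls a) * y)"
  \<comment> \<open>If the germ of the velocity vanishes, \<open>X\<close> and hence
    \<open>a\<close> are constant. Otherwise differentiating the equation for \<open>Y'\<close>
    shows that \<open>Y\<close> solves the variational equation, and injectivity of
    \<open>\<iota>\<close> keeps its image nonzero.\<close>
  proof (cases "Y = 0")
    case True
    then have "fls_deriv (fps_to_fls a) = 0"
      using D(1) by (simp add: a_def fls_deriv_fps_to_fls)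
    then show ?thesis
      using D\<iota>[OF aK] ring_hom_set_0[OF \<iota> sK] by simp
  next
    case False
    have "\<iota> (fps_to_fls Y) \<noteq> 0"
      using False ring_hom_set_inj[OF \<iota> sK] YK subfield_set_0[OF sK] ring_hom_set_0[OF \<iota> sK]
      by (metis fps_to_fls_eq_0_iff inj_onD)
    moreover have "fps_deriv (fps_deriv Y) = - fps_const (3 / 2 * b) * Y - fps_const c * (Y * X + X * Y)"
      unfolding D(2) by (simp add: D(1))
    then have "fps_deriv (fps_deriv Y) = a * Y"
      unfolding a_def mult_2 fps_const_add[symmetric] by (simp only: algebra_simps)
    then have "fls_deriv (fls_deriv (fps_to_fls Y)) = fps_to_fls a * fps_to_fls Y"
      by (simp add: fls_deriv_fps_to_fls fls_times_fps_to_fls)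
    then have "D (D (\<iota> (fps_to_fls Y))) = \<iota> (fps_to_fls a) * \<iota> (fps_to_fls Y)"
      using D\<iota>[OF YK] D\<iota>[OF derivation_closed[OF dK YK]] ring_hom_set_mult[OF \<iota> sK aK YK] by simp
    ultimately show ?thesis
      using YK by blast
  qed
  then show "comm_group ((DGal D (\<iota> ` K) L)\<lparr>carrier := identity_component D (\<iota> ` K) L \<Phi>\<rparr>)"
    by (intro comm_group_identity_component[OF PV] DGal_second_order_commute[OF PV])
      (simp_all add: A' a_def ring_hom_set_0[OF \<iota> sK] ring_hom_set_1[OF \<iota> sK])
qed

section \<open>The foliation\<close>

lemma iso_integer_mod_group_2:
  fixes G (structure)
  assumes "group G" and G: "carrier G = {\<one>, g}" and g: "g \<noteq> \<one>"
  shows "G \<cong> integer_mod_group 2"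
proof -
  interpret group G by fact
  have gG: "g \<in> carrier G" by (simp add: G)
  then have "g \<otimes> g \<in> {\<one>, g}"
    using m_closed[OF gG gG] G by simp
  moreover have "g \<otimes> g \<noteq> g"
    using gG g by simp
  ultimately have gg: "g \<otimes> g = \<one>" by simp
  define h where "h x = (if x = \<one> then 0 else 1 :: int)" for x
  have c: "carrier (integer_mod_group 2) = {0, 1}"
    by (auto simp: carrier_integer_mod_group)
  have "h \<in> hom G (integer_mod_group 2)"
    unfolding hom_def using gG g gg by (auto simp: h_def G c)
  moreover have "bij_betw h (carrier G) (carrier (integer_mod_group 2))"
    using g by (auto simp: bij_betw_def inj_on_def h_def G c)
  ultimately show ?thesis
    by (auto simp: is_iso_def iso_def)
qed

text \<open>Adjoining a square root \<open>y\<close> of the nonsquare \<open>Q\<close> gives the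
  elements \<open>\<iota> a + \<iota> b * y\<close>. The nontrivial automorphism changes the sign of
  \<open>y\<close>, and it makes no difference whether \<open>S\<close> contains one root or
  both.\<close>

lemma DGal_quadratic:
  fixes \<iota> :: "'k :: field \<Rightarrow> 'l :: field"
  assumes \<iota>: "ring_hom_set UNIV \<iota>" and L: "differential_field D L"
    and D: "\<And>u. D (\<iota> u) = \<iota> (DK u)"
    and hull: "L = subfield_set hull (range \<iota> \<union> S)" and y: "y \<in> S" and S: "S \<subseteq> {y, - y}"
    and Q: "y * y = \<iota> Q" "\<And>r. r * r \<noteq> Q"
    and W: "D y = \<iota> W / y"
    and two: "(2 :: 'l) \<noteq> 0"
  shows "DGal D (range \<iota>) L \<cong> integer_mod_group 2"
proof -
  note U = UNIV_I
  have sU: "subfield_set (UNIV :: 'k set)" by (simp add: subfield_set_def)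
  note h0 = ring_hom_set_0[OF \<iota> sU] and h1 = ring_hom_set_1[OF \<iota> sU]
    and ha = ring_hom_set_add[OF \<iota> sU U U] and hm = ring_hom_set_mult[OF \<iota> sU U U]
    and hn = ring_hom_set_uminus[OF \<iota> sU U] and hd = ring_hom_set_diff[OF \<iota> sU U U]
    and hi = ring_hom_set_inverse[OF \<iota> sU U] and hq = ring_hom_set_divide[OF \<iota> sU U U]
  have inj: "\<iota> u = \<iota> v \<Longrightarrow> u = v" for u v
    using ring_hom_set_inj[OF \<iota> sU] by (auto simp: inj_on_def)
  have sL: "subfield_set L" by (rule differential_field_subfield[OF L])
  note cL = subfield_set_closed[OF sL]
  have y_notin: "y \<noteq> \<iota> r" for r
    using Q inj[of "r * r" Q] by (auto simp: hm)
  have y0: "y \<noteq> 0" using y_notin[of 0] by (simp add: h0)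
  have Q0: "Q \<noteq> 0" using Q(2)[of 0] by auto
  have yL: "y \<in> L" and \<iota>L: "\<iota> u \<in> L" for u
    using hull_subset[of "range \<iota> \<union> S" subfield_set] y unfolding hull by auto
  \<comment> \<open>Coordinates are unique, as otherwise \<open>y\<close> would be a quotient of
    elements of the base field.\<close>
  have coeffs: "b = b' \<and> a = a'" if "\<iota> a + \<iota> b * y = \<iota> a' + \<iota> b' * y" for a b a' b'
  proof -
    have *: "\<iota> (b - b') * y = \<iota> (a' - a)"
      using that by (simp add: hd algebra_simps)
    have "b - b' = 0"
    proof (rule ccontr)
      assume "b - b' \<noteq> 0"
      then have "\<iota> (b - b') \<noteq> 0"
        using inj[of "b - b'" 0] h0 by auto
      with * have "y = \<iota> ((a' - a) / (b - b'))"
        unfolding hq by (simp add: nonzero_eq_divide_eq mult.commute)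
      then show False using y_notin by blast
    qed
    with * that show ?thesis
      by (auto simp: h0 dest: inj)
  qed
  let ?M = "{\<iota> a + \<iota> b * y | a b. True}"
  have "subfield_set ?M"
    unfolding subfield_set_def
  proof (intro conjI ballI)
    have "0 = \<iota> 0 + \<iota> 0 * y" "1 = \<iota> 1 + \<iota> 0 * y"
      by (simp_all add: h0 h1)
    then show "0 \<in> ?M" "1 \<in> ?M"
      by blast+
  next
    fix u v assume "u \<in> ?M" "v \<in> ?M"
    then obtain a b c d where uv: "u = \<iota> a + \<iota> b * y" "v = \<iota> c + \<iota> d * y" by blast
    have "u + v = \<iota> (a + c) + \<iota> (b + d) * y"
      by (simp add: uv ha algebra_simps)
    then show "u + v \<in> ?M" by blast
    have "u * v = \<iota> a * \<iota> c + \<iota> b * \<iota> d * (y * y) + (\<iota> a * \<iota> d + \<iota> b * \<iota> c) * y"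
      by (simp add: uv algebra_simps)
    also have "\<dots> = \<iota> (a * c + b * d * Q) + \<iota> (a * d + b * c) * y"
      by (simp only: ha hm Q(1))
    finally show "u * v \<in> ?M" by blast
  next
    fix u assume "u \<in> ?M"
    then obtain a b where u: "u = \<iota> a + \<iota> b * y" by blast
    have "- u = \<iota> (- a) + \<iota> (- b) * y"
      by (simp add: u hn)
    then show "- u \<in> ?M" by blast
    show "inverse u \<in> ?M"
    proof (cases "u = 0")
      case True
      have "inverse u = \<iota> 0 + \<iota> 0 * y" by (simp add: True h0)
      then show ?thesis by blast
    next
      case False
      \<comment> \<open>The norm of \<open>u\<close>. It is nonzero for \<open>u \<noteq> 0\<close>,
        because \<open>a * a = b * b * Q\<close> with \<open>b \<noteq> 0\<close> would make
        \<open>Q\<close> a square.\<close>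
      define N where "N = a * a - b * b * Q"
      have "N \<noteq> 0"
      proof
        assume "N = 0"
        then have e: "a * a = b * b * Q" by (simp add: N_def)
        have "b \<noteq> 0"
        proof
          assume "b = 0"
          with e have "a = 0" by simp
          with \<open>b = 0\<close> False show False by (simp add: u h0)
        qed
        with e have "a / b * (a / b) = Q" by simp
        with Q(2) show False by blast
      qed
      then have N0: "\<iota> N \<noteq> 0"
        using inj[of N 0] h0 by auto
      have "u * (\<iota> a - \<iota> b * y) = \<iota> a * \<iota> a - \<iota> b * \<iota> b * (y * y)"
        by (simp add: u algebra_simps)
      also have "\<dots> = \<iota> N"
        by (simp only: N_def hd hm Q(1))
      finally have "u * ((\<iota> a - \<iota> b * y) / \<iota> N) = 1"
        using N0 by simp
      then have "inverse u = (\<iota> a - \<iota> b * y) / \<iota> N"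
        by (rule inverse_unique)
      also have "\<dots> = \<iota> (a / N) + \<iota> (- b / N) * y"
        by (simp add: hq hn diff_divide_distrib)
      finally show ?thesis by blast
    qed
  qed
  moreover have "range \<iota> \<union> S \<subseteq> ?M"
  proof -
    have "\<iota> a = \<iota> a + \<iota> 0 * y" "y = \<iota> 0 + \<iota> 1 * y" "- y = \<iota> 0 + \<iota> (- 1) * y" for a
      by (simp_all add: h0 h1 hn)
    then have "range \<iota> \<subseteq> ?M" "y \<in> ?M" "- y \<in> ?M" by blast+
    with S show ?thesis by blast
  qed
  ultimately have "L \<subseteq> ?M"
    unfolding hull by (intro hull_minimal)
  then have "\<forall>u\<in>L. \<exists>a b. u = \<iota> a + \<iota> b * y" by blast
  then obtain A B where AB: "\<And>u. u \<in> L \<Longrightarrow> u = \<iota> (A u) + \<iota> (B u) * y"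
    by metis
  have inL: "\<iota> a + \<iota> b * y \<in> L" "\<iota> a - \<iota> b * y \<in> L" for a b
    by (intro cL \<iota>L yL)+
  define \<sigma> where "\<sigma> = (\<lambda>u\<in>L. \<iota> (A u) - \<iota> (B u) * y)"
  have \<sigma>: "\<sigma> (\<iota> a + \<iota> b * y) = \<iota> a - \<iota> b * y" for a b
    using coeffs[OF AB[OF inL(1)[of a b]]] inL[of a b] by (simp add: \<sigma>_def)
  have \<sigma>': "\<sigma> (\<iota> a - \<iota> b * y) = \<iota> a + \<iota> b * y" for a b
    using \<sigma>[of a "- b"] by (simp add: hn)
  have \<sigma>L: "\<sigma> u \<in> L" "\<sigma> (\<sigma> u) = u" if uL: "u \<in> L" for u
  proof -
    obtain a b where u: "u = \<iota> a + \<iota> b * y" using AB[OF uL] by blast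
    show "\<sigma> u \<in> L" "\<sigma> (\<sigma> u) = u"
      unfolding u by (simp_all only: \<sigma> \<sigma>' inL)
  qed
  have \<sigma>y: "\<sigma> y = - y" "\<sigma> (\<iota> a) = \<iota> a" for a
    using \<sigma>[of 0 1] \<sigma>[of a 0] by (simp_all add: h0 h1)
  \<comment> \<open>\<open>D y\<close> is the multiple of \<open>y\<close> by \<open>W / Q\<close>,
    so \<open>D\<close> preserves both the base field and its multiples of \<open>y\<close>, and
    therefore commutes with the change of sign.\<close>
  have D\<sigma>: "\<sigma> (D u) = D (\<sigma> u)" if uL: "u \<in> L" for u
  proof -
    obtain a b where u: "u = \<iota> a + \<iota> b * y" using AB[OF uL] by blast
    have "\<iota> W / y = \<iota> W * y / (y * y)"
      using y0 by simp
    also have "\<dots> = \<iota> (W / Q) * y"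
      unfolding Q(1) hq by simp
    finally have Dy: "D y = \<iota> (W / Q) * y" unfolding W .
    have Db: "D (\<iota> b * y) = \<iota> (DK b + b * (W / Q)) * y"
      unfolding derivation_mult[OF L \<iota>L yL] D Dy by (simp only: ha hm distrib_right mult.assoc)
    have "D u = \<iota> (DK a) + \<iota> (DK b + b * (W / Q)) * y"
      unfolding u using derivation_add[OF L \<iota>L cL(4)[OF \<iota>L yL]] by (simp add: D Db)
    moreover have "D (\<sigma> u) = \<iota> (DK a) - \<iota> (DK b + b * (W / Q)) * y"
      unfolding u \<sigma> using derivation_diff[OF L \<iota>L cL(4)[OF \<iota>L yL]] by (simp add: D Db)
    ultimately show ?thesis by (simp only: \<sigma>)
  qed
  have "ring_hom_set L \<sigma>"
    unfolding ring_hom_set_def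
  proof (intro conjI ballI)
    show "\<sigma> 1 = 1" using \<sigma>y(2)[of 1] by (simp add: h1)
  next
    fix u v assume uvL: "u \<in> L" "v \<in> L"
    obtain a b c d where uv: "u = \<iota> a + \<iota> b * y" "v = \<iota> c + \<iota> d * y"
      using AB[OF uvL(1)] AB[OF uvL(2)] by blast
    have "u + v = \<iota> (a + c) + \<iota> (b + d) * y"
      by (simp add: uv ha algebra_simps)
    then have "\<sigma> (u + v) = \<iota> (a + c) - \<iota> (b + d) * y"
      by (simp only: \<sigma>)
    then show "\<sigma> (u + v) = \<sigma> u + \<sigma> v"
      unfolding uv \<sigma> by (simp add: ha algebra_simps)
    have "u * v = \<iota> a * \<iota> c + \<iota> b * \<iota> d * (y * y) + (\<iota> a * \<iota> d + \<iota> b * \<iota> c) * y"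
      by (simp add: uv algebra_simps)
    also have "\<dots> = \<iota> (a * c + b * d * Q) + \<iota> (a * d + b * c) * y"
      by (simp only: ha hm Q(1))
    finally have "\<sigma> (u * v) = \<iota> (a * c + b * d * Q) - \<iota> (a * d + b * c) * y"
      by (simp only: \<sigma>)
    also have "\<dots> = \<iota> a * \<iota> c + \<iota> b * \<iota> d * (y * y) - (\<iota> a * \<iota> d + \<iota> b * \<iota> c) * y"
      by (simp only: ha hm Q(1))
    also have "\<dots> = \<sigma> u * \<sigma> v"
      unfolding uv \<sigma> by (simp add: algebra_simps)
    finally show "\<sigma> (u * v) = \<sigma> u * \<sigma> v" .
  qed
  moreover have "\<sigma> \<in> Bij L"
    unfolding Bij_def bij_betw_def
  proof (intro IntI CollectI conjI)
    show "\<sigma> \<in> extensional L" by (simp add: \<sigma>_def)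
    show "inj_on \<sigma> L" using \<sigma>L(2) by (metis inj_onI)
    show "\<sigma> ` L = L" using \<sigma>L by (metis (no_types, lifting) image_eqI image_subsetI subsetI subset_antisym)
  qed
  ultimately have \<sigma>G: "\<sigma> \<in> carrier (DGal D (range \<iota>) L)"
    using D\<sigma> \<sigma>y(2) by (auto simp: in_DGal_iff)
  have KL: "range \<iota> \<subseteq> L" using \<iota>L by auto
  interpret group "DGal D (range \<iota>) L"
    by (rule group_DGal[OF L KL])
  let ?G = "DGal D (range \<iota>) L"
  have "\<tau> = \<one>\<^bsub>?G\<^esub> \<or> \<tau> = \<sigma>" if t: "\<tau> \<in> carrier ?G" for \<tau>
  proof -
    have eq: "\<tau> = \<rho>" if r: "\<rho> \<in> carrier ?G" and "\<tau> y = \<rho> y" for \<rho>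
    proof (rule extensionalityI[OF DGal_mem(5)[OF t] DGal_mem(5)[OF r]])
      fix u assume u: "u \<in> L"
      have "\<tau> v = \<rho> v" if "v \<in> range \<iota> \<union> S" for v
        using that DGal_mem(4)[OF t] DGal_mem(4)[OF r] S \<open>\<tau> y = \<rho> y\<close>
          ring_hom_set_uminus[OF DGal_mem(1)[OF t] sL yL]
          ring_hom_set_uminus[OF DGal_mem(1)[OF r] sL yL] by auto
      then show "\<tau> u = \<rho> u"
        using ring_hom_set_eq_on_hull[OF DGal_mem(1)[OF t] DGal_mem(1)[OF r] sL hull] u by blast
    qed
    \<comment> \<open>An automorphism can only permute the two square roots of \<open>Q\<close>, and
      its value at \<open>y\<close> determines it.\<close>
    have "\<tau> y * \<tau> y = y * y"
      unfolding ring_hom_set_mult[OF DGal_mem(1)[OF t] sL yL yL, symmetric] Q(1)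
      using DGal_mem(4)[OF t] by auto
    then have "\<tau> y = y \<or> \<tau> y = - y"
      by (simp add: square_eq_iff)
    then show ?thesis
    proof
      assume "\<tau> y = y"
      then have "\<tau> = \<one>\<^bsub>?G\<^esub>" by (intro eq one_closed) (simp add: DGal_one yL)
      then show ?thesis ..
    next
      assume "\<tau> y = - y"
      then have "\<tau> = \<sigma>" by (intro eq \<sigma>G) (simp add: \<sigma>y)
      then show ?thesis ..
    qed
  qed
  then have "carrier ?G = {\<one>\<^bsub>?G\<^esub>, \<sigma>}"
    using \<sigma>G by auto
  moreover have "\<sigma> \<noteq> \<one>\<^bsub>?G\<^esub>"
  proof
    assume "\<sigma> = \<one>\<^bsub>?G\<^esub>"
    then have "- y = y" using \<sigma>y(1) yL by (simp add: DGal_one)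
    then have "2 * y = 0" by (metis mult_2 neg_eq_iff_add_eq_0)
    with two y0 show False by simp
  qed
  ultimately show ?thesis
    by (intro iso_integer_mod_group_2 is_group)
qed

text \<open>Comparing degrees in \<open>u * u = q * (v * v)\<close> contradicts parity.\<close>

lemma odd_degree_not_square_fract:
  fixes q :: "'a :: field poly"
  assumes "odd (degree q)"
  shows "r * r \<noteq> to_fract q"
proof
  assume r: "r * r = to_fract q"
  obtain u v where uv: "r = Fract u v" "v \<noteq> 0"
    by (cases r)
  have "u * u = q * (v * v)"
    using r uv by (simp add: to_fract_def eq_fract)
  moreover have "q \<noteq> 0" using assms by auto
  ultimately have "u \<noteq> 0" using uv by auto
  have "degree (u * u) = degree (q * (v * v))"
    using \<open>u * u = _\<close> by simp
  then have "2 * degree u = degree q + 2 * degree v"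
    using \<open>u \<noteq> 0\<close> \<open>q \<noteq> 0\<close> uv by (simp add: degree_mult_eq)
  with assms show False by presburger
qed

section \<open>Rational functions as Laurent series\<close>

definition fract_lift :: "('a :: idom \<Rightarrow> 'b :: field) \<Rightarrow> 'a fract \<Rightarrow> 'b" where
  "fract_lift e r = (let (p, q) = SOME (p, q). q \<noteq> 0 \<and> r = Fract p q in e p / e q)"

context
  fixes e :: "'a :: idom \<Rightarrow> 'b :: field"
  assumes e1: "e 1 = 1" and e_add: "\<And>p q. e (p + q) = e p + e q"
    and e_mult: "\<And>p q. e (p * q) = e p * e q" and e_nz: "\<And>p. p \<noteq> 0 \<Longrightarrow> e p \<noteq> 0"
begin

lemma fract_lift_Fract:
  assumes "q \<noteq> 0"
  shows "fract_lift e (Fract p q) = e p / e q"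
proof -
  obtain c d where cd: "(SOME (p', q'). q' \<noteq> 0 \<and> Fract p q = Fract p' q') = (c, d)"
    by (meson surj_pair)
  have "case (SOME (p', q'). q' \<noteq> 0 \<and> Fract p q = Fract p' q') of
          (p', q') \<Rightarrow> q' \<noteq> 0 \<and> Fract p q = Fract p' q'"
    by (rule someI[of _ "(p, q)"]) (simp add: assms)
  then have d: "d \<noteq> 0" and "Fract p q = Fract c d"
    by (simp_all add: cd)
  then have "p * d = c * q"
    using assms by (simp add: eq_fract)
  then have "e p * e d = e c * e q"
    by (simp flip: e_mult)
  then have "e c / e d = e p / e q"
    using e_nz[OF d] e_nz[OF assms] by (simp add: frac_eq_eq)
  then show ?thesis
    by (simp add: fract_lift_def cd)
qed

lemma fract_lift_to_fract: "fract_lift e (to_fract p) = e p"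
  by (simp add: to_fract_def fract_lift_Fract e1)

lemma ring_hom_fract_lift: "ring_hom_set UNIV (fract_lift e)"
  unfolding ring_hom_set_def
proof (intro conjI ballI)
  show "fract_lift e 1 = 1"
    by (simp add: One_fract_def fract_lift_Fract e1)
next
  fix r s :: "'a fract"
  obtain p q p' q' where r: "r = Fract p q" "q \<noteq> 0" and s: "s = Fract p' q'" "q' \<noteq> 0"
    by (metis Fract_cases)
  show "fract_lift e (r + s) = fract_lift e r + fract_lift e s"
    using r s e_nz by (simp add: fract_lift_Fract e_add e_mult add_frac_eq)
  show "fract_lift e (r * s) = fract_lift e r * fract_lift e s"
    using r s by (simp add: fract_lift_Fract e_mult)
qed

end

lemma differential_field_fract: "differential_field fract_deriv (UNIV :: 'a :: idom poly fract set)"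
  unfolding differential_field_def subfield_set_def
proof (intro conjI ballI)
  fix r s :: "'a poly fract"
  obtain p q p' q' where r: "r = Fract p q" "q \<noteq> 0" and s: "s = Fract p' q'" "q' \<noteq> 0"
    by (metis Fract_cases)
  show "fract_deriv (r + s) = fract_deriv r + fract_deriv s"
    using r s by (simp add: fract_deriv_Fract eq_fract pderiv_add pderiv_mult algebra_simps)
  show "fract_deriv (r * s) = fract_deriv r * s + r * fract_deriv s"
    using r s by (simp add: fract_deriv_Fract eq_fract pderiv_mult algebra_simps)
qed auto

text \<open>The Taylor series at \<open>a\<close>. The centre stays free so that a point can be
  chosen at which the cubic of the foliation has a power series as square root.\<close>

definition poly_expansion :: "complex \<Rightarrow> complex poly \<Rightarrow> complex fls" where
  "poly_expansion a p = fps_to_fls (fps_of_poly (pcompose p [:a, 1:]))"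

lemma poly_expansion_hom:
  "poly_expansion a 1 = 1" "poly_expansion a (p + q) = poly_expansion a p + poly_expansion a q"
  "poly_expansion a (p * q) = poly_expansion a p * poly_expansion a q"
  "p \<noteq> 0 \<Longrightarrow> poly_expansion a p \<noteq> 0"
proof -
  show "poly_expansion a p \<noteq> 0" if "p \<noteq> 0"
    using that pcompose_eq_0[of p "[:a, 1:]"] by (auto simp: poly_expansion_def)
qed (simp_all add: poly_expansion_def pcompose_1 pcompose_add pcompose_mult fps_of_poly_add fps_of_poly_mult
    fls_times_fps_to_fls)

lemma poly_expansion_deriv: "fls_deriv (poly_expansion a p) = poly_expansion a (pderiv p)"
  by (simp add: poly_expansion_def fls_deriv_fps_to_fls pderiv_pCons pderiv_pcompose
      flip: fps_of_poly_pderiv)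

lemma poly_expansion_const: "poly_expansion a [:z:] = fls_const z"
  by (simp add: poly_expansion_def)

lemma fract_lift_deriv:
  "fls_deriv (fract_lift (poly_expansion a) r) = fract_lift (poly_expansion a) (fract_deriv r)"
proof -
  obtain p q where r: "r = Fract p q" "q \<noteq> 0"
    by (cases r)
  let ?e = "poly_expansion a"
  note l = fract_lift_Fract[of ?e, OF poly_expansion_hom]
  have u: "?e q \<noteq> 0"
    by (rule poly_expansion_hom(4)[OF r(2)])
  have "?e (p - r) = ?e p - ?e r" for p r
    using poly_expansion_hom(2)[of a "p - r" r] by simp
  then have "fract_lift ?e (fract_deriv r)
      = (fls_deriv (?e p) * ?e q - ?e p * fls_deriv (?e q)) / (?e q * ?e q)"
    using r by (simp add: fract_deriv_Fract l poly_expansion_deriv poly_expansion_hom)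
  moreover have "fls_deriv (?e p / ?e q) * ?e q + ?e p / ?e q * fls_deriv (?e q) = fls_deriv (?e p)"
    using u fls_deriv_mult[of "?e p / ?e q" "?e q"] by simp
  then have "fls_deriv (?e p / ?e q) * ?e q * ?e q = fls_deriv (?e p) * ?e q - ?e p * fls_deriv (?e q)"
    using u by (simp add: field_simps)
  then have "fls_deriv (?e p / ?e q) = (fls_deriv (?e p) * ?e q - ?e p * fls_deriv (?e q)) / (?e q * ?e q)"
    using u by (simp add: eq_divide_eq mult.assoc)
  ultimately show ?thesis
    using r by (simp add: l)
qed

text \<open>\<open>q\<close> is \<open>y^2\<close> expressed through the energy, and the second
  component of the field is half of \<open>q'\<close>. The equation of the foliation on a level is
  therefore the derivative of \<open>y * y = q\<close>.\<close>

lemma foliation_square_root: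
  fixes \<iota> :: "complex poly fract \<Rightarrow> 'l :: field"
    and b c h :: complex
  assumes \<iota>: "ring_hom_set UNIV \<iota>" and two: "(2 :: 'l) \<noteq> 0" "(3 :: 'l) \<noteq> 0"
  defines "q \<equiv> [:2 * h, 0, - 3 / 2 * b, - 2 / 3 * c:]"
  shows "ham (\<iota> (ratconst b)) (\<iota> (ratconst c)) (\<iota> ratvar, y) = \<iota> (ratconst h) \<longleftrightarrow>
           y * y = \<iota> (to_fract q)"
    and "vfield (\<iota> (ratconst b)) (\<iota> (ratconst c)) (\<iota> (ratconst (- 4))) (\<iota> ratvar, y) =
           (y, \<iota> (to_fract (smult (1/2) (pderiv q))))"
proof -
  note U = UNIV_I
  have sU: "subfield_set (UNIV :: complex poly fract set)" by (simp add: subfield_set_def)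
  note h0 = ring_hom_set_0[OF \<iota> sU] and h1 = ring_hom_set_1[OF \<iota> sU]
    and ha = ring_hom_set_add[OF \<iota> sU U U] and hm = ring_hom_set_mult[OF \<iota> sU U U]
  define e where "e p = \<iota> (to_fract p)" for p
  have e: "e 1 = 1" "e (p + r) = e p + e r" "e (p * r) = e p * e r" for p r
    by (simp_all add: e_def h1 ha hm)
  have en: "e (- p) = - e p" for p
    by (simp add: e_def ring_hom_set_uminus[OF \<iota> sU U])
  have enum: "e (numeral k) = numeral k" for k
  proof -
    have "e (of_nat n) = of_nat n" for n
    proof (induction n)
      case 0
      show ?case by (simp add: e_def h0)
    qed (simp add: e)
    from this[of "numeral k"] show ?thesis by simp
  qed
  \<comment> \<open>Only the effect of \<open>e\<close> on sums, products and numerals is at hand,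
    so denominators are cleared before \<open>e\<close> is applied.\<close>
  have "6 * q = 12 * [:h:] - 9 * ([:b:] * ([:0, 1:] * [:0, 1:])) - 4 * ([:c:] * ([:0, 1:] * ([:0, 1:] * [:0, 1:])))"
    by (simp add: q_def numeral_poly)
  then have "6 * q + 9 * ([:b:] * ([:0, 1:] * [:0, 1:])) + 4 * ([:c:] * ([:0, 1:] * ([:0, 1:] * [:0, 1:]))) = 12 * [:h:]"
    by simp
  from arg_cong[OF this, of e]
  have 1: "6 * e q + 9 * (e [:b:] * (e [:0, 1:] * e [:0, 1:])) + 4 * (e [:c:] * (e [:0, 1:] * (e [:0, 1:] * e [:0, 1:]))) = 12 * e [:h:]"
    by (simp only: e enum)
  have nz: "(6 :: 'l) \<noteq> 0" "(12 :: 'l) \<noteq> 0" "(4 :: 'l) \<noteq> 0"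
    using two by (metis mult_eq_0_iff numeral_times_numeral semiring_norm(12,13,14))+
  define B C X where "B = e [:b:]" and "C = e [:c:]" and "X = e [:0, 1:]"
  have "ham B C (X, y) = e [:h:] \<longleftrightarrow> 12 * ham B C (X, y) = 12 * e [:h:]"
    using nz by simp
  also have "12 * ham B C (X, y) = 6 * (y * y) + 9 * (B * (X * X)) + 4 * (C * (X * (X * X)))"
  proof -
    have "12 * (u / 2) = 6 * u" "12 * (v / 3 * w) = 4 * (v * w)" "12 * (3 / 4 * v * w) = 9 * (v * w)" for u v w :: 'l
    proof -
      have "(12 :: 'l) = 6 * 2" "(12 :: 'l) = 4 * 3" by simp_all
      then show "12 * (u / 2) = 6 * u" "12 * (v / 3 * w) = 4 * (v * w)"
        using two by (metis (no_types) mult.assoc nonzero_mult_div_cancel_left times_divide_eq_right mult.commute)+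
      have "12 * (3 / 4 * v * w) = (12 * (3 / 4)) * (v * w)" by (simp only: mult.assoc)
      also have "12 * (3 / 4) = (9 :: 'l)" using nz(3) by (simp add: eq_divide_eq)
      finally show "12 * (3 / 4 * v * w) = 9 * (v * w)" .
    qed
    then show ?thesis
      by (simp only: ham_def prod.case distrib_left power2_eq_square power3_eq_cube mult.assoc)
        (simp only: add.assoc add.commute[of "4 * _"])
  qed
  also have "\<dots> = 12 * e [:h:] \<longleftrightarrow> 6 * (y * y) = 6 * e q"
    unfolding 1[symmetric, folded B_def C_def X_def] by (simp only: add_right_cancel)
  also have "\<dots> \<longleftrightarrow> y * y = e q"
    using nz by simp
  finally show "ham (\<iota> (ratconst b)) (\<iota> (ratconst c)) (\<iota> ratvar, y) = \<iota> (ratconst h) \<longleftrightarrow>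
           y * y = \<iota> (to_fract q)"
    by (simp add: B_def C_def X_def e_def)
  have "2 * smult (1/2) (pderiv q) + 3 * ([:b:] * [:0, 1:]) + 2 * ([:c:] * ([:0, 1:] * [:0, 1:])) = 0"
    by (simp add: q_def numeral_poly pderiv_pCons)
  from arg_cong[OF this, of e]
  have 2: "2 * e (smult (1/2) (pderiv q)) + 3 * (B * X) + 2 * (C * (X * X)) = 0"
    by (simp only: e enum B_def C_def X_def) (simp add: e_def h0)
  have "e [:- 4:] + 4 = 0"
  proof -
    have "e ([:- 4:] + 4) = e 0" by (simp add: numeral_poly)
    then show ?thesis by (simp only: e enum) (simp add: e_def h0)
  qed
  moreover have "- (3 / 2) * B * X - C * X ^ 2 = e (smult (1/2) (pderiv q))"
  proof -
    have "2 * (- (3 / 2) * B * X - C * X ^ 2) = - 3 * (B * X) - 2 * (C * (X * X))"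
      using two by (simp add: right_diff_distrib power2_eq_square)
    also have "\<dots> = 2 * e (smult (1/2) (pderiv q))"
      using 2 by (simp add: diff_eq_eq eq_diff_eq eq_neg_iff_add_eq_0 neg_eq_iff_add_eq_0 ac_simps)
    finally show ?thesis
      by (rule mult_left_cancel[THEN iffD1, OF two(1)])
  qed
  ultimately show "vfield (\<iota> (ratconst b)) (\<iota> (ratconst c)) (\<iota> (ratconst (- 4))) (\<iota> ratvar, y) =
           (y, \<iota> (to_fract (smult (1/2) (pderiv q))))"
    by (simp add: vfield_def B_def C_def X_def flip: e_def)
qed

text \<open>Nothing is known about the field \<open>'l\<close> except that it receives the rational
  functions; this already excludes characteristics 2 and 3.\<close>

lemma rat_embedding_facts:
  fixes \<iota> :: "complex poly fract \<Rightarrow> 'l :: field"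
  assumes "ring_hom_set UNIV \<iota>"
  shows "(2 :: 'l) \<noteq> 0" "(3 :: 'l) \<noteq> 0"
proof -
  have sU: "subfield_set (UNIV :: complex poly fract set)" by (simp add: subfield_set_def)
  have "(numeral k :: 'l) \<noteq> 0" if "(numeral k :: complex) \<noteq> 0" for k
  proof -
    have "(of_nat n :: complex poly fract) = to_fract [:of_nat n:]" for n
      by (induction n) (simp_all flip: to_fract_1 to_fract_add add: one_pCons)
    from this[of "numeral k"] have "(numeral k :: complex poly fract) \<noteq> 0"
      using that by (metis of_nat_numeral pCons_eq_0_iff to_fract_eq_0_iff)
    then show ?thesis
      using ring_hom_set_inj[OF assms sU] ring_hom_set_numeral[OF assms sU] ring_hom_set_0[OF assms sU]
      by (metis UNIV_I inj_onD)
  qed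
  then show "(2 :: 'l) \<noteq> 0" "(3 :: 'l) \<noteq> 0" by simp_all
qed

text \<open>\<open>c \<noteq> 0\<close> gives \<open>q\<close> degree 3 at every energy
  \<open>h\<close>, so no level is exceptional, degenerate cubics included.\<close>

lemma DGal_foliation:
  fixes b c h :: complex and L :: "'l :: field set"
  assumes "c \<noteq> 0" and F: "foliation_extension b c (- 4) h \<iota> D L"
  shows "DGal D (range \<iota>) L \<cong> integer_mod_group 2"
proof -
  define q where "q = [:2 * h, 0, - 3 / 2 * b, - 2 / 3 * c:]"
  let ?S = "leaf_solutions b c (- 4) h \<iota> D L"
  have emb: "differential_field D L" "ring_hom_set UNIV \<iota>" "\<And>u. D (\<iota> u) = \<iota> (fract_deriv u)"
    and hull: "L = subfield_set hull (range \<iota> \<union> ?S)" and "?S \<noteq> {}"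
    using F by (auto simp: foliation_extension_def differential_embedding_def picard_vessiot_by_def)
  note two = rat_embedding_facts[OF emb(2)]
  note sq = foliation_square_root[OF emb(2) two, of b c _ h, folded q_def]
  have S: "y \<in> ?S \<longleftrightarrow> y \<in> L \<and> y \<noteq> 0 \<and> y * y = \<iota> (to_fract q) \<and>
      D y = \<iota> (to_fract (smult (1/2) (pderiv q))) / y" for y
    by (auto simp: leaf_solutions_def foliation_solution_def sq)
  obtain y where y: "y \<in> ?S"
    using \<open>?S \<noteq> {}\<close> by blast
  have "odd (degree q)"
    using \<open>c \<noteq> 0\<close> by (simp add: q_def)
  from odd_degree_not_square_fract[OF this]
  show ?thesis
  proof (intro DGal_quadratic[OF emb(2,1,3) hull y])
    show "?S \<subseteq> {y, - y}"
    proof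
      fix x assume "x \<in> ?S"
      then have "x * x = y * y"
        using y by (simp add: S)
      then show "x \<in> {y, - y}"
        by (simp add: square_eq_iff)
    qed
  qed (use y two in \<open>auto simp: S\<close>)
qed

text \<open>Expansion at a point \<open>a\<close> with \<open>poly q a \<noteq> 0\<close> embeds the
  rational functions into Laurent series, where \<open>q\<close> has a square root because its
  constant coefficient is nonzero.\<close>

lemma foliation_extension_exists:
  fixes b c h :: complex
  assumes "c \<noteq> 0"
  shows "\<exists>\<iota> (L :: complex fls set). foliation_extension b c (- 4) h \<iota> fls_deriv L"
proof -
  define q where "q = [:2 * h, 0, - 3 / 2 * b, - 2 / 3 * c:]"
  have "q \<noteq> 0"
    using assms by (simp add: q_def)
  then have "finite {a. poly q a = 0}"
    by (rule poly_roots_finite)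
  then obtain a where a: "poly q a \<noteq> 0"
    using ex_new_if_finite[OF infinite_UNIV_char_0] by blast
  define \<iota> where "\<iota> = fract_lift (poly_expansion a)"
  note l = fract_lift_to_fract[of "poly_expansion a", OF poly_expansion_hom, folded \<iota>_def]
  have hom: "ring_hom_set UNIV \<iota>"
    unfolding \<iota>_def by (rule ring_hom_fract_lift) (rule poly_expansion_hom; assumption?)+
  have D: "fls_deriv (\<iota> u) = \<iota> (fract_deriv u)" for u
    by (simp add: \<iota>_def fract_lift_deriv)
  note two = rat_embedding_facts[OF hom]
  note sq = foliation_square_root[OF hom two, of b c _ h, folded q_def]
  \<comment> \<open>The solutions are collected in all Laurent series, because \<open>L\<close> is
    to be generated by them; \<open>leaf\<close> confirms that none is lost by restricting to
    \<open>L\<close>.\<close>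
  define S where "S = {y :: complex fls. foliation_solution fls_deriv
     (vfield (\<iota> (ratconst b)) (\<iota> (ratconst c)) (\<iota> (ratconst (- 4)))) (\<iota> ratvar) y \<and>
     ham (\<iota> (ratconst b)) (\<iota> (ratconst c)) (\<iota> ratvar, y) = \<iota> (ratconst h)}"
  define L where "L = subfield_set hull (range \<iota> \<union> S)"
  have KS: "range \<iota> \<subseteq> L" "S \<subseteq> L"
    using hull_subset[of "range \<iota> \<union> S" subfield_set] by (auto simp: L_def)
  have leaf: "leaf_solutions b c (- 4) h \<iota> fls_deriv L = S"
    using KS by (auto simp: leaf_solutions_def S_def)
  have sU: "subfield_set (UNIV :: complex poly fract set)" by (simp add: subfield_set_def)
  have sL: "subfield_set L"
    by (simp add: L_def subfield_set_hull)
  have "fls_deriv ` (range \<iota> \<union> S) \<subseteq> L"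
  proof -
    have "fls_deriv y \<in> L" if "y \<in> S" for y
    proof -
      have "fls_deriv y = \<iota> (to_fract (smult (1/2) (pderiv q))) / y"
        using that by (simp add: S_def foliation_solution_def sq)
      also have "\<dots> \<in> L"
        using that KS by (intro subfield_set_divide[OF sL]) auto
      finally show ?thesis .
    qed
    then show ?thesis
      using KS by (auto simp: D)
  qed
  then have dL: "differential_field fls_deriv L"
    unfolding L_def by (rule differential_field_hull[OF differential_field_fls])
  have dK: "differential_field fls_deriv (range \<iota>)"
    using ring_hom_set_image_subfield[OF hom sU]
    by (auto simp: differential_field_def D)
  have "fls_const z = \<iota> (ratconst z)" for z
    by (simp add: l poly_expansion_const)
  then have const: "range fls_const \<subseteq> range \<iota>" by auto
  have "field_of_constants fls_deriv L = field_of_constants fls_deriv (range \<iota>)"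
    using const KS by (simp add: field_of_constants_fls order_trans)
  moreover have "S \<noteq> {}"
  proof -
    define Q where "Q = fps_of_poly (pcompose q [:a, 1:])"
    have Q0: "fps_nth Q 0 = poly q a"
      by (simp add: Q_def fps_of_poly_nth poly_pcompose flip: poly_0_coeff_0)
    define w where "w = fps_radical (\<lambda>_. csqrt) 2 Q"
    \<comment> \<open>The formal radical is a root once its constant coefficient is one; the
      exponent has the form \<open>Suc 1\<close> to match \<open>power_radical\<close>.\<close>
    have "csqrt (fps_nth Q 0) ^ Suc 1 = fps_nth Q 0"
      using power2_csqrt[of "fps_nth Q 0"] by (simp only: numeral_2_eq_2 One_nat_def)
    then have "w ^ Suc 1 = Q"
      using power_radical[of Q "\<lambda>_. csqrt" 1] a
      by (simp only: w_def Q0 numeral_2_eq_2 One_nat_def) simp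
    then have "fps_to_fls w * fps_to_fls w = poly_expansion a q"
      by (simp add: poly_expansion_def Q_def flip: fls_times_fps_to_fls)
    then have y2: "fps_to_fls w * fps_to_fls w = \<iota> (to_fract q)"
      by (simp add: l)
    have "poly_expansion a q \<noteq> 0"
      by (rule poly_expansion_hom(4)[OF \<open>q \<noteq> 0\<close>])
    then have y0: "fps_to_fls w \<noteq> 0"
      using y2 by (auto simp: l)
    have "2 * (fps_to_fls w * fls_deriv (fps_to_fls w)) = fls_deriv (fps_to_fls w * fps_to_fls w)"
      by (simp add: mult.commute)
    also have "\<dots> = poly_expansion a (pderiv q)"
      by (simp add: y2 l poly_expansion_deriv)
    also have "pderiv q = [:2:] * smult (1/2) (pderiv q)"
      by simp
    also have "poly_expansion a \<dots> = 2 * \<iota> (to_fract (smult (1/2) (pderiv q)))"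
      unfolding poly_expansion_hom poly_expansion_const by (simp add: l)
    finally have "fps_to_fls w * fls_deriv (fps_to_fls w) = \<iota> (to_fract (smult (1/2) (pderiv q)))"
      by simp
    then have "fls_deriv (fps_to_fls w) = \<iota> (to_fract (smult (1/2) (pderiv q))) / fps_to_fls w"
      using y0 by (simp add: nonzero_eq_divide_eq mult.commute)
    then have "fps_to_fls w \<in> S"
      using y0 y2 by (simp add: S_def foliation_solution_def sq)
    then show ?thesis by blast
  qed
  ultimately have "foliation_extension b c (- 4) h \<iota> fls_deriv L"
    unfolding foliation_extension_def differential_embedding_def picard_vessiot_by_def leaf
    using hom D KS dL dK differential_field_fract by (auto simp: L_def)
  then show ?thesis by blast
qed

section \<open>Local solutions of the differential equations\<close>

text \<open>Uniqueness for \<open>x' = y\<close>, \<open>y' = p(x)\<close>, for real or complex time: the map \<open>\<phi>\<close> is the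
  embedding of the times into the complex numbers. On a small ball, the difference of two solutions
  is bounded by half of any bound on it.\<close>

lemma second_order_unique_local:
  fixes \<phi> :: "'a :: real_normed_vector \<Rightarrow> complex"
  assumes \<phi>: "\<And>h. norm (\<phi> h) \<le> norm h"
    and p: "p holomorphic_on UNIV"
    and T: "open T" "t0 \<in> T"
    and x: "\<And>t. t \<in> T \<Longrightarrow> (x has_derivative (\<lambda>h. \<phi> h * y t)) (at t)"
    and y: "\<And>t. t \<in> T \<Longrightarrow> (y has_derivative (\<lambda>h. \<phi> h * p (x t))) (at t)"
    and u: "\<And>t. t \<in> T \<Longrightarrow> (u has_derivative (\<lambda>h. \<phi> h * v t)) (at t)"
    and v: "\<And>t. t \<in> T \<Longrightarrow> (v has_derivative (\<lambda>h. \<phi> h * p (u t))) (at t)"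
    and init: "x t0 = u t0" "y t0 = v t0"
  shows "\<exists>e>0. ball t0 e \<subseteq> T \<and> (\<forall>t\<in>ball t0 e. x t = u t \<and> y t = v t)"
proof -
  have near: "eventually (\<lambda>t. norm (f t - f t0) < 1) (nhds t0)"
    if "(f has_derivative f') (at t0)" for f :: "'a \<Rightarrow> complex" and f'
  proof -
    have "isCont f t0"
      using that by (rule has_derivative_continuous)
    then have "(f \<longlongrightarrow> f t0) (nhds t0)"
      by (simp add: isCont_def tendsto_nhds_iff)
    then show ?thesis
      using tendstoD[of f "f t0" "nhds t0" 1] by (simp add: dist_norm)
  qed
  have "eventually (\<lambda>t. t \<in> T \<and> norm (x t - x t0) < 1 \<and> norm (y t - y t0) < 1 \<and>
      norm (u t - u t0) < 1 \<and> norm (v t - v t0) < 1) (nhds t0)"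
    using T near[OF x] near[OF y] near[OF u] near[OF v]
    by (intro eventually_conj eventually_nhds_in_open) auto
  then obtain d where d: "d > 0" and dT: "\<And>t. dist t t0 < d \<Longrightarrow> t \<in> T \<and> norm (x t - x t0) < 1 \<and>
      norm (y t - y t0) < 1 \<and> norm (u t - u t0) < 1 \<and> norm (v t - v t0) < 1"
    unfolding eventually_nhds_metric by blast
  define B where "B = cball (x t0) 1"
  have "continuous_on B (deriv p)"
    by (intro holomorphic_on_imp_continuous_on holomorphic_deriv holomorphic_on_subset[OF p]
        holomorphic_on_subset[OF holomorphic_deriv[OF p]]) auto
  then have "bounded (deriv p ` B)"
    by (intro compact_imp_bounded compact_continuous_image) (auto simp: B_def)
  then obtain K0 where K0: "\<And>z. z \<in> B \<Longrightarrow> norm (deriv p z) \<le> K0"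
    unfolding bounded_iff by blast
  \<comment> \<open>The lower bound 1 is the Lipschitz constant of \<open>x' = y\<close>, so that
    one number serves both equations.\<close>
  define K where "K = max K0 1"
  have K: "\<And>z. z \<in> B \<Longrightarrow> norm (deriv p z) \<le> K" "K \<ge> 1"
    using K0 by (auto simp: K_def intro: order_trans[OF _ max.cobounded1])
  have lip: "norm (p a - p b) \<le> K * norm (a - b)" if "a \<in> B" "b \<in> B" for a b
  proof (rule field_differentiable_bound[where S = B and f' = "deriv p"])
    show "(p has_field_derivative deriv p z) (at z within B)" for z
      using p by (rule_tac has_field_derivative_at_within[OF holomorphic_derivI[of _ UNIV]]) auto
  qed (use K that in \<open>auto simp: B_def\<close>)
  \<comment> \<open>With \<open>4 * K * e \<le> 1\<close>, integration over the ball bounds each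
    component of the difference by a quarter of the previous bound, and their sum by a half.\<close>
  define e where "e = min d (1 / (4 * K))"
  have e: "e > 0" "e \<le> d" "4 * K * e \<le> 1"
    using d K by (auto simp: e_def min_def field_simps)
  have inB: "x t \<in> B" "u t \<in> B" if "t \<in> ball t0 e" for t
  proof -
    have "dist t t0 < d" using that e by (simp add: dist_commute)
    from dT[OF this] show "x t \<in> B" "u t \<in> B"
      using init by (auto simp: B_def dist_norm norm_minus_commute)
  qed
  \<comment> \<open>The initial bound 4 comes from four functions, each moving by less than
    1.\<close>
  have bound: "norm (x t - u t) + norm (y t - v t) \<le> 4 / 2 ^ n" if "t \<in> ball t0 e" for t n
    using that
  proof (induction n arbitrary: t)
    case 0
    have "dist t t0 < d" using 0 e by (simp add: dist_commute)
    from dT[OF this] have "norm (x t - x t0) < 1" "norm (u t - u t0) < 1" "norm (y t - y t0) < 1"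
      "norm (v t - v t0) < 1" by auto
    moreover have "norm (x t - u t) \<le> norm (x t - x t0) + norm (u t - u t0)"
      using norm_triangle_ineq4[of "x t - x t0" "u t - u t0"] init by simp
    moreover have "norm (y t - v t) \<le> norm (y t - y t0) + norm (v t - v t0)"
      using norm_triangle_ineq4[of "y t - y t0" "v t - v t0"] init by simp
    ultimately show ?case by simp
  next
    case (Suc n)
    define C :: real where "C = 4 / 2 ^ n"
    have C: "C > 0" by (simp add: C_def)
    have sub: "s \<in> T" if "s \<in> ball t0 e" for s
      using that dT[of s] e by (auto simp: dist_commute)
    have on: "onorm (\<lambda>h. \<phi> h * c) \<le> norm c" for c
      by (rule onorm_bound) (simp_all add: norm_mult mult.commute[of "norm (\<phi> _)"] mult_left_mono \<phi>)
    have tt: "norm (t - t0) \<le> e"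
      using Suc.prems by (simp add: dist_norm norm_minus_commute)
    have "norm ((x t - u t) - (x t0 - u t0)) \<le> C * norm (t - t0)"
    proof (rule differentiable_bound[where S = "ball t0 e"])
      fix s assume s: "s \<in> ball t0 e"
      show "((\<lambda>t. x t - u t) has_derivative (\<lambda>h. \<phi> h * (y s - v s))) (at s within ball t0 e)"
        using has_derivative_diff[OF x[OF sub[OF s]] u[OF sub[OF s]]]
        by (rule_tac has_derivative_at_withinI) (simp add: right_diff_distrib)
      show "onorm (\<lambda>h. \<phi> h * (y s - v s)) \<le> C"
        using on[of "y s - v s"] Suc.IH[OF s] norm_ge_zero[of "x s - u s"] unfolding C_def by linarith
    qed (use Suc.prems e in auto)
    also have "\<dots> \<le> C * e"
      using tt C by simp
    finally have 1: "norm (x t - u t) \<le> C * e"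
      using init by simp
    have "norm ((y t - v t) - (y t0 - v t0)) \<le> (K * C) * norm (t - t0)"
    proof (rule differentiable_bound[where S = "ball t0 e"])
      fix s assume s: "s \<in> ball t0 e"
      show "((\<lambda>t. y t - v t) has_derivative (\<lambda>h. \<phi> h * (p (x s) - p (u s)))) (at s within ball t0 e)"
        using has_derivative_diff[OF y[OF sub[OF s]] v[OF sub[OF s]]]
        by (rule_tac has_derivative_at_withinI) (simp add: right_diff_distrib)
      have "norm (p (x s) - p (u s)) \<le> K * norm (x s - u s)"
        by (rule lip[OF inB[OF s]])
      also have "\<dots> \<le> K * C"
        using Suc.IH[OF s] norm_ge_zero[of "y s - v s"] K unfolding C_def
        by (intro mult_left_mono) linarith+
      finally show "onorm (\<lambda>h. \<phi> h * (p (x s) - p (u s))) \<le> K * C"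
        using on[of "p (x s) - p (u s)"] by linarith
    qed (use Suc.prems e in auto)
    also have "\<dots> \<le> (K * C) * e"
      using tt C K by (intro mult_left_mono) auto
    finally have 2: "norm (y t - v t) \<le> K * C * e"
      using init by simp
    have "C * e \<le> K * C * e"
      using C K e by simp
    moreover have "4 * (K * C * e) \<le> C"
      using mult_left_mono[OF e(3), of C] C by (simp add: ac_simps)
    moreover have "4 / 2 ^ Suc n = C / 2"
      by (simp add: C_def)
    ultimately show ?case using 1 2 by linarith
  qed
  have le0: "norm (x t - u t) + norm (y t - v t) \<le> 0" if "t \<in> ball t0 e" for t
  proof (rule LIMSEQ_le_const)
    show "(\<lambda>n. 4 / 2 ^ n :: real) \<longlonglongrightarrow> 0"
      by (rule LIMSEQ_divide_realpow_zero) simp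
    show "\<exists>N. \<forall>n\<ge>N. norm (x t - u t) + norm (y t - v t) \<le> 4 / 2 ^ n"
      using bound[OF that] by blast
  qed
  have "x t = u t \<and> y t = v t" if t: "t \<in> ball t0 e" for t
  proof -
    have "norm (x t - u t) = 0" "norm (y t - v t) = 0"
      using le0[OF t] norm_ge_zero[of "x t - u t"] norm_ge_zero[of "y t - v t"] by linarith+
    then show ?thesis by simp
  qed
  moreover have "ball t0 e \<subseteq> T"
    using dT e by (auto simp: dist_commute)
  ultimately show ?thesis
    using e by blast
qed

text \<open>Separation of variables: the solution is the inverse of a primitive of \<open>1 / sqrt p\<close>.\<close>

lemma first_order_solution_exists:
  assumes p: "p holomorphic_on UNIV" "p 0 \<noteq> 0"
  obtains w r where "r > 0" "w holomorphic_on ball 0 r" "w 0 = 0" "deriv w 0 \<noteq> 0"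
    "\<And>z. z \<in> ball 0 r \<Longrightarrow> (deriv w z)\<^sup>2 = p (w z)"
proof -
  have "isCont p 0"
    using holomorphic_on_imp_continuous_on[OF p(1)] by (simp add: continuous_on_eq_continuous_at)
  then obtain s where s: "s > 0" "\<And>z. dist 0 z < s \<Longrightarrow> p z \<noteq> 0"
    using continuous_at_avoid[of 0 p 0] p(2) by auto
  \<comment> \<open>On a disc without zeros of \<open>p\<close> a holomorphic square root exists;
    its choice singles out one branch of the equation.\<close>
  obtain g where g: "g holomorphic_on ball 0 s" "\<And>z. z \<in> ball 0 s \<Longrightarrow> p z = g z ^ 2"
    using contractible_imp_holomorphic_sqrt[of p "ball 0 s"] s holomorphic_on_subset[OF p(1)]
      convex_imp_contractible[of "ball (0::complex) s"] by (auto simp: subset_iff)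
  have gnz: "g z \<noteq> 0" if "z \<in> ball 0 s" for z
    using g(2)[OF that] s(2)[of z] that by auto
  have "(\<lambda>z. inverse (g z)) holomorphic_on ball 0 s"
    using g gnz by (intro holomorphic_intros) auto
  then obtain H0 where H0: "\<And>z. z \<in> ball 0 s \<Longrightarrow> (H0 has_field_derivative inverse (g z)) (at z within ball 0 s)"
    using holomorphic_convex_primitive'[of "ball 0 s"] by auto
  \<comment> \<open>The primitive is normalised at 0, so that its local inverse \<open>w\<close>
    vanishes there too.\<close>
  define H where "H z = H0 z - H0 0" for z
  have H: "(H has_field_derivative inverse (g z)) (at z)" if "z \<in> ball 0 s" for z
    using H0[OF that] that unfolding H_def
    by (auto simp: at_within_open[of _ "ball 0 s"] intro!: derivative_eq_intros)
  have Hhol: "H holomorphic_on ball 0 s"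
    unfolding holomorphic_on_open[OF open_ball] using H by blast
  have H'0: "deriv H 0 \<noteq> 0"
    using DERIV_imp_deriv[OF H[of 0]] gnz[of 0] s by simp
  have s0: "0 \<in> ball (0::complex) s" using s by simp
  obtain r1 where r1: "r1 > 0" "ball (0::complex) r1 \<subseteq> ball 0 s" "inj_on H (ball 0 r1)"
    by (rule has_complex_derivative_locally_injective[OF Hhol s0 open_ball H'0]) (rule that)
  have H1: "H holomorphic_on ball 0 r1"
    using Hhol r1 holomorphic_on_subset by blast
  obtain w where w: "w holomorphic_on (H ` ball 0 r1)"
    "\<And>z. z \<in> ball 0 r1 \<Longrightarrow> deriv H z * deriv w (H z) = 1" "\<And>z. z \<in> ball 0 r1 \<Longrightarrow> w (H z) = z"
    by (rule holomorphic_has_inverse[OF H1 open_ball r1(3)]) (rule that)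
  have "open (H ` ball 0 r1)"
    by (rule open_mapping_thm3[OF H1 _ r1(3)]) auto
  moreover have "0 \<in> H ` ball 0 r1"
    using r1(1) by (auto simp: H_def image_iff intro!: bexI[of _ 0])
  ultimately obtain r where r: "r > 0" "ball 0 r \<subseteq> H ` ball 0 r1"
    using open_contains_ball by blast
  show thesis
  proof (rule that[OF r(1)])
    show "w holomorphic_on ball 0 r"
      using w(1) r(2) holomorphic_on_subset by blast
    \<comment> \<open>The inverse has derivative \<open>1 / deriv H z\<close>, which is
      \<open>g z\<close>; squaring gives the equation at \<open>H z\<close>.\<close>
    have *: "deriv w (H z) = g z" "w (H z) = z" if "z \<in> ball 0 r1" for z
    proof -
      have z: "z \<in> ball 0 s" using that r1 by blast
      have "inverse (g z) * deriv w (H z) = 1"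
        using w(2)[OF that] DERIV_imp_deriv[OF H[OF z]] by simp
      then show "deriv w (H z) = g z"
        using gnz[OF z] by (simp add: field_simps)
      show "w (H z) = z" by (rule w(3)[OF that])
    qed
    from *[of 0] r1(1) gnz[of 0] s(1) show "w 0 = 0" "deriv w 0 \<noteq> 0"
      by (auto simp: H_def)
    fix z :: complex assume "z \<in> ball 0 r"
    then obtain z' where z': "z' \<in> ball 0 r1" "z = H z'"
      using r(2) by blast
    have "z' \<in> ball 0 s" using z' r1 by blast
    then show "(deriv w z)\<^sup>2 = p (w z)"
      using *[OF z'(1)] g(2) z'(2) by simp
  qed
qed

text \<open>Differentiation gives \<open>f' * (f'' - Q' (f) / 2) = 0\<close>, and the factor
  \<open>f'\<close> may vanish at the point in question. As \<open>f\<close> is not constant,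
  \<open>f'\<close> is nonzero on a nonempty open set, from which the identity continues to
  \<open>S\<close>.\<close>

lemma second_order_of_first_order:
  assumes S: "open S" "connected S" and f: "f holomorphic_on S" "\<not> f constant_on S"
    and Q: "\<And>z. (Q has_field_derivative Q' z) (at z)" "Q' holomorphic_on UNIV"
    and ode: "\<And>z. z \<in> S \<Longrightarrow> (deriv f z)\<^sup>2 = Q (f z)" and z: "z \<in> S"
  shows "deriv (deriv f) z = Q' (f z) / 2"
proof -
  have f': "deriv f holomorphic_on S" and f'': "deriv (deriv f) holomorphic_on S"
    using f S by (auto intro: holomorphic_deriv)
  have df: "(f has_field_derivative deriv f z) (at z)" and ddf: "(deriv f has_field_derivative deriv (deriv f) z) (at z)"
    if "z \<in> S" for z
    using f(1) f' S that by (auto intro: holomorphic_derivI)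
  have eq: "deriv f z * (deriv (deriv f) z - Q' (f z) / 2) = 0" if "z \<in> S" for z
  proof -
    have 1: "((\<lambda>z. (deriv f z)\<^sup>2) has_field_derivative 2 * deriv f z * deriv (deriv f) z) (at z)"
      using ddf[OF that] by (auto intro!: derivative_eq_intros)
    have "((\<lambda>z. Q (f z)) has_field_derivative Q' (f z) * deriv f z) (at z)"
      using DERIV_chain2[OF Q(1) df[OF that]] .
    moreover have "eventually (\<lambda>z. z \<in> S) (nhds z)"
      using S that by (intro eventually_nhds_in_open)
    then have "eventually (\<lambda>z. Q (f z) = (deriv f z)\<^sup>2) (nhds z)"
      by eventually_elim (simp add: ode)
    ultimately have "((\<lambda>z. (deriv f z)\<^sup>2) has_field_derivative Q' (f z) * deriv f z) (at z)"
      by (simp add: DERIV_cong_ev)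
    from DERIV_unique[OF 1 this] show ?thesis
      by (simp add: algebra_simps)
  qed
  obtain z0 where z0: "z0 \<in> S" "deriv f z0 \<noteq> 0"
  proof -
    have "\<exists>z0\<in>S. deriv f z0 \<noteq> 0"
    proof (rule ccontr)
      assume "\<not> ?thesis"
      then have "\<forall>z\<in>S - {}. DERIV f z :> 0"
        using df by (metis DiffD1)
      then have "f constant_on S"
        using DERIV_zero_connected_constant_on[OF S(2,1) finite.emptyI] f
        by (simp add: holomorphic_on_imp_continuous_on)
      with f(2) show False by simp
    qed
    then show thesis using that by blast
  qed
  have "continuous_on S (deriv f)"
    using f' by (rule holomorphic_on_imp_continuous_on)
  then have "open (S \<inter> deriv f -` (- {0}))"
    using S by (intro continuous_open_preimage) auto
  moreover have "S \<inter> deriv f -` (- {0}) \<noteq> {}"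
    using z0 by auto
  moreover have "(Q' \<circ> f) holomorphic_on S"
    by (rule holomorphic_on_compose_gen[OF f(1) Q(2)]) simp
  then have "(\<lambda>z. Q' (f z) / 2) holomorphic_on S"
    unfolding o_def by (intro holomorphic_on_divide holomorphic_on_const) simp_all
  moreover have "deriv (deriv f) w = Q' (f w) / 2" if "w \<in> S \<inter> deriv f -` (- {0})" for w
    using eq[of w] that by simp
  ultimately show ?thesis
    using analytic_continuation_open[of "S \<inter> deriv f -` (- {0})" S "deriv (deriv f)" "\<lambda>z. Q' (f z) / 2" z]
      f'' z S by blast
qed

section \<open>Solutions through a regular point and at the pole\<close>

definition wcubic :: "complex \<Rightarrow> complex \<Rightarrow> complex \<Rightarrow> complex" where
  "wcubic g2 g3 x = 4 * x ^ 3 - g2 * x - g3"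

text \<open>At a branch point, \<open>x = x0 + w^2\<close> turns \<open>x'^2 = 4 w^2 p(w)\<close>
  into \<open>w'^2 = p(w)\<close>, which is regular as \<open>p 0 \<noteq> 0\<close>. Simple roots
  of the cubic and the pole, in the coordinate \<open>1 / \<wp>\<close>, are both of this
  kind.\<close>

lemma square_solution:
  assumes p: "p holomorphic_on UNIV" "p 0 \<noteq> 0"
  obtains X r where "r > 0" "X holomorphic_on ball 0 r" "X 0 = (x0 :: complex)" "\<not> X constant_on ball 0 r"
    "\<And>z. z \<in> ball 0 r \<Longrightarrow> \<exists>w. X z = x0 + w\<^sup>2 \<and> (deriv X z)\<^sup>2 = 4 * w\<^sup>2 * p w"
proof -
  obtain w r where w: "r > 0" "w holomorphic_on ball 0 r" "w 0 = 0" "deriv w 0 \<noteq> 0"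
    "\<And>z. z \<in> ball 0 r \<Longrightarrow> (deriv w z)\<^sup>2 = p (w z)"
    using first_order_solution_exists[OF p] by metis
  have dw: "(w has_field_derivative deriv w z) (at z)" if "z \<in> ball 0 r" for z
    using w(2) that by (auto intro: holomorphic_derivI)
  show thesis
  proof (rule that[OF w(1), of "\<lambda>z. x0 + (w z)\<^sup>2"])
    show "(\<lambda>z. x0 + (w z)\<^sup>2) holomorphic_on ball 0 r"
      using w(2) by (intro holomorphic_intros)
    show "x0 + (w 0)\<^sup>2 = x0"
      by (simp add: w)
    show "\<not> (\<lambda>z. x0 + (w z)\<^sup>2) constant_on ball 0 r"
    proof
      assume "(\<lambda>z. x0 + (w z)\<^sup>2) constant_on ball 0 r"
      then obtain k where "\<And>z. z \<in> ball 0 r \<Longrightarrow> x0 + (w z)\<^sup>2 = k"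
        by (auto simp: constant_on_def)
      from this[of 0] this have 0: "w z = 0" if "z \<in> ball 0 r" for z
        using that w(1,3) by auto
      have "eventually (\<lambda>z. z \<in> ball 0 r) (nhds (0 :: complex))"
        using w(1) by (intro eventually_nhds_in_open) auto
      then have "eventually (\<lambda>z. w z = 0) (nhds 0)"
        by eventually_elim (rule 0)
      then have "deriv w 0 = deriv (\<lambda>_. 0) 0"
        by (rule deriv_cong_ev) simp
      with w(4) show False by simp
    qed
    fix z :: complex assume z: "z \<in> ball 0 r"
    have "((\<lambda>z. x0 + (w z)\<^sup>2) has_field_derivative 2 * w z * deriv w z) (at z)"
      using dw[OF z] by (auto intro!: derivative_eq_intros)
    then have "(deriv (\<lambda>z. x0 + (w z)\<^sup>2) z)\<^sup>2 = 4 * (w z)\<^sup>2 * p (w z)"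
      by (simp add: DERIV_imp_deriv power_mult_distrib w(5)[OF z])
    then show "\<exists>v. x0 + (w z)\<^sup>2 = x0 + v\<^sup>2 \<and> (deriv (\<lambda>z. x0 + (w z)\<^sup>2) z)\<^sup>2 = 4 * v\<^sup>2 * p v"
      by blast
  qed
qed

text \<open>The hypothesis excludes the double roots, which are the equilibria of the second-order
  equation.\<close>

lemma local_solution_regular_point:
  assumes "wcubic g2 g3 x0 \<noteq> 0 \<or> 12 * x0\<^sup>2 - g2 \<noteq> 0"
  obtains X r where "r > 0" "X holomorphic_on ball 0 r" "X 0 = x0" "\<not> X constant_on ball 0 r"
    "\<And>z. z \<in> ball 0 r \<Longrightarrow> (deriv X z)\<^sup>2 = wcubic g2 g3 (X z)"
proof (cases "wcubic g2 g3 x0 = 0")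
  case True
  \<comment> \<open>The increment of the cubic from \<open>x0\<close> to \<open>x0 + w^2\<close>,
    divided by \<open>4 w^2\<close>; its value at 0 is a quarter of the derivative of the
    cubic.\<close>
  define p where "p w = (12 * x0\<^sup>2 - g2 + 12 * x0 * w\<^sup>2 + 4 * w ^ 4) / 4" for w
  have "p holomorphic_on UNIV" "p 0 \<noteq> 0"
    using assms True unfolding p_def by (auto intro!: holomorphic_intros)
  then obtain X r where X: "r > 0" "X holomorphic_on ball 0 r" "X 0 = x0" "\<not> X constant_on ball 0 r"
    "\<And>z. z \<in> ball 0 r \<Longrightarrow> \<exists>w. X z = x0 + w\<^sup>2 \<and> (deriv X z)\<^sup>2 = 4 * w\<^sup>2 * p w"
    using square_solution[where ?x0.0 = x0] by metis
  have "4 * w\<^sup>2 * p w = wcubic g2 g3 (x0 + w\<^sup>2) - wcubic g2 g3 x0" for w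
    by (simp add: p_def wcubic_def power2_eq_square power3_eq_cube power4_eq_xxxx field_simps)
  then show thesis
    using that[OF X(1-4)] X(5) True by force
next
  case False
  have "(\<lambda>w. wcubic g2 g3 (x0 + w)) holomorphic_on UNIV"
    unfolding wcubic_def by (intro holomorphic_intros)
  then obtain w r where w: "r > 0" "w holomorphic_on ball 0 r" "w 0 = 0" "deriv w 0 \<noteq> 0"
    "\<And>z. z \<in> ball 0 r \<Longrightarrow> (deriv w z)\<^sup>2 = wcubic g2 g3 (x0 + w z)"
    using first_order_solution_exists[of "\<lambda>w. wcubic g2 g3 (x0 + w)"] False by (metis add_0_right)
  have dw: "((\<lambda>z. x0 + w z) has_field_derivative deriv w z) (at z)" if "z \<in> ball 0 r" for z
    using holomorphic_derivI[OF w(2) _ that] by (auto intro!: derivative_eq_intros)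
  show thesis
  proof (rule that[OF w(1), of "\<lambda>z. x0 + w z"])
    show "(\<lambda>z. x0 + w z) holomorphic_on ball 0 r"
      using w(2) by (intro holomorphic_intros)
    show "\<not> (\<lambda>z. x0 + w z) constant_on ball 0 r"
    proof
      assume "(\<lambda>z. x0 + w z) constant_on ball 0 r"
      then obtain k where k: "\<And>z. z \<in> ball 0 r \<Longrightarrow> x0 + w z = k"
        by (auto simp: constant_on_def)
      have "eventually (\<lambda>z. z \<in> ball 0 r) (nhds (0 :: complex))"
        using w(1) by (intro eventually_nhds_in_open) auto
      then have "eventually (\<lambda>z. x0 + w z = k) (nhds 0)"
        by eventually_elim (rule k)
      then have "deriv (\<lambda>z. x0 + w z) 0 = deriv (\<lambda>_. k) 0"
        by (rule deriv_cong_ev) simp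
      with w(1,4) dw[of 0] show False by (simp add: DERIV_imp_deriv)
    qed
  qed (use w in \<open>simp_all add: DERIV_imp_deriv[OF dw]\<close>)
qed

text \<open>The germ of \<open>1 / \<wp>\<close> at the pole.\<close>

lemma local_solution_pole:
  obtains f r where "r > 0" "f holomorphic_on ball 0 r" "f 0 = 0" "\<not> f constant_on ball 0 r"
    "\<And>z. z \<in> ball 0 r \<Longrightarrow> (deriv f z)\<^sup>2 = 4 * f z - g2 * f z ^ 3 - g3 * f z ^ 4"
proof -
  \<comment> \<open>\<open>4 f - g2 f^3 - g3 f^4\<close> at \<open>f = w^2\<close>, divided by
    \<open>4 w^2\<close>.\<close>
  define p where "p w = (4 - g2 * w ^ 4 - g3 * w ^ 6) / 4" for w :: complex
  have "p holomorphic_on UNIV" "p 0 \<noteq> 0"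
    unfolding p_def by (auto intro!: holomorphic_intros)
  then obtain X r where X: "r > 0" "X holomorphic_on ball 0 r" "X 0 = 0" "\<not> X constant_on ball 0 r"
    "\<And>z. z \<in> ball 0 r \<Longrightarrow> \<exists>w. X z = 0 + w\<^sup>2 \<and> (deriv X z)\<^sup>2 = 4 * w\<^sup>2 * p w"
    using square_solution[where ?x0.0 = 0] by metis
  have e: "4 * w\<^sup>2 * p w = 4 * (0 + w\<^sup>2) - g2 * (0 + w\<^sup>2) ^ 3 - g3 * (0 + w\<^sup>2) ^ 4" for w
    by (simp add: p_def field_simps flip: power_mult power_add)
  have "(deriv X z)\<^sup>2 = 4 * X z - g2 * X z ^ 3 - g3 * X z ^ 4" if "z \<in> ball 0 r" for z
    using X(5)[OF that] e by metis
  then show thesis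
    by (rule that[OF X(1-4)])
qed

lemma second_order_at_pole:
  assumes "open S" "connected S" "f holomorphic_on S" "\<not> f constant_on S"
    and "\<And>z. z \<in> S \<Longrightarrow> (deriv f z)\<^sup>2 = 4 * f z - g2 * f z ^ 3 - g3 * f z ^ 4" and "z \<in> S"
  shows "deriv (deriv f) z = 2 - 3 / 2 * g2 * f z ^ 2 - 2 * g3 * f z ^ 3"
proof -
  have "deriv (deriv f) z = (4 - 3 * g2 * f z ^ 2 - 4 * g3 * f z ^ 3) / 2"
  proof (rule second_order_of_first_order[OF assms(1-4) _ _ assms(5,6)])
    show "((\<lambda>x. 4 * x - g2 * x ^ 3 - g3 * x ^ 4) has_field_derivative (4 - 3 * g2 * x ^ 2 - 4 * g3 * x ^ 3)) (at x)" for x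
      by (auto intro!: derivative_eq_intros)
    show "(\<lambda>x. 4 - 3 * g2 * x ^ 2 - 4 * g3 * x ^ 3) holomorphic_on UNIV"
      by (intro holomorphic_intros)
  qed
  then show ?thesis by (simp add: field_simps)
qed

lemma second_order_regular:
  assumes "open S" "connected S" "f holomorphic_on S" "\<not> f constant_on S"
    and "\<And>z. z \<in> S \<Longrightarrow> (deriv f z)\<^sup>2 = wcubic g2 g3 (f z)" and "z \<in> S"
  shows "deriv (deriv f) z = 6 * f z ^ 2 - g2 / 2"
proof -
  have "deriv (deriv f) z = (12 * f z ^ 2 - g2) / 2"
  proof (rule second_order_of_first_order[OF assms(1-4) _ _ assms(5,6)])
    show "(wcubic g2 g3 has_field_derivative (12 * x ^ 2 - g2)) (at x)" for x
      unfolding wcubic_def by (auto intro!: derivative_eq_intros)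
    show "(\<lambda>x. 12 * x ^ 2 - g2) holomorphic_on UNIV"
      by (intro holomorphic_intros)
  qed
  then show ?thesis by (simp add: field_simps)
qed

section \<open>Uniqueness of germs and of meromorphic functions\<close>

lemma holomorphic_has_derivative_mult:
  assumes "f holomorphic_on S" "open S" "z \<in> S"
  shows "(f has_derivative (\<lambda>h. h * deriv f z)) (at z)"
  using holomorphic_derivI[OF assms] unfolding has_field_derivative_def
  by (simp add: mult.commute[of _ "deriv f z"])

lemma second_order_unique_holomorphic:
  assumes p: "p holomorphic_on UNIV" and S: "open S" "z0 \<in> S"
    and f: "f holomorphic_on S" "\<And>z. z \<in> S \<Longrightarrow> deriv (deriv f) z = p (f z)"
    and g: "g holomorphic_on S" "\<And>z. z \<in> S \<Longrightarrow> deriv (deriv g) z = p (g z)"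
    and init: "f z0 = g z0" "deriv f z0 = deriv g z0"
  shows "eventually (\<lambda>z. f z = g z) (nhds z0)"
proof -
  have d: "(f has_derivative (\<lambda>h. h * deriv f z)) (at z)" "(g has_derivative (\<lambda>h. h * deriv g z)) (at z)"
    "(deriv f has_derivative (\<lambda>h. h * p (f z))) (at z)" "(deriv g has_derivative (\<lambda>h. h * p (g z))) (at z)"
    if "z \<in> S" for z
    using holomorphic_has_derivative_mult[OF f(1) S(1) that] holomorphic_has_derivative_mult[OF g(1) S(1) that]
      holomorphic_has_derivative_mult[OF holomorphic_deriv[OF f(1) S(1)] S(1) that]
      holomorphic_has_derivative_mult[OF holomorphic_deriv[OF g(1) S(1)] S(1) that]
      f(2)[OF that] g(2)[OF that] by simp_all
  obtain e where "e > 0" "\<And>z. z \<in> ball z0 e \<Longrightarrow> f z = g z"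
    using second_order_unique_local[of "\<lambda>h. h", OF _ p S d(1) d(3) d(2) d(4) init] by auto
  then show ?thesis
    unfolding eventually_nhds_metric by (metis dist_commute mem_ball)
qed

text \<open>The value 0 forces the derivative 0, so both germs have the same initial values for the
  second-order equation. Constants must be excluded, since 0 also solves the first-order
  one.\<close>

lemma pole_germ_unique:
  assumes "r > 0" "f holomorphic_on ball 0 r" "f 0 = 0" "\<not> f constant_on ball 0 r"
    "\<And>z. z \<in> ball 0 r \<Longrightarrow> (deriv f z)\<^sup>2 = 4 * f z - g2 * f z ^ 3 - g3 * f z ^ 4"
    and "g holomorphic_on ball 0 r" "g 0 = 0" "\<not> g constant_on ball 0 r"
    "\<And>z. z \<in> ball 0 r \<Longrightarrow> (deriv g z)\<^sup>2 = 4 * g z - g2 * g z ^ 3 - g3 * g z ^ 4"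
  shows "eventually (\<lambda>z. f z = g z) (nhds 0)"
proof (rule second_order_unique_holomorphic)
  show "(\<lambda>x. 2 - 3 / 2 * g2 * x ^ 2 - 2 * g3 * x ^ 3) holomorphic_on UNIV"
    by (intro holomorphic_intros)
  have "0 \<in> ball (0::complex) r" using assms(1) by simp
  then have "(deriv f 0)\<^sup>2 = 0" "(deriv g 0)\<^sup>2 = 0"
    using assms(3,5,7,9) by simp_all
  then show "deriv f 0 = deriv g 0" by simp
  show "f 0 = g 0" using assms by simp
  show "0 \<in> ball (0::complex) r" by fact
qed (use assms second_order_at_pole[of "ball 0 r"] in auto)

text \<open>The identity theorem is applied to the difference with its singularities removed.
  Equality extends to the poles because both functions take the default value 0 there.\<close>

lemma nicely_meromorphic_eqI:
  assumes f: "f nicely_meromorphic_on A" and g: "g nicely_meromorphic_on A"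
    and A: "open A" "connected A" "z0 \<in> A" and eq: "eventually (\<lambda>z. f z = g z) (at z0)"
  shows "\<And>z. z \<in> A \<Longrightarrow> f z = g z"
    and "\<And>z. z \<in> A \<Longrightarrow> is_pole f z \<longleftrightarrow> is_pole g z"
proof -
  define d where "d = remove_sings (\<lambda>z. f z - g z)"
  have mero: "(\<lambda>z. f z - g z) meromorphic_on A"
    using f g by (auto simp: nicely_meromorphic_on_def intro!: meromorphic_intros)
  have nd: "d nicely_meromorphic_on A"
    unfolding d_def by (rule remove_sings_nicely_meromorphic[OF mero])
  have d_eq: "eventually (\<lambda>w. d w = f w - g w) (at z)" if "z \<in> A" for z
    unfolding d_def using meromorphic_on_isolated_singularity[OF meromorphic_on_subset[OF mero, of "{z}"]] that
    by (intro eventually_remove_sings_eq_at) auto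
  have "eventually (\<lambda>w. d w = 0) (at z0)"
    using d_eq[OF A(3)] eq by eventually_elim simp
  then have "frequently (\<lambda>w. d w = 0) (at z0)"
    by (simp add: eventually_frequently)
  then have d0: "d z = 0" if "z \<in> A" for z
    using frequently_eq_meromorphic_imp_constant[OF _ nd A] that by blast
  have ev: "eventually (\<lambda>w. f w = g w) (at z)" if "z \<in> A" for z
  proof -
    have "eventually (\<lambda>w. w \<in> A) (at z)"
      using A that by (intro eventually_at_in_open') auto
    with d_eq[OF that] show ?thesis
      by eventually_elim (simp add: d0)
  qed
  show pole: "is_pole f z \<longleftrightarrow> is_pole g z" if "z \<in> A" for z
    by (rule is_pole_cong[OF ev[OF that] refl])
  show "f z = g z" if z: "z \<in> A" for z
  proof (cases "is_pole f z")
    case True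
    then show ?thesis
      using pole[OF z] is_pole_zero_at_nicely_mero[OF f _ z] is_pole_zero_at_nicely_mero[OF g _ z] by simp
  next
    case False
    then have "f \<midarrow>z\<rightarrow> f z" "g \<midarrow>z\<rightarrow> g z"
      using f g z pole[OF z] by (auto simp: nicely_meromorphic_on_def)
    moreover from this(1) have "g \<midarrow>z\<rightarrow> f z"
      using tendsto_cong[OF ev[OF z]] by blast
    ultimately show ?thesis
      using LIM_unique by blast
  qed
qed

lemma nicely_meromorphic_affine:
  assumes f: "f nicely_meromorphic_on UNIV" and s: "s \<noteq> 0"
  shows "(\<lambda>z. f (a + s * z)) nicely_meromorphic_on UNIV"
    and "is_pole (\<lambda>z. f (a + s * z)) z \<longleftrightarrow> is_pole f (a + s * z)"
proof -
  have lim: "filterlim (\<lambda>z. a + s * z) (at (a + s * z)) (at z)" for z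
  proof (rule filterlim_atI)
    show "((\<lambda>z. a + s * z) \<longlongrightarrow> a + s * z) (at z)"
      by (intro tendsto_intros)
    show "eventually (\<lambda>w. a + s * w \<noteq> a + s * z) (at z)"
      using s by (auto simp: eventually_at_filter)
  qed
  have pole: "is_pole (\<lambda>z. f (a + s * z)) z" if "is_pole f (a + s * z)" for z
    using that filterlim_compose[OF _ lim] unfolding is_pole_def by blast
  have nopole: "(\<lambda>z. f (a + s * z)) \<midarrow>z\<rightarrow> f (a + s * z)" if "\<not> is_pole f (a + s * z)" for z
    using f that tendsto_compose_filtermap[of f] filterlim_compose[OF _ lim, of f "nhds (f (a + s * z))" z]
    unfolding nicely_meromorphic_on_def by auto
  show "is_pole (\<lambda>z. f (a + s * z)) z \<longleftrightarrow> is_pole f (a + s * z)"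
    using pole nopole not_tendsto_and_filterlim_at_infinity[of "at z"] unfolding is_pole_def by auto
  have "(\<lambda>z. f (a + s * z)) meromorphic_on UNIV"
    by (rule meromorphic_on_compose[of f UNIV])
      (use f in \<open>auto simp: nicely_meromorphic_on_def intro!: analytic_intros\<close>)
  then show "(\<lambda>z. f (a + s * z)) nicely_meromorphic_on UNIV"
    using pole nopole is_pole_zero_at_nicely_mero[OF f] unfolding nicely_meromorphic_on_def by blast
qed

section \<open>The Weierstrass function\<close>

context
  fixes g2 g3 P
  assumes W: "is_weierstrass g2 g3 P"
begin

lemma weierstrass_nicely_meromorphic: "P nicely_meromorphic_on UNIV"
  and weierstrass_pole_0: "is_pole P 0"
  and weierstrass_ode: "\<not> is_pole P z \<Longrightarrow> (deriv P z)\<^sup>2 = wcubic g2 g3 (P z)"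
  using W by (auto simp: is_weierstrass_def wcubic_def)

lemma weierstrass_analytic: "\<not> is_pole P z \<Longrightarrow> P analytic_on {z}"
  by (rule nicely_meromorphic_on_imp_analytic_at[OF weierstrass_nicely_meromorphic]) auto

lemma weierstrass_holomorphic: "(\<And>z. z \<in> S \<Longrightarrow> \<not> is_pole P z) \<Longrightarrow> P holomorphic_on S"
  by (rule analytic_imp_holomorphic) (use weierstrass_analytic analytic_on_analytic_at in blast)

lemma weierstrass_open_nonpoles: "open {z. \<not> is_pole P z}"
proof -
  have "\<exists>e>0. ball z e \<subseteq> {z. \<not> is_pole P z}" if np: "\<not> is_pole P z" for z
  proof -
    obtain e where e: "e > 0" "P holomorphic_on ball z e"
      using weierstrass_analytic[OF np] by (auto simp: analytic_on_def)
    then have "\<not> is_pole P w" if "w \<in> ball z e" for w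
      using that not_is_pole_holomorphic[of "ball z e" w P] by auto
    with e show ?thesis by auto
  qed
  then show ?thesis
    by (auto simp: open_contains_ball)
qed

lemma weierstrass_derivative: "\<not> is_pole P z \<Longrightarrow> (P has_field_derivative deriv P z) (at z)"
  by (rule holomorphic_derivI[OF weierstrass_holomorphic weierstrass_open_nonpoles]) auto

text \<open>The identity theorem would carry constancy to the origin, where there is a pole.\<close>

lemma weierstrass_not_locally_constant: "\<not> eventually (\<lambda>z. P z = k) (at z0)"
proof
  assume "eventually (\<lambda>z. P z = k) (at z0)"
  then have "is_pole P 0 \<longleftrightarrow> is_pole (\<lambda>_. k) (0 :: complex)"
    by (intro nicely_meromorphic_eqI(2)[OF weierstrass_nicely_meromorphic nicely_meromorphic_on_const
          open_UNIV connected_UNIV UNIV_I]) auto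
  with weierstrass_pole_0 show False by simp
qed

lemma weierstrass_not_constant_on:
  assumes "open S" "S \<noteq> {}"
  shows "\<not> P constant_on S"
proof
  assume "P constant_on S"
  then obtain k where k: "\<And>z. z \<in> S \<Longrightarrow> P z = k"
    by (auto simp: constant_on_def)
  obtain z0 where "z0 \<in> S" using assms by blast
  with assms have "eventually (\<lambda>z. z \<in> S) (at z0)"
    by (intro eventually_at_in_open') auto
  then have "eventually (\<lambda>z. P z = k) (at z0)"
    by eventually_elim (rule k)
  with weierstrass_not_locally_constant show False by blast
qed

lemma weierstrass_second_derivative:
  assumes "\<not> is_pole P z"
  shows "(deriv P has_field_derivative 6 * P z ^ 2 - g2 / 2) (at z)"
proof -
  obtain e where e: "e > 0" "ball z e \<subseteq> {z. \<not> is_pole P z}"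
    using weierstrass_open_nonpoles assms by (auto simp: open_contains_ball)
  have hol: "P holomorphic_on ball z e"
    using e by (intro weierstrass_holomorphic) auto
  have "deriv (deriv P) z = 6 * P z ^ 2 - g2 / 2"
    by (rule second_order_regular[OF open_ball connected_ball hol weierstrass_not_constant_on])
      (use e weierstrass_ode in auto)
  moreover have "(deriv P has_field_derivative deriv (deriv P) z) (at z)"
    using holomorphic_derivI[OF holomorphic_deriv[OF hol]] e by auto
  ultimately show ?thesis by simp
qed

text \<open>At the pole \<open>P\<close> has the default value 0 and \<open>inverse 0 = 0\<close>,
  so the pointwise inverse is already the holomorphic extension.\<close>

lemma weierstrass_inverse_germ:
  obtains f r where "r > 0" "f holomorphic_on ball 0 r" "f 0 = 0" "\<not> f constant_on ball 0 r"
    "\<And>z. z \<in> ball 0 r \<Longrightarrow> (deriv f z)\<^sup>2 = 4 * f z - g2 * f z ^ 3 - g3 * f z ^ 4"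
    "\<And>z. f z = inverse (P z)"
proof -
  define f where "f z = inverse (P z)" for z
  have lim: "f \<midarrow>0\<rightarrow> 0"
    using is_pole_tendsto[OF weierstrass_pole_0] by (simp add: f_def[abs_def] o_def)
  have nf: "f nicely_meromorphic_on UNIV"
    unfolding f_def[abs_def] by (rule nicely_meromorphic_on_inverse[OF weierstrass_nicely_meromorphic])
  have "\<not> is_pole f 0"
    using lim not_tendsto_and_filterlim_at_infinity[of "at 0" f 0] by (auto simp: is_pole_def)
  then have "f analytic_on {0}"
    by (rule nicely_meromorphic_on_imp_analytic_at[OF nf UNIV_I])
  then obtain r0 where r0: "r0 > 0" "f holomorphic_on ball 0 r0"
    by (auto simp: analytic_on_def)
  have "isolated_singularity_at P 0"
    using weierstrass_nicely_meromorphic meromorphic_on_isolated_singularity[of P 0] meromorphic_on_subset[of P UNIV "{0}"]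
    by (auto simp: nicely_meromorphic_on_def)
  then obtain r1 where r1: "r1 > 0" "P analytic_on ball 0 r1 - {0}"
    by (auto simp: isolated_singularity_at_def)
  have "eventually (\<lambda>z. P z \<noteq> 0) (at 0)"
    using weierstrass_pole_0 by (rule non_zero_neighbour_pole)
  then obtain r2 where r2: "r2 > 0" "\<And>z. z \<noteq> 0 \<Longrightarrow> dist z 0 < r2 \<Longrightarrow> P z \<noteq> 0"
    by (auto simp: eventually_at)
  define r where "r = min r0 (min r1 r2)"
  have r: "r > 0" "r \<le> r0" "r \<le> r1" "r \<le> r2"
    using r0 r1 r2 by (auto simp: r_def)
  have hol: "f holomorphic_on ball 0 r"
    using r0(2) r(2) by (auto elim!: holomorphic_on_subset)
  have f0: "f 0 = 0"
    using is_pole_zero_at_nicely_mero[OF weierstrass_nicely_meromorphic weierstrass_pole_0] by (simp add: f_def)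
  \<comment> \<open>The defect of the equation vanishes off the origin, hence at the origin by
    continuity.\<close>
  define L where "L z = (deriv f z)\<^sup>2 - (4 * f z - g2 * f z ^ 3 - g3 * f z ^ 4)" for z
  have L: "L z = 0" if z: "z \<in> ball 0 r" "z \<noteq> 0" for z
  proof -
    have Pz: "P z \<noteq> 0"
      using r2(2)[of z] z r by simp
    have "P analytic_on {z}"
      using r1(2) by (rule analytic_on_subset) (use z r in auto)
    then have np: "\<not> is_pole P z"
      using analytic_at_imp_no_pole by blast
    have "(f has_field_derivative - (deriv P z / P z ^ 2)) (at z)"
      unfolding f_def[abs_def] using weierstrass_derivative[OF np] Pz
      by (auto intro!: derivative_eq_intros simp: field_simps power2_eq_square)
    then have "deriv f z = - (deriv P z / P z ^ 2)"
      by (rule DERIV_imp_deriv)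
    then have "(deriv f z)\<^sup>2 = wcubic g2 g3 (P z) / P z ^ 4"
      by (simp add: power_divide weierstrass_ode[OF np])
    also have "\<dots> = 4 * f z - g2 * f z ^ 3 - g3 * f z ^ 4"
      using Pz by (simp add: f_def wcubic_def field_simps power2_eq_square power3_eq_cube power4_eq_xxxx)
    finally show ?thesis by (simp add: L_def)
  qed
  have "L holomorphic_on ball 0 r"
    unfolding L_def[abs_def] using hol by (intro holomorphic_intros) auto
  then have "isCont L 0"
    using r by (intro analytic_at_imp_isCont) (auto simp: analytic_at intro!: exI[of _ "ball 0 r"])
  then have "L \<midarrow>0\<rightarrow> L 0"
    by (simp add: isCont_def)
  moreover have "eventually (\<lambda>z. L z = 0) (at 0)"
    using r L by (auto simp: eventually_at intro!: exI[of _ r])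
  then have "L \<midarrow>0\<rightarrow> 0"
    by (rule tendsto_eventually)
  ultimately have "L 0 = 0"
    by (rule LIM_unique)
  with L have ode: "(deriv f z)\<^sup>2 = 4 * f z - g2 * f z ^ 3 - g3 * f z ^ 4" if "z \<in> ball 0 r" for z
    using that unfolding L_def by (cases "z = 0") auto
  have nc: "\<not> f constant_on ball 0 r"
  proof
    assume "f constant_on ball 0 r"
    then have "f (of_real (r / 2)) = f 0"
      using r by (auto simp: constant_on_def)
    then show False
      using r2(2)[of "of_real (r / 2)"] r f0 by (simp add: f_def)
  qed
  show thesis
    by (rule that[OF r(1) hol f0 nc ode]) (simp_all add: f_def)
qed

end

text \<open>The reciprocals are germs of the kind treated in \<open>pole_germ_unique\<close>; they
  agree near 0, and the identity theorem does the rest.\<close>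

lemma weierstrass_unique:
  assumes P: "is_weierstrass g2 g3 P" and R: "is_weierstrass g2 g3 R"
  shows "P = R"
proof -
  obtain f r where f: "r > 0" "f holomorphic_on ball 0 r" "f 0 = 0" "\<not> f constant_on ball 0 r"
    "\<And>z. z \<in> ball 0 r \<Longrightarrow> (deriv f z)\<^sup>2 = 4 * f z - g2 * f z ^ 3 - g3 * f z ^ 4"
    "\<And>z. f z = inverse (P z)"
    using weierstrass_inverse_germ[OF P] by metis
  obtain g s where g: "s > 0" "g holomorphic_on ball 0 s" "g 0 = 0" "\<not> g constant_on ball 0 s"
    "\<And>z. z \<in> ball 0 s \<Longrightarrow> (deriv g z)\<^sup>2 = 4 * g z - g2 * g z ^ 3 - g3 * g z ^ 4"
    "\<And>z. g z = inverse (R z)"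
    using weierstrass_inverse_germ[OF R] by metis
  define t where "t = min r s"
  have t: "t > 0" "ball (0::complex) t \<subseteq> ball 0 r" "ball (0::complex) t \<subseteq> ball 0 s"
    using f(1) g(1) by (auto simp: t_def)
  have nc: "\<not> h constant_on ball 0 t"
    if "\<And>z. h z = inverse (Q z)" "is_weierstrass g2 g3 Q" for h Q
  proof
    assume "h constant_on ball 0 t"
    then obtain k where k: "\<And>z. z \<in> ball 0 t \<Longrightarrow> h z = k"
      by (auto simp: constant_on_def)
    have "Q z = inverse k" if "z \<in> ball 0 t" for z
      using k[OF that] \<open>\<And>z. h z = inverse (Q z)\<close> by (metis inverse_inverse_eq)
    then have "Q constant_on ball 0 t"
      by (auto simp: constant_on_def)
    then show False
      using weierstrass_not_constant_on[OF that(2), of "ball 0 t"] t(1) by simp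
  qed
  have "eventually (\<lambda>z. f z = g z) (nhds 0)"
    using f(2-3,5) g(2-3,5) t nc[OF f(6) P] nc[OF g(6) R]
    by (intro pole_germ_unique[OF t(1), of f g2 g3 g]) (auto intro: holomorphic_on_subset)
  then have "eventually (\<lambda>z. P z = R z) (nhds 0)"
    by eventually_elim (simp add: f(6) g(6))
  then have "eventually (\<lambda>z. P z = R z) (at 0)"
    by (simp add: eventually_nhds_conv_at)
  then show ?thesis
    using nicely_meromorphic_eqI(1)[OF weierstrass_nicely_meromorphic[OF P] weierstrass_nicely_meromorphic[OF R]
        open_UNIV connected_UNIV UNIV_I] by blast
qed

lemma weierstrass_eq:
  assumes "is_weierstrass g2 g3 P"
  shows "weierstrass g2 g3 = P"
  unfolding weierstrass_def using assms weierstrass_unique by (intro the_equality) blast+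

text \<open>The reflected function satisfies the same characterization, so uniqueness applies. The
  argument is written as \<open>0 + (- 1) * z\<close> to fit
  \<open>nicely_meromorphic_affine\<close>.\<close>

lemma weierstrass_even:
  assumes W: "is_weierstrass g2 g3 P"
  shows "P (- z) = P z" "is_pole P (- z) \<longleftrightarrow> is_pole P z"
proof -
  let ?R = "\<lambda>z. P (0 + (- 1) * z)"
  note n = nicely_meromorphic_affine[OF weierstrass_nicely_meromorphic[OF W], of "- 1" 0]
  have pole: "is_pole ?R z \<longleftrightarrow> is_pole P (- z)" for z
    using n(2)[of z] by simp
  have "(deriv ?R z)\<^sup>2 = 4 * ?R z ^ 3 - g2 * ?R z - g3" if "\<not> is_pole ?R z" for z
  proof -
    have np: "\<not> is_pole P (- z)"
      using that pole[of z] by blast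
    have um: "((\<lambda>x. 0 + - 1 * x) has_field_derivative - 1) (at z)"
      by (auto intro!: derivative_eq_intros)
    have "(?R has_field_derivative deriv P (- z) * - 1) (at z)"
      by (rule DERIV_chain2[OF _ um]) (use weierstrass_derivative[OF W np] in simp)
    then have "deriv ?R z = - deriv P (- z)"
      by (simp add: DERIV_imp_deriv)
    then show ?thesis
      using weierstrass_ode[OF W np] by (simp add: wcubic_def)
  qed
  moreover have "is_pole ?R 0"
    unfolding pole using weierstrass_pole_0[OF W] by simp
  ultimately have "is_weierstrass g2 g3 ?R"
    unfolding is_weierstrass_def using n(1) by simp
  from weierstrass_unique[OF W this] have "P = ?R" .
  then show "P (- z) = P z"
    by (metis add_0 mult_minus1)
  show "is_pole P (- z) \<longleftrightarrow> is_pole P z"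
    using pole[of z] \<open>P = ?R\<close> by simp
qed

text \<open>Numerator and denominator of the duplication formula for \<open>1 / \<wp>\<close>, made homogeneous.\<close>

definition dup_num :: "complex \<Rightarrow> complex \<Rightarrow> complex \<Rightarrow> complex \<Rightarrow> complex" where
  "dup_num g2 g3 u v = 4 * u * v ^ 3 - g2 * u ^ 3 * v - g3 * u ^ 4"

definition dup_den :: "complex \<Rightarrow> complex \<Rightarrow> complex \<Rightarrow> complex \<Rightarrow> complex" where
  "dup_den g2 g3 u v = v ^ 4 + g2 / 2 * u ^ 2 * v ^ 2 + 2 * g3 * u ^ 3 * v + g2 ^ 2 / 16 * u ^ 4"

lemma dup_homogeneous:
  "dup_num g2 g3 (a * v) v = v ^ 4 * dup_num g2 g3 a 1"
  "dup_den g2 g3 (a * v) v = v ^ 4 * dup_den g2 g3 a 1"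
  by (simp_all add: dup_num_def dup_den_def power2_eq_square power3_eq_cube power4_eq_xxxx algebra_simps)

text \<open>The left side is the square of \<open>N' D - N D'\<close>, the numerator of the
  derivative of \<open>N / D\<close>. Together with \<open>f'^2 = N\<close>, the identity says that
  \<open>N / D\<close>, evaluated at half the argument, again satisfies the equation of
  \<open>f\<close>.\<close>

lemma duplication_identity:
  fixes x g2 g3 :: complex
  defines "N \<equiv> dup_num g2 g3 x 1" and "D \<equiv> dup_den g2 g3 x 1"
  shows "((4 - 3 * g2 * x ^ 2 - 4 * g3 * x ^ 3) * D - N * (g2 * x + 6 * g3 * x ^ 2 + g2 ^ 2 / 4 * x ^ 3)) ^ 2
    = 4 * (4 * D ^ 3 - g2 * N ^ 2 * D - g3 * N ^ 3)"
  unfolding N_def D_def dup_num_def dup_den_def by (simp add: field_simps) algebra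

lemma holomorphic_eq_on_ball:
  assumes "f holomorphic_on ball 0 R" "g holomorphic_on ball 0 R" "R > 0"
    and "eventually (\<lambda>z. f z = g z) (nhds 0)" "z \<in> ball 0 R"
  shows "f z = g z"
proof -
  obtain e where e: "e > 0" "\<And>z. dist z 0 < e \<Longrightarrow> f z = g z"
    using assms(4) by (auto simp: eventually_nhds_metric)
  show ?thesis
    by (rule analytic_continuation_open[of "ball 0 (min e R)" "ball 0 R"]) (use assms e in auto)
qed

text \<open>Used to differentiate at points near \<open>z0\<close> a formula that holds only off
  \<open>z0\<close>.\<close>

lemma eventually_at_imp_eventually_nhds:
  fixes z0 :: "'a :: t1_space"
  assumes "eventually Q (at z0)"
  shows "eventually (\<lambda>z. eventually Q (nhds z)) (at z0)"
proof -
  obtain S where S: "open S" "z0 \<in> S" "\<And>z. z \<in> S \<Longrightarrow> z \<noteq> z0 \<Longrightarrow> Q z"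
    using assms by (auto simp: eventually_at_topological)
  have "eventually Q (nhds z)" if "z \<in> S" "z \<noteq> z0" for z
    unfolding eventually_nhds by (rule exI[of _ "S - {z0}"]) (use S that in auto)
  with S show ?thesis
    by (auto simp: eventually_at_topological)
qed

text \<open>A numerator and a denominator of the continuation of \<open>f\<close> at
  \<open>z\<close>, computed from the value of \<open>f\<close> at \<open>z / 2 ^ n\<close>; both
  are holomorphic as long as that point lies in the original ball.\<close>

primrec dup_iterate :: "complex \<Rightarrow> complex \<Rightarrow> (complex \<Rightarrow> complex) \<Rightarrow> nat \<Rightarrow> complex \<Rightarrow> complex \<times> complex" where
  "dup_iterate g2 g3 f 0 z = (f z, 1)"
| "dup_iterate g2 g3 f (Suc n) z =
     (dup_num g2 g3 (fst (dup_iterate g2 g3 f n (z / 2))) (snd (dup_iterate g2 g3 f n (z / 2))),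
      dup_den g2 g3 (fst (dup_iterate g2 g3 f n (z / 2))) (snd (dup_iterate g2 g3 f n (z / 2))))"

section \<open>Continuation of the germ by iterated duplication\<close>

context
  fixes g2 g3 :: complex and f r
  assumes r: "r > 0" and f: "f holomorphic_on ball 0 r" "f 0 = 0" "\<not> f constant_on ball 0 r"
    and ode: "\<And>z. z \<in> ball 0 r \<Longrightarrow> (deriv f z)\<^sup>2 = 4 * f z - g2 * f z ^ 3 - g3 * f z ^ 4"
begin

lemma half_in_ball: "z \<in> ball 0 (2 * R) \<Longrightarrow> z / 2 \<in> ball (0 :: complex) R"
  by (simp add: norm_divide)

text \<open>The quotient at half the argument is a nonconstant germ vanishing at 0 that satisfies
  the same first-order equation, so it is \<open>f\<close>. The quotient is formed only near 0,
  where the denominator is close to 1.\<close>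

lemma germ_duplication:
  "eventually (\<lambda>z. dup_num g2 g3 (f (z / 2)) 1 = f z * dup_den g2 g3 (f (z / 2)) 1) (nhds 0)"
proof -
  have "isCont f 0"
    using f(1) r by (intro analytic_at_imp_isCont) (auto simp: analytic_at intro!: exI[of _ "ball 0 r"])
  then have "isCont (\<lambda>z. dup_den g2 g3 (f z) 1) 0"
    unfolding dup_den_def by (intro continuous_intros)
  moreover have "dup_den g2 g3 (f 0) 1 \<noteq> 0"
    by (simp add: f(2) dup_den_def)
  ultimately obtain t0 where t0: "t0 > 0" "\<And>z. dist 0 z < t0 \<Longrightarrow> dup_den g2 g3 (f z) 1 \<noteq> 0"
    using continuous_at_avoid[of 0 "\<lambda>z. dup_den g2 g3 (f z) 1" 0] by auto
  define t where "t = min t0 r"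
  have t: "t > 0" "t \<le> r" "t \<le> t0"
    using t0 r by (auto simp: t_def)
  have in_r: "z / 2 \<in> ball (0 :: complex) r" if "z \<in> ball 0 t" for z
    using that t by (simp add: norm_divide)
  have den: "dup_den g2 g3 (f (z / 2)) 1 \<noteq> 0" if "z \<in> ball 0 t" for z
    using that t by (intro t0(2)) (simp add: norm_divide)
  have df: "((\<lambda>z. f (z / 2)) has_field_derivative deriv f (z / 2) * (1 / 2)) (at z)" if "z \<in> ball 0 t" for z
  proof -
    have "((\<lambda>z. z / 2) has_field_derivative 1 / 2) (at z)"
      by (auto intro!: derivative_eq_intros)
    from DERIV_chain2[OF _ this, of f] holomorphic_derivI[OF f(1) open_ball in_r[OF that], of UNIV]
    show ?thesis by simp
  qed
  define g where "g z = dup_num g2 g3 (f (z / 2)) 1 / dup_den g2 g3 (f (z / 2)) 1" for z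
  have dg: "(g has_field_derivative
      ((4 - 3 * g2 * f (z / 2) ^ 2 - 4 * g3 * f (z / 2) ^ 3) * dup_den g2 g3 (f (z / 2)) 1
        - dup_num g2 g3 (f (z / 2)) 1 * (g2 * f (z / 2) + 6 * g3 * f (z / 2) ^ 2 + g2 ^ 2 / 4 * f (z / 2) ^ 3))
        * (deriv f (z / 2) * (1 / 2)) / (dup_den g2 g3 (f (z / 2)) 1) ^ 2) (at z)"
    if z: "z \<in> ball 0 t" for z
  proof -
    define a where "a = deriv f (z / 2) * (1 / 2)"
    have "((\<lambda>z. dup_num g2 g3 (f (z / 2)) 1) has_field_derivative
        (4 - 3 * g2 * f (z / 2) ^ 2 - 4 * g3 * f (z / 2) ^ 3) * a) (at z)"
      unfolding dup_num_def using df[OF z, folded a_def]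
      by (auto intro!: derivative_eq_intros simp: algebra_simps)
    moreover have "((\<lambda>z. dup_den g2 g3 (f (z / 2)) 1) has_field_derivative
        (g2 * f (z / 2) + 6 * g3 * f (z / 2) ^ 2 + g2 ^ 2 / 4 * f (z / 2) ^ 3) * a) (at z)"
      unfolding dup_den_def using df[OF z, folded a_def]
      by (auto intro!: derivative_eq_intros simp: algebra_simps)
    ultimately have "(g has_field_derivative
        ((4 - 3 * g2 * f (z / 2) ^ 2 - 4 * g3 * f (z / 2) ^ 3) * a * dup_den g2 g3 (f (z / 2)) 1
        - dup_num g2 g3 (f (z / 2)) 1 * ((g2 * f (z / 2) + 6 * g3 * f (z / 2) ^ 2 + g2 ^ 2 / 4 * f (z / 2) ^ 3) * a))
        / (dup_den g2 g3 (f (z / 2)) 1 * dup_den g2 g3 (f (z / 2)) 1)) (at z)"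
      unfolding g_def[abs_def] using den[OF z] by (rule DERIV_divide)
    then show ?thesis
      unfolding a_def[symmetric] power2_eq_square[of "dup_den _ _ _ _"]
      by (rule back_subst[of "\<lambda>d. (g has_field_derivative d) (at z)"]) (simp add: algebra_simps)
  qed
  have g_ode: "(deriv g z)\<^sup>2 = 4 * g z - g2 * g z ^ 3 - g3 * g z ^ 4" if z: "z \<in> ball 0 t" for z
  proof -
    define x N D E where "x = f (z / 2)" and "N = dup_num g2 g3 x 1" and "D = dup_den g2 g3 x 1"
      and "E = (4 - 3 * g2 * x ^ 2 - 4 * g3 * x ^ 3) * D - N * (g2 * x + 6 * g3 * x ^ 2 + g2 ^ 2 / 4 * x ^ 3)"
    have "deriv g z = E * (deriv f (z / 2) * (1 / 2)) / D ^ 2"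
      using DERIV_imp_deriv[OF dg[OF z]] by (simp only: x_def N_def D_def E_def)
    then have "(deriv g z)\<^sup>2 = E\<^sup>2 * ((deriv f (z / 2))\<^sup>2 / 4) / D ^ 4"
      by (simp add: power_mult_distrib power_divide)
    also have "(deriv f (z / 2))\<^sup>2 = N"
      using ode[OF in_r[OF z]] by (simp add: x_def N_def dup_num_def)
    also have "E\<^sup>2 = 4 * (4 * D ^ 3 - g2 * N ^ 2 * D - g3 * N ^ 3)"
      unfolding E_def N_def D_def by (rule duplication_identity)
    also have "4 * (4 * D ^ 3 - g2 * N ^ 2 * D - g3 * N ^ 3) * (N / 4) / D ^ 4
        = 4 * (N / D) - g2 * (N / D) ^ 3 - g3 * (N / D) ^ 4"
      using den[OF z] unfolding x_def[symmetric] D_def[symmetric]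
      by (simp add: field_simps power2_eq_square power3_eq_cube power4_eq_xxxx)
    finally have "(deriv g z)\<^sup>2 = 4 * (N / D) - g2 * (N / D) ^ 3 - g3 * (N / D) ^ 4" .
    moreover have "g z = N / D"
      by (simp add: g_def x_def N_def D_def)
    ultimately show ?thesis
      by simp
  qed
  have hol: "g holomorphic_on ball 0 t"
    unfolding holomorphic_on_open[OF open_ball] using dg by blast
  have g0: "g 0 = 0"
    by (simp add: g_def f(2) dup_num_def)
  \<comment> \<open>If \<open>g\<close> were constant, the numerator, which equals
    \<open>f'^2\<close>, would vanish near 0, against \<open>f'' = 2\<close> at the origin.\<close>
  have "\<not> g constant_on ball 0 t"
  proof
    assume "g constant_on ball 0 t"
    then have gz: "g z = 0" if "z \<in> ball 0 t" for z
      using g0 that t unfolding constant_on_def by (metis centre_in_ball)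
    have N0: "dup_num g2 g3 (f (z / 2)) 1 = 0" if "z \<in> ball 0 t" for z
      using den[OF that] gz[OF that] by (simp add: g_def)
    have "deriv f z = 0" if "z \<in> ball 0 (t / 2)" for z
      using N0[of "2 * z"] ode[of z] that t by (simp add: dup_num_def norm_mult)
    moreover have "eventually (\<lambda>z. z \<in> ball 0 (t / 2)) (nhds (0::complex))"
      using t by (intro eventually_nhds_in_open) auto
    ultimately have "eventually (\<lambda>z. deriv f z = 0) (nhds 0)"
      by (simp add: eventually_mono)
    then have "deriv (deriv f) 0 = deriv (\<lambda>_. 0) 0"
      by (rule deriv_cong_ev) simp
    moreover have "deriv (deriv f) 0 = 2"
      using second_order_at_pole[OF open_ball connected_ball f(1,3) ode, of 0] f(2) r by simp
    ultimately show False by simp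
  qed
  moreover have "\<not> f constant_on ball 0 t"
  proof
    assume "f constant_on ball 0 t"
    then have f0: "f z = 0" if "z \<in> ball 0 t" for z
      using f(2) that t unfolding constant_on_def by (metis centre_in_ball)
    have "eventually (\<lambda>z. z \<in> ball 0 t) (nhds (0::complex))"
      using t by (intro eventually_nhds_in_open) auto
    then have "eventually (\<lambda>z. f z = 0) (nhds 0)"
      by eventually_elim (rule f0)
    then have "f z = 0" if "z \<in> ball 0 r" for z
      by (rule holomorphic_eq_on_ball[OF f(1) holomorphic_on_const r _ that])
    with f(3) show False by (auto simp: constant_on_def)
  qed
  moreover have "f holomorphic_on ball 0 t"
    using f(1) by (rule holomorphic_on_subset) (use t in auto)
  ultimately have "eventually (\<lambda>z. f z = g z) (nhds 0)"
    using hol g0 f(2) ode g_ode t by (intro pole_germ_unique[OF t(1), of f g2 g3 g]) auto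
  moreover have "eventually (\<lambda>z. z \<in> ball 0 t) (nhds (0::complex))"
    using t by (intro eventually_nhds_in_open) auto
  ultimately show ?thesis
    by eventually_elim (use den in \<open>auto simp: g_def\<close>)
qed

abbreviation "U n z \<equiv> fst (dup_iterate g2 g3 f n z)"
abbreviation "V n z \<equiv> snd (dup_iterate g2 g3 f n z)"

lemma dup_iterate_0: "U n 0 = 0" "V n 0 = 1"
  by (induction n) (auto simp: f(2) dup_num_def dup_den_def)

lemma dup_iterate_holomorphic: "U n holomorphic_on ball 0 (2 ^ n * r) \<and> V n holomorphic_on ball 0 (2 ^ n * r)"
proof (induction n)
  case 0
  show ?case using f(1) by simp
next
  case (Suc n)
  have h: "(\<lambda>z. g (z / 2)) holomorphic_on ball 0 (2 ^ Suc n * r)"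
    if "g holomorphic_on ball 0 (2 ^ n * r)" for g :: "complex \<Rightarrow> complex"
  proof -
    have "(g \<circ> (\<lambda>z. z / 2)) holomorphic_on ball 0 (2 ^ Suc n * r)"
      by (rule holomorphic_on_compose_gen[OF _ that])
        (use half_in_ball[of _ "2 ^ n * r"] in \<open>auto intro!: holomorphic_intros simp: mult.assoc\<close>)
    then show ?thesis by (simp add: o_def)
  qed
  show ?case
    using h[of "U n"] h[of "V n"] Suc.IH
    by (auto simp: dup_num_def dup_den_def intro!: holomorphic_intros)
qed

text \<open>Both forms are homogeneous of degree 4, so the fourth power of the previous denominator
  is a common factor.\<close>

lemma dup_iterate_germ: "eventually (\<lambda>z. U n z = f z * V n z) (nhds 0)"
proof (induction n)
  case (Suc n)
  have "filterlim (\<lambda>z::complex. z / 2) (nhds 0) (nhds 0)"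
    using tendsto_divide[OF tendsto_ident_at tendsto_const, of 2 "0::complex" UNIV]
    by (simp add: tendsto_nhds_iff)
  from eventually_compose_filterlim[OF Suc.IH this] germ_duplication show ?case
  proof eventually_elim
    case (elim z)
    then show ?case
      by (simp add: dup_homogeneous elim(1) elim(2))
  qed
qed simp

text \<open>All iterates represent \<open>f\<close> near 0; in cross-multiplied form this continues
  to the common ball, whatever zeros the denominators have.\<close>

lemma dup_iterate_cross:
  assumes "norm z < 2 ^ n * r" "norm z < 2 ^ m * r"
  shows "U n z * V m z = U m z * V n z"
proof -
  define R where "R = min (2 ^ n * r) (2 ^ m * r)"
  have R: "R > 0" "ball (0::complex) R \<subseteq> ball 0 (2 ^ n * r)" "ball (0::complex) R \<subseteq> ball 0 (2 ^ m * r)"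
    using r by (auto simp: R_def)
  have hol: "U n holomorphic_on ball 0 R" "V n holomorphic_on ball 0 R"
    "U m holomorphic_on ball 0 R" "V m holomorphic_on ball 0 R"
    using dup_iterate_holomorphic R holomorphic_on_subset by blast+
  have "eventually (\<lambda>z. U n z * V m z = U m z * V n z) (nhds 0)"
    using dup_iterate_germ[of n] dup_iterate_germ[of m] by eventually_elim simp
  then show ?thesis
    by (rule holomorphic_eq_on_ball[OF holomorphic_on_mult[OF hol(1,4)] holomorphic_on_mult[OF hol(3,2)] R(1)])
      (use assms in \<open>auto simp: R_def\<close>)
qed

lemma germ_nonzero: "eventually (\<lambda>z. f z \<noteq> 0) (at 0)"
proof -
  obtain b where b: "b \<in> ball 0 r" "f b \<noteq> 0"
    using f(3) by (metis constant_on_def)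
  have "eventually (\<lambda>w. f w \<noteq> 0 \<and> w \<in> ball 0 r) (at 0)"
    by (rule non_zero_neighbour_alt[OF f(1)]) (use b r in auto)
  then show ?thesis by eventually_elim simp
qed

text \<open>Near 0 the numerator is \<open>f\<close> times a factor tending to 1, so it does not
  vanish identically and its zeros are isolated.\<close>

lemma dup_iterate_nonzero:
  assumes "norm z0 < 2 ^ n * r"
  shows "eventually (\<lambda>z. U n z \<noteq> 0) (at z0)"
proof -
  define B where "B = ball (0::complex) (2 ^ n * r)"
  have B: "0 \<in> B" "open B" "connected B" "z0 \<in> B"
    using r assms by (auto simp: B_def)
  have hol: "U n holomorphic_on B" "V n holomorphic_on B"
    using dup_iterate_holomorphic by (auto simp: B_def)
  have "isCont (V n) 0"
    using hol B by (intro analytic_at_imp_isCont) (auto simp: analytic_at)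
  then have "(V n \<longlongrightarrow> 1) (at 0)"
    by (simp add: isCont_def dup_iterate_0)
  then have "eventually (\<lambda>z. V n z \<noteq> 0) (at 0)"
    by (rule tendsto_imp_eventually_ne) simp
  moreover have "eventually (\<lambda>z. U n z = f z * V n z) (at 0)"
    using dup_iterate_germ by (simp add: eventually_nhds_conv_at)
  moreover have "eventually (\<lambda>z. z \<in> B) (at 0)"
    using B by (intro eventually_at_in_open') auto
  ultimately have "eventually (\<lambda>z. z \<in> B \<and> U n z \<noteq> 0) (at 0)"
    using germ_nonzero by eventually_elim auto
  then obtain b where b: "b \<in> B" "U n b \<noteq> 0"
    using eventually_happens'[OF trivial_limit_at] by blast
  have "eventually (\<lambda>w. U n w \<noteq> 0 \<and> w \<in> B) (at z0)"
    by (rule non_zero_neighbour_alt[OF hol(1) B(2,3,4) b])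
  then show ?thesis by eventually_elim simp
qed

text \<open>The Weierstrass equation for the quotient of \<open>V n\<close> by \<open>U n\<close>,
  multiplied by the fourth power of \<open>U n\<close>. Free of denominators, it is holomorphic on
  the whole ball and needs to be verified near 0 only.\<close>

lemma dup_iterate_ode:
  assumes "norm z < 2 ^ n * r"
  shows "(deriv (V n) z * U n z - V n z * deriv (U n) z)\<^sup>2
    = 4 * V n z ^ 3 * U n z - g2 * V n z * U n z ^ 3 - g3 * U n z ^ 4"
proof -
  define R where "R = 2 ^ n * r"
  have "R > 0" using r by (simp add: R_def)
  have hol: "U n holomorphic_on ball 0 R" "V n holomorphic_on ball 0 R"
    using dup_iterate_holomorphic by (auto simp: R_def)
  have hol': "deriv (U n) holomorphic_on ball 0 R" "deriv (V n) holomorphic_on ball 0 R"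
    using hol by (auto intro: holomorphic_deriv)
  have "eventually (\<lambda>z. eventually (\<lambda>w. U n w = f w * V n w) (nhds z)) (nhds 0)"
    using dup_iterate_germ by (simp add: eventually_eventually)
  moreover have "eventually (\<lambda>z. z \<in> ball 0 R \<inter> ball 0 r) (nhds (0::complex))"
    using r \<open>R > 0\<close> by (intro eventually_nhds_in_open) auto
  ultimately have "eventually (\<lambda>z. (deriv (V n) z * U n z - V n z * deriv (U n) z)\<^sup>2
    = 4 * V n z ^ 3 * U n z - g2 * V n z * U n z ^ 3 - g3 * U n z ^ 4) (nhds 0)"
  proof eventually_elim
    case (elim z)
    have U: "U n z = f z * V n z"
      using eventually_nhds_x_imp_x[OF elim(1)] .
    have zr: "z \<in> ball 0 r" and zR: "z \<in> ball 0 R" using elim by auto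
    have "deriv (U n) z = deriv (\<lambda>w. f w * V n w) z"
      by (rule deriv_cong_ev[OF elim(1) refl])
    also have "\<dots> = f z * deriv (V n) z + deriv f z * V n z"
      by (rule DERIV_imp_deriv[OF DERIV_mult'])
        (use holomorphic_derivI[OF f(1) open_ball zr] holomorphic_derivI[OF hol(2) open_ball zR] in auto)
    finally have "deriv (V n) z * U n z - V n z * deriv (U n) z = - (deriv f z * V n z ^ 2)"
      by (simp add: U algebra_simps power2_eq_square)
    then have "(deriv (V n) z * U n z - V n z * deriv (U n) z)\<^sup>2 = (deriv f z)\<^sup>2 * V n z ^ 4"
      by (simp add: power_mult_distrib)
    also have "\<dots> = 4 * V n z ^ 3 * U n z - g2 * V n z * U n z ^ 3 - g3 * U n z ^ 4"
      unfolding ode[OF zr] U by (simp add: power_mult_distrib algebra_simps power3_eq_cube power4_eq_xxxx)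
    finally show ?case .
  qed
  then show ?thesis
    by (rule holomorphic_eq_on_ball[rotated 3])
      (use hol hol' \<open>R > 0\<close> assms in \<open>auto simp: R_def[symmetric] intro!: holomorphic_intros\<close>)
qed

text \<open>\<open>dup_iterate_cross\<close> makes the value independent of the admissible
  \<open>n\<close>. Points without admissible \<open>n\<close> are isolated, and the arbitrary value
  there is corrected by \<open>remove_sings\<close>.\<close>

definition weierstrass_value :: "complex \<Rightarrow> complex" where
  "weierstrass_value z = (SOME x. \<exists>n. norm z < 2 ^ n * r \<and> U n z \<noteq> 0 \<and> x = V n z / U n z)"

lemma weierstrass_value_eq:
  assumes "norm z < 2 ^ n * r" "U n z \<noteq> 0"
  shows "weierstrass_value z = V n z / U n z"
proof -
  have "\<exists>n. norm z < 2 ^ n * r \<and> U n z \<noteq> 0 \<and> weierstrass_value z = V n z / U n z"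
    unfolding weierstrass_value_def by (rule someI_ex) (use assms in blast)
  then obtain m where m: "norm z < 2 ^ m * r" "U m z \<noteq> 0" "weierstrass_value z = V m z / U m z"
    by blast
  then show ?thesis
    using dup_iterate_cross[OF assms(1) m(1)] assms(2) by (simp add: frac_eq_eq mult.commute)
qed

lemma eventually_weierstrass_value:
  assumes "norm z0 < 2 ^ n * r"
  shows "eventually (\<lambda>z. norm z < 2 ^ n * r \<and> U n z \<noteq> 0 \<and> weierstrass_value z = V n z / U n z) (at z0)"
proof -
  have "eventually (\<lambda>z. z \<in> ball 0 (2 ^ n * r)) (at z0)"
    using assms by (intro eventually_at_in_open') auto
  with dup_iterate_nonzero[OF assms] show ?thesis
    by eventually_elim (auto simp: weierstrass_value_eq)
qed

lemma ex_scale: "\<exists>n. norm (z :: complex) < 2 ^ n * r"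
proof -
  obtain n where "norm z / r < 2 ^ n"
    using real_arch_pow[of 2 "norm z / r"] by auto
  then show ?thesis using r by (auto simp: field_simps)
qed

lemma weierstrass_value_meromorphic: "weierstrass_value meromorphic_on UNIV"
proof (subst meromorphic_on_meromorphic_at, intro ballI)
  fix z0 :: complex
  obtain n where n: "norm z0 < 2 ^ n * r" using ex_scale by blast
  have "U n holomorphic_on ball 0 (2 ^ n * r)" "V n holomorphic_on ball 0 (2 ^ n * r)"
    using dup_iterate_holomorphic by auto
  then have "U n analytic_on {z0}" "V n analytic_on {z0}"
    using n by (auto simp: analytic_at intro!: exI[of _ "ball 0 (2 ^ n * r)"])
  then have "(\<lambda>z. V n z / U n z) meromorphic_on {z0}"
    by (intro meromorphic_intros analytic_on_imp_meromorphic_on)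
  moreover have "eventually (\<lambda>z. weierstrass_value z = V n z / U n z) (at z0)"
    using eventually_weierstrass_value[OF n] by eventually_elim simp
  ultimately show "weierstrass_value meromorphic_on {z0}"
    by (subst meromorphic_on_cong[of "{z0}" weierstrass_value "\<lambda>z. V n z / U n z"]) auto
qed

lemma is_weierstrass_remove_sings_value: "is_weierstrass g2 g3 (remove_sings weierstrass_value)"
  unfolding is_weierstrass_def
proof (intro conjI allI impI)
  let ?P = "remove_sings weierstrass_value"
  show "?P nicely_meromorphic_on UNIV"
    by (rule remove_sings_nicely_meromorphic[OF weierstrass_value_meromorphic])
  have P_eq: "eventually (\<lambda>z. norm z < 2 ^ n * r \<and> U n z \<noteq> 0 \<and> ?P z = V n z / U n z) (at z0)"
    if n: "norm z0 < 2 ^ n * r" for n z0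
  proof -
    have "isolated_singularity_at weierstrass_value z0"
      by (rule meromorphic_on_isolated_singularity[OF meromorphic_on_subset[OF weierstrass_value_meromorphic]]) auto
    from eventually_remove_sings_eq_at[OF this] eventually_weierstrass_value[OF n] show ?thesis
      by eventually_elim simp
  qed
  show "is_pole ?P 0"
  proof -
    have "f \<midarrow>0\<rightarrow> 0"
      using f(1,2) r holomorphic_on_imp_continuous_on[OF f(1)]
      by (metis centre_in_ball continuous_on_eq_continuous_at isCont_def open_ball)
    then have "filterlim f (at 0) (at 0)"
      using germ_nonzero by (rule filterlim_atI)
    then have "is_pole (\<lambda>z. inverse (f z)) 0"
      unfolding is_pole_def by (rule filterlim_compose[OF filterlim_inverse_at_infinity])
    moreover have ev: "eventually (\<lambda>z. inverse (f z) = ?P z) (at 0)"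
      \<comment> \<open>For \<open>n = 0\<close> the pair is \<open>(f z, 1)\<close>, so the value
        is the reciprocal of \<open>f\<close>.\<close>
      using P_eq[of 0 0] r by (auto elim!: eventually_mono simp: divide_inverse)
    ultimately show ?thesis
      using is_pole_cong[OF ev refl] by blast
  qed
  fix z0 assume np: "\<not> is_pole ?P z0"
  have "?P analytic_on {z0}"
    by (rule nicely_meromorphic_on_imp_analytic_at[OF _ UNIV_I np]) fact
  then obtain e where e: "e > 0" "?P holomorphic_on ball z0 e"
    by (auto simp: analytic_on_def)
  define L where "L z = (deriv ?P z)\<^sup>2 - (4 * ?P z ^ 3 - g2 * ?P z - g3)" for z
  have "L holomorphic_on ball z0 e"
    unfolding L_def[abs_def] using e by (intro holomorphic_intros) auto
  then have "isCont L z0"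
    using e by (intro analytic_at_imp_isCont) (auto simp: analytic_at intro!: exI[of _ "ball z0 e"])
  then have lim: "L \<midarrow>z0\<rightarrow> L z0"
    by (simp add: isCont_def)
  obtain n where n: "norm z0 < 2 ^ n * r" using ex_scale by blast
  have hol: "U n holomorphic_on ball 0 (2 ^ n * r)" "V n holomorphic_on ball 0 (2 ^ n * r)"
    using dup_iterate_holomorphic by auto
  \<comment> \<open>The derivative of \<open>?P\<close> at \<open>z\<close> can be computed from the
    quotient only if both agree in a whole neighbourhood of \<open>z\<close>.\<close>
  have "eventually (\<lambda>z. eventually (\<lambda>w. norm w < 2 ^ n * r \<and> U n w \<noteq> 0 \<and> ?P w = V n w / U n w) (nhds z)) (at z0)"
    by (rule eventually_at_imp_eventually_nhds[OF P_eq[OF n]])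
  then have "eventually (\<lambda>z. L z = 0) (at z0)"
  proof eventually_elim
    case (elim z)
    have z: "norm z < 2 ^ n * r" "U n z \<noteq> 0" "?P z = V n z / U n z"
      using eventually_nhds_x_imp_x[OF elim] by auto
    have zb: "z \<in> ball 0 (2 ^ n * r)" using z by simp
    have "eventually (\<lambda>w. ?P w = V n w / U n w) (nhds z)"
      using elim by eventually_elim simp
    then have "deriv ?P z = deriv (\<lambda>w. V n w / U n w) z"
      by (rule deriv_cong_ev) simp
    also have "\<dots> = (deriv (V n) z * U n z - V n z * deriv (U n) z) / (U n z * U n z)"
      by (rule DERIV_imp_deriv[OF DERIV_divide[OF holomorphic_derivI[OF hol(2) open_ball zb]
              holomorphic_derivI[OF hol(1) open_ball zb] z(2)]])
    finally have "(deriv ?P z)\<^sup>2 = (deriv (V n) z * U n z - V n z * deriv (U n) z)\<^sup>2 / U n z ^ 4"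
      by (simp add: power_divide power2_eq_square power4_eq_xxxx)
    also have "\<dots> = 4 * ?P z ^ 3 - g2 * ?P z - g3"
      unfolding dup_iterate_ode[OF z(1)] z(3) using z(2)
      by (simp add: field_simps power2_eq_square power3_eq_cube power4_eq_xxxx)
    finally show ?case by (simp add: L_def)
  qed
  then have "L \<midarrow>z0\<rightarrow> 0"
    by (rule tendsto_eventually)
  with lim have "L z0 = 0"
    by (rule LIM_unique)
  then show "(deriv ?P z0)\<^sup>2 = 4 * ?P z0 ^ 3 - g2 * ?P z0 - g3"
    by (simp add: L_def)
qed

end

theorem is_weierstrass_exists: "\<exists>P. is_weierstrass g2 g3 P"
proof -
  obtain f r where "r > 0" "f holomorphic_on ball 0 r" "f 0 = 0" "\<not> f constant_on ball 0 r"
    "\<And>z. z \<in> ball 0 r \<Longrightarrow> (deriv f z)\<^sup>2 = 4 * f z - g2 * f z ^ 3 - g3 * f z ^ 4"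
    using local_solution_pole by metis
  from is_weierstrass_remove_sings_value[OF this] show ?thesis by blast
qed

section \<open>Values, symmetries and periods\<close>

context
  fixes g2 g3 P
  assumes W: "is_weierstrass g2 g3 P"
begin

text \<open>\<open>k\<close> is 1 or -1, and a reversal of time leaves the second-order equation
  unchanged. Since \<open>X\<close> has no poles on its disc, equality of the two functions also
  shows that \<open>P\<close> has none along the corresponding points.\<close>

lemma weierstrass_extends_solution:
  assumes z1: "\<not> is_pole P z1" and X: "X holomorphic_on ball c r"
    and X'': "\<And>t. t \<in> ball c r \<Longrightarrow> deriv (deriv X) t = 6 * X t ^ 2 - g2 / 2"
    and s: "s \<in> ball c r" and k: "k\<^sup>2 = 1" and init: "X s = P z1" "deriv X s = k * deriv P z1"
    and t: "t \<in> ball c r"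
  shows "\<not> is_pole P (z1 + k * (t - s))" "X t = P (z1 + k * (t - s))"
proof -
  define a where "a = z1 - k * s"
  have a: "a + k * t = z1 + k * (t - s)" for t
    by (simp add: a_def algebra_simps)
  have k0: "k \<noteq> 0" using k by auto
  define R where "R t = P (a + k * t)" for t
  note aff = nicely_meromorphic_affine[OF weierstrass_nicely_meromorphic[OF W] k0, of a, folded R_def[abs_def]]
  define S where "S = ball c r \<inter> (\<lambda>t. a + k * t) -` {z. \<not> is_pole P z}"
  have S: "open S"
    unfolding S_def
    by (intro open_Int open_ball open_vimage weierstrass_open_nonpoles[OF W] continuous_intros)
  have sS: "s \<in> S"
    using s z1 by (simp add: S_def a)
  have lin: "((\<lambda>t. a + k * t) has_field_derivative k) (at t)" for t
    by (auto intro!: derivative_eq_intros)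
  have R': "(R has_field_derivative deriv P (a + k * t) * k) (at t)" if "t \<in> S" for t
    unfolding R_def[abs_def]
    by (rule DERIV_chain2[OF weierstrass_derivative[OF W] lin]) (use that in \<open>simp add: S_def\<close>)
  have Rhol: "R holomorphic_on S"
    unfolding holomorphic_on_open[OF S] using R' by blast
  have R'': "deriv (deriv R) t = 6 * R t ^ 2 - g2 / 2" if "t \<in> S" for t
  proof -
    have "eventually (\<lambda>t. t \<in> S) (nhds t)"
      using S that by (rule eventually_nhds_in_open)
    then have "eventually (\<lambda>t. deriv R t = deriv P (a + k * t) * k) (nhds t)"
      by eventually_elim (rule DERIV_imp_deriv[OF R'])
    then have "deriv (deriv R) t = deriv (\<lambda>t. deriv P (a + k * t) * k) t"
      by (rule deriv_cong_ev) simp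
    also have "\<dots> = (6 * P (a + k * t) ^ 2 - g2 / 2) * k * k"
      by (rule DERIV_imp_deriv[OF DERIV_cmult_right[OF DERIV_chain2[OF weierstrass_second_derivative[OF W] lin]]])
        (use that in \<open>simp add: S_def\<close>)
    also have "\<dots> = 6 * R t ^ 2 - g2 / 2"
      using k by (simp add: R_def power2_eq_square mult.assoc)
    finally show ?thesis .
  qed
  have "eventually (\<lambda>t. X t = R t) (nhds s)"
  proof (rule second_order_unique_holomorphic[where p = "\<lambda>x. 6 * x ^ 2 - g2 / 2", OF _ S sS])
    show "(\<lambda>x. 6 * x ^ 2 - g2 / 2) holomorphic_on UNIV"
      by (intro holomorphic_intros) auto
    show "X holomorphic_on S"
      using X by (rule holomorphic_on_subset) (auto simp: S_def)
    show "X s = R s"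
      by (simp add: R_def a init)
    show "deriv X s = deriv R s"
      using DERIV_imp_deriv[OF R'[OF sS]] by (simp add: a init)
  qed (use Rhol R'' X'' in \<open>auto simp: S_def\<close>)
  then have ev: "eventually (\<lambda>t. X t = R t) (at s)"
    by (simp add: eventually_nhds_conv_at)
  have Xan: "X analytic_on ball c r"
    using X by (simp add: analytic_on_open)
  have nX: "X nicely_meromorphic_on ball c r"
    by (rule analytic_on_imp_nicely_meromorphic_on[OF Xan])
  have nR: "R nicely_meromorphic_on ball c r"
    using aff(1) by (rule nicely_meromorphic_on_subset) auto
  note eqs = nicely_meromorphic_eqI[OF nX nR open_ball connected_ball s ev t]
  show "X t = P (z1 + k * (t - s))"
    using eqs(1) by (simp add: R_def a)
  have "\<not> is_pole X t"
    using not_is_pole_holomorphic[OF open_ball t X] .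
  then show "\<not> is_pole P (z1 + k * (t - s))"
    using eqs(2) aff(2)[of t] by (simp add: a)
qed

lemma weierstrass_surjective:
  assumes x0: "wcubic g2 g3 x0 \<noteq> 0 \<or> 12 * x0\<^sup>2 - g2 \<noteq> 0"
  shows "\<exists>z. \<not> is_pole P z \<and> P z = x0"
proof -
  define V where "V = P ` {z. \<not> is_pole P z}"
  define B where "B = {x. wcubic g2 g3 x = 0 \<and> 12 * x\<^sup>2 - g2 = 0}"
  have "B \<subseteq> {x. poly [:- g3, - g2, 0, 4:] x = 0}"
    by (auto simp: B_def wcubic_def power3_eq_cube algebra_simps)
  then have finB: "finite B"
    using poly_roots_finite[of "[:- g3, - g2, 0, 4:]"] finite_subset by auto
  have conn: "connected (UNIV - B)"
    by (rule connected_open_delete_finite) (use finB in auto)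
  have nbhd: "x \<in> interior V \<or> x \<in> interior (- V)" if "x \<notin> B" for x
  proof -
    have "wcubic g2 g3 x \<noteq> 0 \<or> 12 * x\<^sup>2 - g2 \<noteq> 0"
      using that by (auto simp: B_def)
    from local_solution_regular_point[OF this] obtain X r where
      X: "r > 0" "X holomorphic_on ball 0 r" "X 0 = x" "\<not> X constant_on ball 0 r"
      "\<And>z. z \<in> ball 0 r \<Longrightarrow> (deriv X z)\<^sup>2 = wcubic g2 g3 (X z)" by metis
    define N where "N = X ` ball 0 r"
    have N: "open N" "x \<in> N"
      unfolding N_def using open_mapping_thm[OF X(2) open_ball connected_ball open_ball _ X(4)] X(1,3)
      by (auto intro!: image_eqI[of _ _ 0])
    have X'': "deriv (deriv X) t = 6 * X t ^ 2 - g2 / 2" if "t \<in> ball 0 r" for t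
      by (rule second_order_regular[OF open_ball connected_ball X(2,4,5) that])
    \<comment> \<open>At a common value the derivatives agree up to sign, so the whole local
      solution consists of values of \<open>P\<close>. Hence \<open>N\<close> is either contained in
      \<open>V\<close> or disjoint from it.\<close>
    have "N \<subseteq> V" if "N \<inter> V \<noteq> {}"
    proof -
      obtain s z1 where s: "s \<in> ball 0 r" "\<not> is_pole P z1" "X s = P z1"
        using \<open>N \<inter> V \<noteq> {}\<close> by (auto simp: N_def V_def)
      have "(deriv X s)\<^sup>2 = (deriv P z1)\<^sup>2"
        using X(5)[OF s(1)] weierstrass_ode[OF W s(2)] s(3) by simp
      then have "deriv X s = 1 * deriv P z1 \<or> deriv X s = (- 1) * deriv P z1"
        by (simp add: power2_eq_iff)
      then obtain k :: complex where k: "k\<^sup>2 = 1" "deriv X s = k * deriv P z1"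
        by (metis power2_minus power_one)
      show "N \<subseteq> V"
        using weierstrass_extends_solution[OF s(2) X(2) X'' s(1) k(1) s(3) k(2)]
        by (auto simp: N_def V_def)
    qed
    then show ?thesis
      using N by (metis ComplI disjoint_iff interiorI subsetI)
  qed
  have "UNIV - B \<subseteq> interior V \<union> interior (- V)"
    using nbhd by auto
  moreover have "interior V \<inter> interior (- V) \<inter> (UNIV - B) = {}"
    using interior_subset[of V] interior_subset[of "- V"] by auto
  ultimately have "interior V \<inter> (UNIV - B) = {} \<or> interior (- V) \<inter> (UNIV - B) = {}"
    by (intro connectedD[OF conn]) auto
  \<comment> \<open>The image of a small ball is open and nonempty, hence infinite, and not
    contained in the finite set \<open>B\<close>.\<close>
  moreover have "interior V \<inter> (UNIV - B) \<noteq> {}"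
  proof -
    obtain z where z: "\<not> is_pole P z"
    proof -
      have "isolated_singularity_at P 0"
        using weierstrass_nicely_meromorphic[OF W] meromorphic_on_isolated_singularity[of P 0] meromorphic_on_subset[of P UNIV "{0}"]
        by (auto simp: nicely_meromorphic_on_def)
      then have "eventually (\<lambda>z. P analytic_on {z}) (at 0)"
        by (simp add: isolated_singularity_at_altdef)
      then obtain z where "P analytic_on {z}"
        using eventually_happens'[OF trivial_limit_at] by blast
      then show thesis
        using that analytic_at_imp_no_pole by blast
    qed
    obtain e where e: "e > 0" "ball z e \<subseteq> {z. \<not> is_pole P z}"
      using weierstrass_open_nonpoles[OF W] z by (auto simp: open_contains_ball)
    have hol: "P holomorphic_on ball z e"
      using e by (intro weierstrass_holomorphic[OF W]) auto
    have "open (P ` ball z e)"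
      by (rule open_mapping_thm[OF hol open_ball connected_ball open_ball])
        (use weierstrass_not_constant_on[OF W, of "ball z e"] e in auto)
    moreover have "P ` ball z e \<subseteq> V" "P ` ball z e \<noteq> {}"
      using e by (auto simp: V_def)
    ultimately show ?thesis
      using finite_imp_not_open[of "P ` ball z e"] finB
      by (metis Diff_UNIV Diff_eq_empty_iff compl_le_swap1 disjoint_eq_subset_Compl finite_subset
          interior_maximal Compl_eq_Diff_UNIV double_complement subset_trans)
  qed
  ultimately have "x \<in> V" if "x \<notin> B" for x
    using that nbhd interior_subset[of V] by blast
  moreover have "x0 \<notin> B" using x0 by (auto simp: B_def)
  ultimately show ?thesis
    by (force simp: V_def)
qed

lemma weierstrass_deriv_odd:
  assumes "\<not> is_pole P z"
  shows "deriv P (- z) = - deriv P z"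
proof -
  have np: "\<not> is_pole P (- z)"
    using weierstrass_even(2)[OF W] assms by blast
  have um: "((\<lambda>z. - z) has_field_derivative - 1) (at z)"
    by (auto intro!: derivative_eq_intros)
  have "((\<lambda>z. P (- z)) has_field_derivative deriv P (- z) * - 1) (at z)"
    by (rule DERIV_chain2[OF weierstrass_derivative[OF W np] um])
  then have "(P has_field_derivative deriv P (- z) * - 1) (at z)"
    by (simp add: weierstrass_even(1)[OF W])
  from DERIV_unique[OF this weierstrass_derivative[OF W assms]] show ?thesis
    by (metis minus_minus mult_minus1_right)
qed

text \<open>The equation leaves only the sign of the derivative open, and replacing \<open>z\<close>
  by \<open>- z\<close> changes it.\<close>

lemma weierstrass_attains:
  assumes y0: "y0\<^sup>2 = wcubic g2 g3 x0" and reg: "y0 \<noteq> 0 \<or> 12 * x0\<^sup>2 - g2 \<noteq> 0"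
  obtains z where "\<not> is_pole P z" "P z = x0" "deriv P z = y0"
proof -
  have "wcubic g2 g3 x0 \<noteq> 0 \<or> 12 * x0\<^sup>2 - g2 \<noteq> 0"
    using y0 reg by (cases "y0 = 0") auto
  then obtain z where z: "\<not> is_pole P z" "P z = x0"
    using weierstrass_surjective[of x0] by blast
  have "(deriv P z)\<^sup>2 = y0\<^sup>2"
    using weierstrass_ode[OF W z(1)] y0 z(2) by simp
  then consider "deriv P z = y0" | "deriv P z = - y0"
    by (auto simp: power2_eq_iff)
  then show thesis
  proof cases
    case 1
    with z that show thesis by blast
  next
    case 2
    then show thesis
      using z weierstrass_even[OF W, of z] weierstrass_deriv_odd[OF z(1)] by (intro that[of "- z"]) auto
  qed
qed

lemma weierstrass_isolated_pole:
  obtains d where "d > 0" "\<And>z. z \<noteq> 0 \<Longrightarrow> norm z < d \<Longrightarrow> \<not> is_pole P z"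
proof -
  have "isolated_singularity_at P 0"
    using weierstrass_nicely_meromorphic[OF W] meromorphic_on_isolated_singularity[of P 0] meromorphic_on_subset[of P UNIV "{0}"]
    by (auto simp: nicely_meromorphic_on_def)
  then obtain d where d: "d > 0" "P analytic_on ball 0 d - {0}"
    by (auto simp: isolated_singularity_at_def)
  have "\<not> is_pole P z" if "z \<noteq> 0" "norm z < d" for z
  proof -
    have "P analytic_on {z}"
      using d(2) by (rule analytic_on_subset) (use that in auto)
    then show ?thesis using analytic_at_imp_no_pole by blast
  qed
  with d(1) that show thesis by blast
qed

text \<open>Where the derivative vanishes, the solution run backwards has the same initial values:
  the case \<open>k = - 1\<close> of \<open>weierstrass_extends_solution\<close>.\<close>

lemma weierstrass_reflection:
  assumes w: "\<not> is_pole P w" "deriv P w = 0"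
  shows "P (w + t) = P (w - t)"
proof -
  obtain e where e: "e > 0" "ball w e \<subseteq> {z. \<not> is_pole P z}"
    using weierstrass_open_nonpoles[OF W] w by (auto simp: open_contains_ball)
  have hol: "P holomorphic_on ball w e"
    using e by (intro weierstrass_holomorphic[OF W]) auto
  have P'': "deriv (deriv P) z = 6 * P z ^ 2 - g2 / 2" if "z \<in> ball w e" for z
    using DERIV_imp_deriv[OF weierstrass_second_derivative[OF W]] e that by auto
  have eq: "P z = P (w + (- 1) * (z - w))" if "z \<in> ball w e" for z
    by (rule weierstrass_extends_solution(2)[OF w(1) hol P'' _ _ refl _ that]) (use e w in auto)
  have "eventually (\<lambda>t. t \<in> ball 0 e) (at (0 :: complex))"
    using e by (intro eventually_at_in_open') auto
  then have "eventually (\<lambda>t. P (w + 1 * t) = P (w + (- 1) * t)) (at 0)"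
  proof eventually_elim
    case (elim t)
    have "w + t \<in> ball w e" using elim by (simp add: dist_norm)
    from eq[OF this] show ?case by simp
  qed
  from nicely_meromorphic_eqI(1)[OF nicely_meromorphic_affine(1)[OF weierstrass_nicely_meromorphic[OF W]]
      nicely_meromorphic_affine(1)[OF weierstrass_nicely_meromorphic[OF W]] open_UNIV connected_UNIV UNIV_I this UNIV_I]
  show ?thesis by simp
qed

lemma weierstrass_half_period:
  assumes w: "\<not> is_pole P w" "deriv P w = 0"
  shows "P (z + 2 * w) = P z"
proof -
  have "P (z + 2 * w) = P (w + (w + z))" by (simp add: algebra_simps)
  also have "\<dots> = P (w - (w + z))" by (rule weierstrass_reflection[OF w])
  also have "\<dots> = P z" using weierstrass_even(1)[OF W, of z] by simp
  finally show ?thesis .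
qed

lemma weierstrass_period_pole:
  assumes "\<And>z. P (z + w) = P z"
  shows "is_pole P w"
proof -
  have "(\<lambda>z. P (w + 1 * z)) = P"
    using assms by (simp add: add.commute)
  then have "is_pole P 0 \<longleftrightarrow> is_pole P (w + 1 * 0)"
    using nicely_meromorphic_affine(2)[OF weierstrass_nicely_meromorphic[OF W], of 1 w 0] by simp
  then show ?thesis using weierstrass_pole_0[OF W] by simp
qed

text \<open>Otherwise both are odd multiples of half a common generator of the periods on their line, and
  their difference is a period.\<close>

lemma weierstrass_half_periods_independent:
  assumes w1: "\<not> is_pole P w1" "deriv P w1 = 0" and w2: "\<not> is_pole P w2" "deriv P w2 = 0"
    and ne: "P w1 \<noteq> P w2"
  shows "w2 / w1 \<notin> \<real>"
proof
  assume "w2 / w1 \<in> \<real>"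
  have w1_0: "w1 \<noteq> 0" using w1 weierstrass_pole_0[OF W] by auto
  then obtain \<rho> where \<rho>: "w2 = of_real \<rho> * w1"
    using \<open>w2 / w1 \<in> \<real>\<close> by (auto elim!: Reals_cases simp: field_simps)
  \<comment> \<open>The periods on the real line through \<open>w1\<close>, measured in units of
    \<open>w1\<close>.\<close>
  define S where "S = {t :: real. \<forall>z. P (z + of_real t * w1) = P z}"
  have S0: "0 \<in> S" by (simp add: S_def)
  have S_diff: "t - u \<in> S" if "t \<in> S" "u \<in> S" for t u
    unfolding S_def
  proof (intro CollectI allI)
    fix z
    have "P (z + of_real (t - u) * w1) = P (z + of_real (t - u) * w1 + of_real u * w1)"
      using that by (simp add: S_def)
    also have "z + of_real (t - u) * w1 + of_real u * w1 = z + of_real t * w1"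
      by (simp add: algebra_simps)
    also have "P \<dots> = P z" using that by (simp add: S_def)
    finally show "P (z + of_real (t - u) * w1) = P z" .
  qed
  have S_add: "t + u \<in> S" if "t \<in> S" "u \<in> S" for t u
    using S_diff[OF that(1) S_diff[OF S0 that(2)]] by simp
  have S_nat: "of_nat n * t \<in> S" if "t \<in> S" for t n
    by (induction n) (auto simp: S0 distrib_right intro: S_add that)
  have S_int: "of_int k * t \<in> S" if "t \<in> S" for t k
  proof (cases "k \<ge> 0")
    case True
    then show ?thesis using S_nat[OF that, of "nat k"] by simp
  next
    case False
    then show ?thesis using S_diff[OF S0 S_nat[OF that, of "nat (- k)"]] by simp
  qed
  have pole: "is_pole P (of_real t * w1)" if "t \<in> S" for t
    by (rule weierstrass_period_pole) (use that in \<open>simp add: S_def\<close>)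
  obtain d0 where d0: "d0 > 0" "\<And>z. z \<noteq> 0 \<Longrightarrow> norm z < d0 \<Longrightarrow> \<not> is_pole P z"
    using weierstrass_isolated_pole by metis
  define d where "d = d0 / norm w1"
  have d: "d > 0" using d0 w1_0 by (simp add: d_def)
  \<comment> \<open>Periods are poles, and the pole at the origin is isolated.\<close>
  have gap: "d \<le> t" if "t \<in> S" "t > 0" for t
  proof (rule ccontr)
    assume "\<not> d \<le> t"
    then have "norm (of_real t * w1) < d0"
      using that w1_0 by (simp add: d_def norm_mult field_simps)
    then show False
      using d0(2)[of "of_real t * w1"] pole[OF that(1)] that w1_0 by auto
  qed
  have two: "2 \<in> S" "2 * \<rho> \<in> S"
    using weierstrass_half_period[OF w1] weierstrass_half_period[OF w2] by (simp_all add: S_def \<rho> mult.assoc)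
  \<comment> \<open>The first two would turn \<open>w1\<close> and \<open>w2\<close> into poles; the
    third would identify the values \<open>P w1\<close> and \<open>P w2\<close>.\<close>
  have notin: "1 \<notin> S" "\<rho> \<notin> S" "1 - \<rho> \<notin> S"
  proof -
    show "1 \<notin> S" using pole[of 1] w1 by auto
    show "\<rho> \<notin> S" using pole[of \<rho>] w2 by (auto simp: \<rho>)
    show "1 - \<rho> \<notin> S"
    proof
      assume "1 - \<rho> \<in> S"
      then have "P (w2 + of_real (1 - \<rho>) * w1) = P w2" by (simp add: S_def)
      moreover have "w2 + of_real (1 - \<rho>) * w1 = w1" by (simp add: \<rho> algebra_simps)
      ultimately show False using ne by simp
    qed
  qed
  \<comment> \<open>Distinct periods differ by at least \<open>d\<close>, so an element within
    \<open>d\<close> of the infimum is the least one.\<close>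
  define S' where "S' = {t \<in> S. t > 0}"
  have S': "S' \<noteq> {}" "bdd_below S'"
    using two by (auto simp: S'_def intro: bdd_belowI[of _ 0])
  have "Inf S' < Inf S' + d" using d by simp
  then obtain t where t: "t \<in> S'" "t < Inf S' + d"
    using cInf_less_iff[OF S'] by blast
  have tmin: "t \<le> u" if "u \<in> S'" for u
  proof (rule ccontr)
    assume "\<not> t \<le> u"
    then have "d \<le> t - u"
      using t that by (intro gap S_diff) (auto simp: S'_def)
    moreover have "Inf S' \<le> u" by (rule cInf_lower[OF that S'(2)])
    ultimately show False using t by linarith
  qed
  have t0: "t > 0" "t \<in> S" using t by (auto simp: S'_def)
  have mult: "\<exists>k. u = of_int k * t" if "u \<in> S" for u
  proof -
    \<comment> \<open>The remainder of \<open>u\<close> modulo \<open>t\<close> is a period below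
      the least positive one, hence 0.\<close>
    define v where "v = u - of_int \<lfloor>u / t\<rfloor> * t"
    have vS: "v \<in> S" unfolding v_def by (intro S_diff that S_int t0)
    have "of_int \<lfloor>u / t\<rfloor> * t \<le> u" "u < (of_int \<lfloor>u / t\<rfloor> + 1) * t"
      using t0 by (simp_all flip: pos_le_divide_eq pos_divide_less_eq)
    then have "0 \<le> v" "v < t"
      by (auto simp: v_def distrib_right)
    then have "v = 0"
      using tmin[of v] vS by (force simp: S'_def)
    then show ?thesis by (auto simp: v_def)
  qed
  obtain k l where k: "2 = of_int k * t" and l: "2 * \<rho> = of_int l * t"
    using mult two by metis
  have "odd k"
  proof
    assume "even k"
    then obtain j where "k = 2 * j" by blast
    with k have "1 = of_int j * t" by simp
    with S_int[OF t0(2), of j] notin show False by simp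
  qed
  moreover have "odd l"
  proof
    assume "even l"
    then obtain j where "l = 2 * j" by blast
    with l have "\<rho> = of_int j * t" by simp
    with S_int[OF t0(2), of j] notin show False by simp
  qed
  ultimately obtain j where "k - l = 2 * j"
    by (metis even_diff evenE odd_even_add even_add diff_conv_add_uminus even_minus)
  then have "of_int k - of_int l = 2 * (of_int j :: real)"
    by (metis of_int_diff of_int_mult of_int_numeral)
  then have "(of_int k - of_int l) * t = 2 * (of_int j * t)"
    by simp
  then have "1 - \<rho> = of_int j * t"
    using k l by (simp add: left_diff_distrib)
  with S_int[OF t0(2), of j] notin show False by simp
qed

text \<open>A double root \<open>x\<close> has \<open>g2 = 12 x^2\<close> and
  \<open>g3 = - 8 x^3\<close>, so the discriminant would vanish. Two distinct simple roots are then
  attained at places whose doubles are independent periods.\<close>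

theorem weierstrass_elliptic:
  assumes disc: "g2 ^ 3 - 27 * g3 ^ 2 \<noteq> 0"
  shows "elliptic_function P"
proof -
  have reg: "12 * x\<^sup>2 - g2 \<noteq> 0" if "wcubic g2 g3 x = 0" for x
  proof
    assume "12 * x\<^sup>2 - g2 = 0"
    then have g: "g2 = 12 * x\<^sup>2" by simp
    have "g3 = 4 * x ^ 3 - g2 * x"
      using that by (simp add: wcubic_def)
    then have "g3 = - 8 * x ^ 3"
      unfolding g by (simp add: power2_eq_square power3_eq_cube)
    with g disc show False
      by (simp add: power_mult_distrib flip: power_mult)
  qed
  have "\<not> constant (poly [:- g3, - g2, 0, 4:])"
    by (simp add: constant_degree)
  then obtain e1 where "poly [:- g3, - g2, 0, 4:] e1 = 0"
    using fundamental_theorem_of_algebra by blast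
  then have e1: "wcubic g2 g3 e1 = 0"
    by (simp add: wcubic_def power3_eq_cube algebra_simps)
  \<comment> \<open>Dividing the cubic by its root \<open>e1\<close> leaves the quadratic equation
    \<open>quad\<close> for the second root, solved here with a complex square root.\<close>
  define s where "s = csqrt (g2 - 3 * e1\<^sup>2)"
  have s: "s\<^sup>2 = g2 - 3 * e1\<^sup>2" by (simp add: s_def)
  define e2 where "e2 = (s - e1) / 2"
  have "4 * (e1\<^sup>2 + e1 * e2 + e2\<^sup>2) = s\<^sup>2 + 3 * e1\<^sup>2"
    by (simp add: e2_def field_simps power2_eq_square)
  then have quad: "4 * (e1\<^sup>2 + e1 * e2 + e2\<^sup>2) - g2 = 0"
    by (simp add: s)
  have "wcubic g2 g3 e2 = wcubic g2 g3 e1 + (e2 - e1) * (4 * (e1\<^sup>2 + e1 * e2 + e2\<^sup>2) - g2)"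
    by (simp add: wcubic_def power2_eq_square power3_eq_cube algebra_simps)
  then have e2: "wcubic g2 g3 e2 = 0"
    using e1 quad by simp
  have "e1 \<noteq> e2"
  proof
    assume "e1 = e2"
    then have "12 * e1\<^sup>2 - g2 = 0"
      using quad by (simp add: power2_eq_square)
    with reg[OF e1] show False by simp
  qed
  obtain w1 where w1: "\<not> is_pole P w1" "P w1 = e1" "deriv P w1 = 0"
    using weierstrass_attains[of 0 e1] e1 reg by auto
  obtain w2 where w2: "\<not> is_pole P w2" "P w2 = e2" "deriv P w2 = 0"
    using weierstrass_attains[of 0 e2] e2 reg by auto
  have "w2 / w1 \<notin> \<real>"
    using weierstrass_half_periods_independent[OF w1(1,3) w2(1,3)] w1 w2 \<open>e1 \<noteq> e2\<close> by simp
  moreover have "w1 \<noteq> 0" using w1 weierstrass_pole_0[OF W] by auto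
  ultimately show ?thesis
    unfolding elliptic_function_def
    using weierstrass_nicely_meromorphic[OF W] weierstrass_half_period[OF w1(1,3)] weierstrass_half_period[OF w2(1,3)]
    by (intro conjI exI[of _ "2 * w1"] exI[of _ "2 * w2"]) auto
qed

end

section \<open>Integral curves\<close>

text \<open>\<open>\<phi>\<close> embeds real or complex time isometrically. The set
  \<open>E\<close> of times at which the curve agrees with the translate of \<open>P\<close> is open
  by local uniqueness, and so is the complement within \<open>T\<close>; connectedness of
  \<open>T\<close> concludes.\<close>

lemma weierstrass_integral_curve:
  fixes \<phi> :: "'a :: real_normed_vector \<Rightarrow> complex"
  assumes W: "is_weierstrass g2 g3 P"
    and \<phi>: "bounded_linear \<phi>" "\<And>h. norm (\<phi> h) = norm h"
    and T: "open T" "connected T"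
    and u: "\<And>t. t \<in> T \<Longrightarrow> (u has_derivative (\<lambda>h. \<phi> h * v t)) (at t)"
    and v: "\<And>t. t \<in> T \<Longrightarrow> (v has_derivative (\<lambda>h. \<phi> h * (6 * u t ^ 2 - g2 / 2))) (at t)"
    and t1: "t1 \<in> T" "v t1 ^ 2 = wcubic g2 g3 (u t1)" "v t1 \<noteq> 0 \<or> 12 * u t1 ^ 2 - g2 \<noteq> 0"
  obtains t0 where "\<And>t. t \<in> T \<Longrightarrow> \<not> is_pole P (\<phi> t - t0) \<and> u t = P (\<phi> t - t0) \<and> v t = deriv P (\<phi> t - t0)"
proof -
  obtain z1 where z1: "\<not> is_pole P z1" "P z1 = u t1" "deriv P z1 = v t1"
    using weierstrass_attains[OF W t1(2,3)] by metis
  define t0 where "t0 = \<phi> t1 - z1"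
  define E where "E = {t. \<not> is_pole P (\<phi> t - t0) \<and> u t = P (\<phi> t - t0) \<and> v t = deriv P (\<phi> t - t0)}"
  define S where "S = T \<inter> (\<lambda>t. \<phi> t - t0) -` {z. \<not> is_pole P z}"
  have c\<phi>: "continuous_on UNIV (\<lambda>t. \<phi> t - t0)"
    by (intro continuous_intros linear_continuous_on[OF \<phi>(1)])
  have S: "open S"
    unfolding S_def using continuous_open_vimage[OF weierstrass_open_nonpoles[OF W]] c\<phi>
    by (intro open_Int T) (auto simp: continuous_on_eq_continuous_at)
  have d\<phi>: "((\<lambda>t. \<phi> t - t0) has_derivative \<phi>) (at t)" for t
    by (auto intro!: derivative_eq_intros bounded_linear_imp_has_derivative[OF \<phi>(1)])
  have dP: "((\<lambda>t. P (\<phi> t - t0)) has_derivative (\<lambda>h. \<phi> h * deriv P (\<phi> t - t0))) (at t)"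
    "((\<lambda>t. deriv P (\<phi> t - t0)) has_derivative (\<lambda>h. \<phi> h * (6 * P (\<phi> t - t0) ^ 2 - g2 / 2))) (at t)"
    if "\<not> is_pole P (\<phi> t - t0)" for t
    using has_derivative_compose[OF d\<phi> weierstrass_derivative[OF W that, unfolded has_field_derivative_def]]
      has_derivative_compose[OF d\<phi> weierstrass_second_derivative[OF W that, unfolded has_field_derivative_def]]
    by (simp_all add: mult.commute)
  have inner: "\<exists>e>0. ball t e \<subseteq> E" if t: "t \<in> T \<inter> E" for t
  proof -
    have tS: "t \<in> S" using t by (auto simp: S_def E_def)
    obtain e where e: "e > 0" "ball t e \<subseteq> S"
      "\<And>s. s \<in> ball t e \<Longrightarrow> u s = P (\<phi> s - t0) \<and> v s = deriv P (\<phi> s - t0)"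
    proof -
      have "\<exists>e>0. ball t e \<subseteq> S \<and> (\<forall>s\<in>ball t e. u s = P (\<phi> s - t0) \<and> v s = deriv P (\<phi> s - t0))"
      proof (rule second_order_unique_local[where p = "\<lambda>x. 6 * x ^ 2 - g2 / 2" and \<phi> = \<phi>, OF _ _ S tS])
        show "(\<lambda>x. 6 * x ^ 2 - g2 / 2) holomorphic_on UNIV"
          by (intro holomorphic_intros) auto
      qed (use t \<phi>(2) u v dP in \<open>auto simp: S_def E_def\<close>)
      then show thesis using that by blast
    qed
    have "ball t e \<subseteq> E"
      using e(2,3) by (auto simp: E_def S_def)
    with e(1) show ?thesis by blast
  qed
  have outer: "eventually (\<lambda>s. s \<notin> E) (nhds t)" if t: "t \<in> T" "t \<notin> E" for t
  proof -
    have cu: "isCont u t" "isCont v t"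
      using u[OF t(1)] v[OF t(1)] has_derivative_continuous by blast+
    \<comment> \<open>The isometry makes \<open>\<phi>\<close> injective, so times other than
      \<open>t\<close> do not reach the possible pole.\<close>
    have c: "filterlim (\<lambda>s. \<phi> s - t0) (at (\<phi> t - t0)) (at t)"
    proof (rule filterlim_atI)
      show "((\<lambda>s. \<phi> s - t0) \<longlongrightarrow> \<phi> t - t0) (at t)"
        using d\<phi>[THEN has_derivative_continuous] by (simp add: isCont_def)
      have "\<phi> s - t0 \<noteq> \<phi> t - t0" if "s \<noteq> t" for s
        using that \<phi>(2)[of "s - t"] by (auto simp: linear_diff[OF bounded_linear.linear[OF \<phi>(1)]])
      then show "eventually (\<lambda>s. \<phi> s - t0 \<noteq> \<phi> t - t0) (at t)"
        by (auto simp: eventually_at_filter)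
    qed
    have "eventually (\<lambda>s. s \<notin> E) (at t)"
    proof (cases "is_pole P (\<phi> t - t0)")
      case True
      \<comment> \<open>Near a pole \<open>P\<close> is unbounded while \<open>u\<close> is
        continuous, so the curve cannot agree with \<open>P\<close> at nearby times.\<close>
      have "filterlim (\<lambda>s. P (\<phi> s - t0)) at_infinity (at t)"
        using True unfolding is_pole_def by (rule filterlim_compose[OF _ c])
      then have "eventually (\<lambda>s. norm (P (\<phi> s - t0)) \<ge> norm (u t) + 1) (at t)"
        using add_nonneg_pos[OF norm_ge_zero[of "u t"] zero_less_one]
        by (simp only: filterlim_at_infinity[OF order_refl])
      moreover have "eventually (\<lambda>s. dist (u s) (u t) < 1) (at t)"
        using cu(1) tendstoD[of u "u t" "at t" 1] by (simp add: isCont_def)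
      ultimately show ?thesis
      proof eventually_elim
        case (elim s)
        have "norm (u s) < norm (u t) + 1"
          using elim(2) norm_triangle_ineq2[of "u s" "u t"] by (simp add: dist_norm)
        with elim(1) show ?case by (auto simp: E_def)
      qed
    next
      case False
      have cP: "((\<lambda>s. u s - P (\<phi> s - t0)) \<longlongrightarrow> u t - P (\<phi> t - t0)) (at t)"
        "((\<lambda>s. v s - deriv P (\<phi> s - t0)) \<longlongrightarrow> v t - deriv P (\<phi> t - t0)) (at t)"
        using cu dP[OF False, THEN has_derivative_continuous]
        by (auto simp: isCont_def intro!: tendsto_diff)
      consider "u t - P (\<phi> t - t0) \<noteq> 0" | "v t - deriv P (\<phi> t - t0) \<noteq> 0"
        using t(2) False by (auto simp: E_def)
      then show ?thesis
      proof cases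
        case 1
        from tendsto_imp_eventually_ne[OF cP(1) 1] show ?thesis
          by eventually_elim (auto simp: E_def)
      next
        case 2
        from tendsto_imp_eventually_ne[OF cP(2) 2] show ?thesis
          by eventually_elim (auto simp: E_def)
      qed
    qed
    then show ?thesis
      using t by (simp add: eventually_nhds_conv_at)
  qed
  have "T \<subseteq> interior E \<union> interior (- E)"
  proof
    fix t assume t: "t \<in> T"
    show "t \<in> interior E \<union> interior (- E)"
    proof (cases "t \<in> E")
      case True
      with t inner[of t] show ?thesis by (auto simp: mem_interior)
    next
      case False
      then show ?thesis
        using outer[OF t] by (auto simp: mem_interior eventually_nhds_metric dist_commute subset_iff)
    qed
  qed
  moreover have "interior E \<inter> interior (- E) \<inter> T = {}"
    using interior_subset[of E] interior_subset[of "- E"] by auto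
  ultimately have "interior E \<inter> T = {} \<or> interior (- E) \<inter> T = {}"
    by (intro connectedD[OF T(2)]) auto
  moreover have "t1 \<in> E"
    using z1 by (simp add: E_def t0_def)
  then have "t1 \<in> interior E \<inter> T"
    using inner[of t1] t1(1) by (auto simp: mem_interior)
  ultimately have "T \<subseteq> E"
    using \<open>T \<subseteq> interior E \<union> interior (- E)\<close> interior_subset[of E] by blast
  then show thesis
    by (intro that[of t0]) (auto simp: E_def)
qed

text \<open>The affine substitution that takes the system to \<open>u' = v\<close>, \<open>v' = 6 u\<^sup>2 - g2 / 2\<close>.\<close>

lemma wcubic_energy:
  fixes b c :: real and x y h :: complex
  assumes "c \<noteq> 0"
  defines "u \<equiv> - of_real (c / 6) * (x + of_real (3 * b / (4 * c)))" and "v \<equiv> - of_real (c / 6) * y"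
  shows "v ^ 2 = wcubic (inv_g2 b) (inv_g3 b c h) u \<longleftrightarrow> ham (of_real b) (of_real c) (x, y) = h"
    and "6 * u ^ 2 - inv_g2 b / 2 = - of_real (c / 6) * (- (3 / 2) * of_real b * x - of_real c * x ^ 2)"
    and "x = - of_real (6 / c) * u - of_real (3 * b / (4 * c))" "y = - of_real (6 / c) * v"
proof -
  define B C where "B = complex_of_real b" and "C = complex_of_real c"
  have C: "C \<noteq> 0" using assms by (simp add: C_def)
  have u: "u = - (C * x / 6 + B / 8)" and v: "v = - (C * y / 6)"
    using C by (simp_all add: u_def v_def B_def[symmetric] C_def[symmetric] field_simps)
  \<comment> \<open>The factor is forced by the kinetic term: \<open>v^2\<close> is
    \<open>C^2 / 36\<close> times \<open>y^2\<close>, that is \<open>C^2 / 18\<close> times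
    \<open>y^2 / 2\<close>.\<close>
  have e: "v ^ 2 - wcubic (inv_g2 b) (inv_g3 b c h) u = C ^ 2 / 18 * (ham B C (x, y) - h)"
    by (simp add: wcubic_def inv_g2_def inv_g3_def ham_def u v flip: B_def C_def)
      (simp add: field_simps power2_eq_square power3_eq_cube)
  have "v ^ 2 - wcubic (inv_g2 b) (inv_g3 b c h) u = 0 \<longleftrightarrow> ham B C (x, y) - h = 0"
    unfolding e using C by simp
  then show "v ^ 2 = wcubic (inv_g2 b) (inv_g3 b c h) u \<longleftrightarrow> ham (of_real b) (of_real c) (x, y) = h"
    by (simp only: right_minus_eq B_def C_def)
  show "6 * u ^ 2 - inv_g2 b / 2 = - of_real (c / 6) * (- (3 / 2) * of_real b * x - of_real c * x ^ 2)"
    by (simp add: inv_g2_def u flip: B_def C_def) (simp add: field_simps power2_eq_square)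
  show "x = - of_real (6 / c) * u - of_real (3 * b / (4 * c))" "y = - of_real (6 / c) * v"
    using C by (simp_all add: u v flip: B_def C_def) (simp_all add: field_simps)
qed

lemma energy_weierstrass_facts:
  shows "is_weierstrass (inv_g2 b) (inv_g3 b c h) (energy_weierstrass b c h)"
    and "inv_g2 b ^ 3 - 27 * inv_g3 b c h ^ 2 \<noteq> 0 \<Longrightarrow> elliptic_function (energy_weierstrass b c h)"
proof -
  obtain P where P: "is_weierstrass (inv_g2 b) (inv_g3 b c h) P"
    using is_weierstrass_exists by blast
  show W: "is_weierstrass (inv_g2 b) (inv_g3 b c h) (energy_weierstrass b c h)"
    using P by (simp only: weierstrass_eq[OF P])
  show "elliptic_function (energy_weierstrass b c h)" if "inv_g2 b ^ 3 - 27 * inv_g3 b c h ^ 2 \<noteq> 0"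
    by (rule weierstrass_elliptic[OF W that])
qed

text \<open>Under the substitution, energy \<open>h\<close> is the first-order Weierstrass equation
  with \<open>inv_g3 b c h\<close>, and the system is its second-order consequence.\<close>

lemma weierstrass_curve_integral_curve:
  fixes b c :: real
  assumes c: "c \<noteq> 0"
  shows "integral_curve_on (vfield (complex_of_real b) (complex_of_real c) (- 4))
      {t. \<not> is_pole (energy_weierstrass b c h) (t - t0)} (weierstrass_curve b c h t0)"
    and "\<not> is_pole (energy_weierstrass b c h) (t - t0) \<Longrightarrow>
      ham (complex_of_real b) (complex_of_real c) (weierstrass_curve b c h t0 t) = h"
proof -
  let ?P = "energy_weierstrass b c h"
  note W = energy_weierstrass_facts(1)[of b c h]
  define x y where "x t = - complex_of_real (6 / c) * ?P (t - t0) - complex_of_real (3 * b / (4 * c))"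
    and "y t = - complex_of_real (6 / c) * deriv ?P (t - t0)" for t
  have xy: "weierstrass_curve b c h t0 = (\<lambda>t. (x t, y t))"
    by (simp add: weierstrass_curve_def x_def y_def)
  have u: "- of_real (c / 6) * (x t + of_real (3 * b / (4 * c))) = ?P (t - t0)"
    "- of_real (c / 6) * y t = deriv ?P (t - t0)" for t
    using c by (simp_all add: x_def y_def)
  note e1 = wcubic_energy(1)[OF c, where b = b and x = "x t" and y = "y t" and h = h for t, unfolded u]
    and e2 = wcubic_energy(2)[OF c, where b = b and x = "x t" for t, unfolded u]
  show "ham (complex_of_real b) (complex_of_real c) (weierstrass_curve b c h t0 t) = h"
    if "\<not> is_pole ?P (t - t0)"
    using e1[of t] weierstrass_ode[OF W that] by (simp add: xy)
  have shift: "((\<lambda>t. t - t0) has_field_derivative 1) (at t)" for t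
    by (auto intro!: derivative_eq_intros)
  have "(x has_field_derivative y t) (at t)"
    "(y has_field_derivative - (3 / 2) * of_real b * x t - of_real c * x t ^ 2) (at t)"
    if np: "\<not> is_pole ?P (t - t0)" for t
  proof -
    have P: "((\<lambda>t. ?P (t - t0)) has_field_derivative deriv ?P (t - t0)) (at t)"
      "((\<lambda>t. deriv ?P (t - t0)) has_field_derivative 6 * ?P (t - t0) ^ 2 - inv_g2 b / 2) (at t)"
      using DERIV_chain2[OF weierstrass_derivative[OF W np] shift]
        DERIV_chain2[OF weierstrass_second_derivative[OF W np] shift] by simp_all
    show "(x has_field_derivative y t) (at t)"
      unfolding x_def[abs_def] y_def using P(1) c by (auto intro!: derivative_eq_intros)
    have "(y has_field_derivative - complex_of_real (6 / c) * (6 * ?P (t - t0) ^ 2 - inv_g2 b / 2)) (at t)"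
      unfolding y_def[abs_def] by (rule DERIV_cmult[OF P(2)])
    also have "- complex_of_real (6 / c) * (6 * ?P (t - t0) ^ 2 - inv_g2 b / 2)
        = - (3 / 2) * of_real b * x t - of_real c * x t ^ 2"
    proof -
      have "- complex_of_real (6 / c) * (- complex_of_real (c / 6) * w) = w" for w
        using c by simp
      then show ?thesis
        unfolding e2[of t] .
    qed
    finally show "(y has_field_derivative - (3 / 2) * of_real b * x t - of_real c * x t ^ 2) (at t)" .
  qed
  then show "integral_curve_on (vfield (complex_of_real b) (complex_of_real c) (- 4))
      {t. \<not> is_pole ?P (t - t0)} (weierstrass_curve b c h t0)"
    by (auto simp: integral_curve_on_def xy vfield_neg4)
qed

lemma integral_curve_weierstrass:
  fixes b c :: real and \<phi> :: "'a :: real_normed_vector \<Rightarrow> complex"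
  assumes c: "c \<noteq> 0"
    and \<phi>: "bounded_linear \<phi>" "\<And>s. norm (\<phi> s) = norm s"
    and T: "open T" "connected T"
    and x: "\<And>t. t \<in> T \<Longrightarrow> (x has_derivative (\<lambda>s. \<phi> s * y t)) (at t)"
    and y: "\<And>t. t \<in> T \<Longrightarrow>
      (y has_derivative (\<lambda>s. \<phi> s * (- (3 / 2) * of_real b * x t - of_real c * x t ^ 2))) (at t)"
    and t1: "t1 \<in> T" "ham (of_real b) (of_real c) (x t1, y t1) = h"
      "y t1 \<noteq> 0 \<or> - (3 / 2) * of_real b * x t1 - of_real c * x t1 ^ 2 \<noteq> 0"
  obtains t0 where "\<And>t. t \<in> T \<Longrightarrow> \<not> is_pole (energy_weierstrass b c h) (\<phi> t - t0) \<and>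
      (x t, y t) = weierstrass_curve b c h t0 (\<phi> t)"
proof -
  let ?P = "energy_weierstrass b c h"
  note W = energy_weierstrass_facts(1)[of b c h]
  define u v where "u t = - complex_of_real (c / 6) * (x t + of_real (3 * b / (4 * c)))"
    and "v t = - complex_of_real (c / 6) * y t" for t
  note e1 = wcubic_energy(1)[OF c, where b = b and x = "x t" and y = "y t" and h = h for t, folded u_def v_def]
    and e2 = wcubic_energy(2)[OF c, where b = b and x = "x t" for t, folded u_def]
    and e3 = wcubic_energy(3)[OF c, where b = b and x = "x t" for t, folded u_def]
    and e4 = wcubic_energy(4)[OF c, where y = "y t" for t, folded v_def]
  have u: "(u has_derivative (\<lambda>s. \<phi> s * v t)) (at t)" if "t \<in> T" for t
    unfolding u_def[abs_def] v_def using x[OF that]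
    by (auto intro!: derivative_eq_intros simp: mult.left_commute)
  have v: "(v has_derivative (\<lambda>s. \<phi> s * (6 * u t ^ 2 - inv_g2 b / 2))) (at t)" if "t \<in> T" for t
    unfolding e2[of t] unfolding v_def[abs_def]
    using has_derivative_mult_right[OF y[OF that], of "- complex_of_real (c / 6)"]
    by (simp add: mult.left_commute)
  have init: "v t1 ^ 2 = wcubic (inv_g2 b) (inv_g3 b c h) (u t1)"
    using e1[of t1] t1(2) by simp
  \<comment> \<open>Up to a nonzero factor the force is the derivative of the cubic at
    \<open>u t1\<close>; a point that is not an equilibrium is thus not a double root with velocity
    0.\<close>
  have reg: "v t1 \<noteq> 0 \<or> 12 * u t1 ^ 2 - inv_g2 b \<noteq> 0"
  proof (cases "y t1 = 0")
    case True
    then have "6 * u t1 ^ 2 - inv_g2 b / 2 \<noteq> 0"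
      using t1(3) c unfolding e2[of t1] by auto
    moreover have "12 * u t1 ^ 2 - inv_g2 b = 2 * (6 * u t1 ^ 2 - inv_g2 b / 2)"
      by simp
    ultimately show ?thesis by simp
  qed (use c in \<open>simp add: v_def\<close>)
  obtain t0 where t0: "\<And>t. t \<in> T \<Longrightarrow> \<not> is_pole ?P (\<phi> t - t0) \<and> u t = ?P (\<phi> t - t0) \<and>
      v t = deriv ?P (\<phi> t - t0)"
  proof (rule weierstrass_integral_curve[OF W \<phi> T u v t1(1) init reg])
    fix t0
    assume "\<And>t. t \<in> T \<Longrightarrow> \<not> is_pole ?P (\<phi> t - t0) \<and> u t = ?P (\<phi> t - t0) \<and>
      v t = deriv ?P (\<phi> t - t0)"
    then show thesis by (rule that)
  qed
  show thesis
    by (rule that[of t0])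
      (use t0 e3 e4 in \<open>simp add: weierstrass_curve_def\<close>)
qed

lemma complex_integral_curve_weierstrass:
  fixes b c :: real
  assumes c: "c \<noteq> 0" and T: "open T" "connected T"
    and \<gamma>: "integral_curve_on (vfield (complex_of_real b) (complex_of_real c) (- 4)) T \<gamma>"
    and t1: "t1 \<in> T" "ham (complex_of_real b) (complex_of_real c) (\<gamma> t1) = h"
      "vfield (complex_of_real b) (complex_of_real c) (- 4) (\<gamma> t1) \<noteq> (0, 0)"
  shows "\<exists>t0. \<forall>t\<in>T. \<not> is_pole (energy_weierstrass b c h) (t - t0) \<and> \<gamma> t = weierstrass_curve b c h t0 t"
proof -
  define x y where "x t = fst (\<gamma> t)" and "y t = snd (\<gamma> t)" for t
  have \<gamma>_eq: "\<gamma> t = (x t, y t)" for t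
    by (simp add: x_def y_def)
  have "(x has_field_derivative y t) (at t)"
    "(y has_field_derivative - (3 / 2) * of_real b * x t - of_real c * x t ^ 2) (at t)" if "t \<in> T" for t
    using \<gamma> that unfolding integral_curve_on_def \<gamma>_eq vfield_neg4 by (simp_all add: \<gamma>_eq)
  then have d: "(x has_derivative (\<lambda>s. s * y t)) (at t)"
    "(y has_derivative (\<lambda>s. s * (- (3 / 2) * of_real b * x t - of_real c * x t ^ 2))) (at t)" if "t \<in> T" for t
    using that unfolding has_field_derivative_def
    by (simp_all only: mult.commute[of _ "y t"]
        mult.commute[of _ "- (3 / 2) * of_real b * x t - of_real c * x t ^ 2"])
  have h: "ham (of_real b) (of_real c) (x t1, y t1) = h"
    using t1(2) by (simp only: \<gamma>_eq)
  have reg: "y t1 \<noteq> 0 \<or> - (3 / 2) * of_real b * x t1 - of_real c * x t1 ^ 2 \<noteq> 0"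
    using t1(3) by (simp only: \<gamma>_eq vfield_neg4 prod.inject de_Morgan_conj)
  show ?thesis
  proof (rule integral_curve_weierstrass[OF c bounded_linear_ident refl T d t1(1) h reg])
    fix t0
    assume "\<And>t. t \<in> T \<Longrightarrow> \<not> is_pole (energy_weierstrass b c h) (t - t0) \<and>
      (x t, y t) = weierstrass_curve b c h t0 t"
    then show ?thesis
      unfolding \<gamma>_eq by blast
  qed
qed

text \<open>The shift \<open>t0\<close> has to be complex: a curve that exists for all real times
  cannot have a real shift, because the time \<open>t0\<close> would be a pole.\<close>

lemma real_integral_curve_weierstrass:
  fixes b c h :: real
  assumes c: "c \<noteq> 0" and T: "open T" "connected T"
    and \<gamma>: "integral_curve_on (vfield b c (- 4)) T \<gamma>"
    and t1: "t1 \<in> T" "ham b c (\<gamma> t1) = h" "vfield b c (- 4) (\<gamma> t1) \<noteq> (0, 0)"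
  shows "\<exists>t0. \<forall>t\<in>T. \<not> is_pole (energy_weierstrass b c (complex_of_real h)) (complex_of_real t - t0) \<and>
      (complex_of_real (fst (\<gamma> t)), complex_of_real (snd (\<gamma> t)))
        = weierstrass_curve b c (complex_of_real h) t0 (complex_of_real t)"
proof -
  define x y where "x t = fst (\<gamma> t)" and "y t = snd (\<gamma> t)" for t
  have \<gamma>_eq: "\<gamma> t = (x t, y t)" for t
    by (simp add: x_def y_def)
  have dx: "(x has_field_derivative y t) (at t)"
    and dy: "(y has_field_derivative - (3 / 2) * b * x t - c * x t ^ 2) (at t)" if "t \<in> T" for t
    using \<gamma> that unfolding integral_curve_on_def \<gamma>_eq vfield_neg4 by (simp_all add: \<gamma>_eq)
  have lift: "((\<lambda>t. complex_of_real (z t)) has_derivative (\<lambda>s. complex_of_real s * complex_of_real z')) (at t)"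
    if "(z has_field_derivative z') (at t)" for z z' t
    using has_derivative_of_real[OF that[unfolded has_field_derivative_def]]
    by (simp add: mult.commute)
  have d: "((\<lambda>t. complex_of_real (x t)) has_derivative (\<lambda>s. complex_of_real s * complex_of_real (y t))) (at t)"
    "((\<lambda>t. complex_of_real (y t)) has_derivative (\<lambda>s. complex_of_real s *
      (- (3 / 2) * of_real b * complex_of_real (x t) - of_real c * complex_of_real (x t) ^ 2))) (at t)"
    if "t \<in> T" for t
    using lift[OF dx[OF that]] lift[OF dy[OF that]] by simp_all
  have h: "ham (of_real b) (of_real c) (complex_of_real (x t1), complex_of_real (y t1)) = complex_of_real h"
    unfolding t1(2)[symmetric] \<gamma>_eq by (simp add: ham_def)
  have reg: "complex_of_real (y t1) \<noteq> 0 \<or>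
      - (3 / 2) * of_real b * complex_of_real (x t1) - of_real c * complex_of_real (x t1) ^ 2 \<noteq> 0"
  proof -
    have "y t1 \<noteq> 0 \<or> - (3 / 2) * b * x t1 - c * x t1 ^ 2 \<noteq> 0"
      using t1(3) unfolding \<gamma>_eq vfield_neg4 by auto
    moreover have "- (3 / 2) * of_real b * complex_of_real (x t1) - of_real c * complex_of_real (x t1) ^ 2
        = complex_of_real (- (3 / 2) * b * x t1 - c * x t1 ^ 2)"
      by simp
    ultimately show ?thesis
      unfolding of_real_eq_0_iff by (simp only: of_real_eq_0_iff)
  qed
  show ?thesis
  proof (rule integral_curve_weierstrass[OF c bounded_linear_of_real _ T d t1(1) h reg])
    show "norm (complex_of_real s) = norm s" for s
      by simp
    fix t0
    assume "\<And>t. t \<in> T \<Longrightarrow>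
      \<not> is_pole (energy_weierstrass b c (complex_of_real h)) (complex_of_real t - t0) \<and>
      (complex_of_real (x t), complex_of_real (y t))
        = weierstrass_curve b c (complex_of_real h) t0 (complex_of_real t)"
    then show ?thesis
      unfolding \<gamma>_eq fst_conv snd_conv by blast
  qed
qed

theorem theorem8p5:
  fixes b c :: real
  assumes "c \<noteq> 0"
  shows
    \<comment> \<open>(1), over the reals and complexified\<close>
    "((\<forall>x y. vfield b c (- 4) (x, y) = (y, - (3 / 2) * b * x - c * x ^ 2)) \<and>
      hamiltonian_system (ham b c) (vfield b c (- 4)) \<and>
      polynomial_in_two_variables (ham b c) \<and>
      first_integral (ham b c) (vfield b c (- 4)) \<and>
      hamiltonian_system (ham (complex_of_real b) (complex_of_real c))
        (vfield (complex_of_real b) (complex_of_real c) (- 4)) \<and>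
      polynomial_in_two_variables (ham (complex_of_real b) (complex_of_real c)) \<and>
      first_integral (ham (complex_of_real b) (complex_of_real c))
        (vfield (complex_of_real b) (complex_of_real c) (- 4)))
     \<and>
     \<comment> \<open>(2)\<close>
     ((\<forall>h. is_weierstrass (inv_g2 b) (inv_g3 b c h) (energy_weierstrass b c h) \<and>
           (inv_g2 b ^ 3 - 27 * inv_g3 b c h ^ 2 \<noteq> 0 \<longrightarrow>
              elliptic_function (energy_weierstrass b c h))) \<and>
      (\<forall>h t0. integral_curve_on (vfield (complex_of_real b) (complex_of_real c) (- 4))
                {t. \<not> is_pole (energy_weierstrass b c h) (t - t0)} (weierstrass_curve b c h t0) \<and>
              (\<forall>t. \<not> is_pole (energy_weierstrass b c h) (t - t0) \<longrightarrow>
                 ham (complex_of_real b) (complex_of_real c) (weierstrass_curve b c h t0 t) = h)) \<and>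
      (\<forall>h T \<gamma>. open T \<longrightarrow> connected T \<longrightarrow>
         integral_curve_on (vfield (complex_of_real b) (complex_of_real c) (- 4)) T \<gamma> \<longrightarrow>
         (\<exists>t\<in>T. ham (complex_of_real b) (complex_of_real c) (\<gamma> t) = h \<and>
                vfield (complex_of_real b) (complex_of_real c) (- 4) (\<gamma> t) \<noteq> (0, 0)) \<longrightarrow>
         (\<exists>t0. \<forall>t\<in>T. \<not> is_pole (energy_weierstrass b c h) (t - t0) \<and>
                     \<gamma> t = weierstrass_curve b c h t0 t)) \<and>
      (\<forall>h T \<gamma>. open T \<longrightarrow> connected T \<longrightarrow> integral_curve_on (vfield b c (- 4)) T \<gamma> \<longrightarrow>
         (\<exists>t\<in>T. ham b c (\<gamma> t) = h \<and> vfield b c (- 4) (\<gamma> t) \<noteq> (0, 0)) \<longrightarrow>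
         (\<exists>t0. \<forall>t\<in>T.
            \<not> is_pole (energy_weierstrass b c (complex_of_real h)) (complex_of_real t - t0) \<and>
            (complex_of_real (fst (\<gamma> t)), complex_of_real (snd (\<gamma> t)))
              = weierstrass_curve b c (complex_of_real h) t0 (complex_of_real t))))
     \<and>
     \<comment> \<open>(3)\<close>
     (\<forall>h. (\<exists>\<iota> (L :: complex fls set).
             foliation_extension (complex_of_real b) (complex_of_real c) (- 4) h \<iota> fls_deriv L) \<and>
          (\<forall>\<iota> D (L :: 'l::field set).
             foliation_extension (complex_of_real b) (complex_of_real c) (- 4) h \<iota> D L \<longrightarrow>
             DGal D (range \<iota>) L \<cong> integer_mod_group 2))
     \<and>
     \<comment> \<open>(4)\<close>
     (\<forall>T \<gamma> t0 K A.
        open T \<longrightarrow> connected T \<longrightarrow> t0 \<in> T \<longrightarrow>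
        integral_curve_on (vfield (complex_of_real b) (complex_of_real c) (- 4)) T \<gamma> \<longrightarrow>
        K = solution_field \<gamma> t0 \<longrightarrow>
        A = variational_matrix (vfield (complex_of_real b) (complex_of_real c) (- 4)) \<gamma> t0 \<longrightarrow>
        (\<exists>L \<Phi>. picard_vessiot_linear fls_deriv K L A \<Phi>) \<and>
        (\<forall>\<iota> D (L :: 'l set) \<Phi>.
           differential_embedding \<iota> fls_deriv K D L \<longrightarrow>
           picard_vessiot_linear D (\<iota> ` K) L (map_matrix \<iota> A) \<Phi> \<longrightarrow>
           subgroup (identity_component D (\<iota> ` K) L \<Phi>) (DGal D (\<iota> ` K) L) \<and>
           comm_group ((DGal D (\<iota> ` K) L)
             \<lparr>carrier := identity_component D (\<iota> ` K) L \<Phi>\<rparr>)))"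
proof (intro conjI allI impI)
  show "vfield b c (- 4) (x, y) = (y, - (3 / 2) * b * x - c * x ^ 2)" for x y
    by (rule vfield_neg4)
  show "hamiltonian_system (ham b c) (vfield b c (- 4))"
    "hamiltonian_system (ham (complex_of_real b) (complex_of_real c))
      (vfield (complex_of_real b) (complex_of_real c) (- 4))"
    by (rule hamiltonian_system_ham)+
  show "polynomial_in_two_variables (ham b c)"
    "polynomial_in_two_variables (ham (complex_of_real b) (complex_of_real c))"
    by (rule polynomial_ham)+
  show "first_integral (ham b c) (vfield b c (- 4))"
    "first_integral (ham (complex_of_real b) (complex_of_real c))
      (vfield (complex_of_real b) (complex_of_real c) (- 4))"
    by (rule first_integral_ham)+
next
  fix h
  show "is_weierstrass (inv_g2 b) (inv_g3 b c h) (energy_weierstrass b c h)"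
    by (rule energy_weierstrass_facts)
  show "elliptic_function (energy_weierstrass b c h)"
    if "inv_g2 b ^ 3 - 27 * inv_g3 b c h ^ 2 \<noteq> 0"
    using that by (rule energy_weierstrass_facts)
next
  fix h t0
  show "integral_curve_on (vfield (complex_of_real b) (complex_of_real c) (- 4))
      {t. \<not> is_pole (energy_weierstrass b c h) (t - t0)} (weierstrass_curve b c h t0)"
    by (rule weierstrass_curve_integral_curve(1)[OF assms])
  show "ham (complex_of_real b) (complex_of_real c) (weierstrass_curve b c h t0 t) = h"
    if "\<not> is_pole (energy_weierstrass b c h) (t - t0)" for t
    by (rule weierstrass_curve_integral_curve(2)[OF assms that])
next
  fix h T \<gamma>
  assume "open T" "connected T"
    "integral_curve_on (vfield (complex_of_real b) (complex_of_real c) (- 4)) T \<gamma>"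
    "\<exists>t\<in>T. ham (complex_of_real b) (complex_of_real c) (\<gamma> t) = h \<and>
      vfield (complex_of_real b) (complex_of_real c) (- 4) (\<gamma> t) \<noteq> (0, 0)"
  then show "\<exists>t0. \<forall>t\<in>T. \<not> is_pole (energy_weierstrass b c h) (t - t0) \<and>
      \<gamma> t = weierstrass_curve b c h t0 t"
    using complex_integral_curve_weierstrass[OF assms] by blast
next
  fix h T \<gamma>
  assume "open T" "connected T" "integral_curve_on (vfield b c (- 4)) T \<gamma>"
    "\<exists>t\<in>T. ham b c (\<gamma> t) = h \<and> vfield b c (- 4) (\<gamma> t) \<noteq> (0, 0)"
  then show "\<exists>t0. \<forall>t\<in>T.
      \<not> is_pole (energy_weierstrass b c (complex_of_real h)) (complex_of_real t - t0) \<and>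
      (complex_of_real (fst (\<gamma> t)), complex_of_real (snd (\<gamma> t)))
        = weierstrass_curve b c (complex_of_real h) t0 (complex_of_real t)"
    using real_integral_curve_weierstrass[OF assms] by blast
next
  fix h
  show "\<exists>\<iota> (L :: complex fls set).
      foliation_extension (complex_of_real b) (complex_of_real c) (- 4) h \<iota> fls_deriv L"
    by (rule foliation_extension_exists) (simp add: assms)
  show "DGal D (range \<iota>) L \<cong> integer_mod_group 2"
    if "foliation_extension (complex_of_real b) (complex_of_real c) (- 4) h \<iota> D L"
    for \<iota> D and L :: "'l set"
    by (rule DGal_foliation[OF _ that]) (simp add: assms)
next
  fix T \<gamma> t0 K A
  assume T: "open T" "t0 \<in> T"
    and \<gamma>: "integral_curve_on (vfield (complex_of_real b) (complex_of_real c) (- 4)) T \<gamma>"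
    and K: "K = solution_field \<gamma> t0"
    and A: "A = variational_matrix (vfield (complex_of_real b) (complex_of_real c) (- 4)) \<gamma> t0"
  show "\<exists>L \<Phi>. picard_vessiot_linear fls_deriv K L A \<Phi>"
    by (rule variational_equation_galois(1)[OF T \<gamma> K A])
  fix \<iota> D \<Phi> and L :: "'l set"
  assume emb: "differential_embedding \<iota> fls_deriv K D L"
    and PV: "picard_vessiot_linear D (\<iota> ` K) L (map_matrix \<iota> A) \<Phi>"
  show "subgroup (identity_component D (\<iota> ` K) L \<Phi>) (DGal D (\<iota> ` K) L)"
    by (rule subgroup_identity_component[OF PV])
  show "comm_group ((DGal D (\<iota> ` K) L)\<lparr>carrier := identity_component D (\<iota> ` K) L \<Phi>\<rparr>)"
    by (rule variational_equation_galois(2)[OF T \<gamma> K A emb PV])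
qed

end
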